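(* Let $G$ be a finite simple graph with $n\ge 1$ vertices, let $-\infty<\alpha<\infty$ and $-\infty\le\beta<\infty$, and let $\xi(t)$ be the continuous-time Markov chain (CTMC) with parameters $\alpha,\beta,G$ described in the context. Let $\lambda_1(G)$ be the largest eigenvalue of the adjacency matrix of $G$, $\kappa(G)$ the independence number of $G$ and $e(G)$ the number of edges of $G$. (i) If $\alpha<0$ and $\alpha+\beta\lambda_1(G)<0$, then $\xi(t)$ is positive recurrent. (ii) $\xi(t)$ is null recurrent in the following cases: (a) $\alpha=0$, $\beta<0$ and $\kappa(G)\le 2$; (b) $\alpha=\beta=0$ and $n\le 2$; (c) $\alpha=0$, $\beta>0$, $e(G)=0$ and $n\le 2$. (iii) In all other cases $\xi(t)$ is transient. This means the cases: (a) $\alpha>0$; (b) $\alpha=0$, $\beta>0$ and $e(G)>0$; (c) $\alpha=0$, $\beta>0$, $e(G)=0$ and $n\ge 3$; (d) $\alpha=\beta=0$ and $n\ge 3$; (e) $\alpha=0$, $\beta<0$ and $\kappa(G)\ge 3$; (f) $\alpha<0$ and $\alpha+\beta\lambda_1(G)\ge 0$.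
   Context: $G$ is a finite undirected graph, not necessarily connected, with vertices $1,\dots,n$ and without self-loops or multiple edges; $A=(a_{ij})$ is its adjacency matrix, and $i\sim j$ means that $i$ and $j$ are adjacent. $\mathbb{Z}_+=\{0,1,2,\dots\}$ and $\mathbf e_i$ is the $i$-th unit vector. The independence number $\kappa(G)$ is the largest cardinality of a set of vertices no two of which are adjacent. The CTMC $\xi(t)=(\xi_1(t),\dots,\xi_n(t))\in\mathbb{Z}_+^n$ has transition rates $q_{\xi,\eta}$ given by $$q_{\xi,\xi+\mathbf e_i}=e^{\alpha\xi_i+\beta(A\xi)_i}=e^{\alpha\xi_i+\beta\sum_{j:\,j\sim i}\xi_j},\qquad q_{\xi,\xi-\mathbf e_i}=1 \ \text{ if } \xi_i>0,$$ and all other rates are $0$. Case $\beta=-\infty$ (hard-core interaction): the conventions $0\cdot\infty=0$ and $e^{-\infty}=0$ are used, so $\xi_i$ can increase only when $\xi_j=0$ for all $j\sim i$. In this case the chain is considered on the state space $\Gamma_0=\{\xi\in\mathbb{Z}_+^n:\ \xi_i\xi_j=0 \text{ whenever } i\sim j\}$, which is absorbing and on which the chain is irreducible. The convention $0\cdot\infty=0$ also applies to $\beta\lambda_1(G)$ (so $\alpha+\beta\lambda_1(G)=\alpha$ if $\beta=-\infty$ and $\lambda_1(G)=0$, and $=-\infty$ if $\beta=-\infty$ and $\lambda_1(G)>0$). The chain may be explosive (then it is considered up to the explosion time); recurrence and transience are understood as for the embedded jump chain, and positive/null recurrence is understood for the CTMC (finite/infinite expected return times). An explosive chain is transient. *)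

theory Defs
  imports "HOL-Probability.Probability"
begin

section \<open>Graphs\<close>

text \<open>A finite simple graph is given by its adjacency relation on a finite vertex type \<open>'v\<close>.\<close>

definition simple_graph :: "('v \<Rightarrow> 'v \<Rightarrow> bool) \<Rightarrow> bool" where
  "simple_graph E \<longleftrightarrow> symp E \<and> irreflp E"

definition edge_set :: "('v \<Rightarrow> 'v \<Rightarrow> bool) \<Rightarrow> 'v set set" where
  "edge_set E = {{i, j} |i j. E i j}"

definition edge_count :: "('v::finite \<Rightarrow> 'v \<Rightarrow> bool) \<Rightarrow> nat" where
  "edge_count E = card (edge_set E)"

definition independent_set :: "('v \<Rightarrow> 'v \<Rightarrow> bool) \<Rightarrow> 'v set \<Rightarrow> bool" where
  "independent_set E S \<longleftrightarrow> (\<forall>i\<in>S. \<forall>j\<in>S. \<not> E i j)"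

definition independence_number :: "('v::finite \<Rightarrow> 'v \<Rightarrow> bool) \<Rightarrow> nat" where
  "independence_number E = Max (card ` {S. independent_set E S})"

definition adjacency_matrix :: "('v::finite \<Rightarrow> 'v \<Rightarrow> bool) \<Rightarrow> real^'v^'v" where
  "adjacency_matrix E = (\<chi> i j. if E i j then 1 else 0)"

definition eigenvalues :: "real^'v^'v \<Rightarrow> real set" where
  "eigenvalues A = {l. \<exists>v. v \<noteq> 0 \<and> A *v v = l *\<^sub>R v}"

definition largest_eigenvalue :: "real^'v^'v \<Rightarrow> real" where
  "largest_eigenvalue A = Max (eigenvalues A)"


section \<open>Discrete-time Markov chains\<close>

text \<open>
  The law on path space of the Markov chain with transition kernel \<open>K\<close> started at \<open>x\<close>, obtained from
  the Ionescu-Tulcea construction: coordinate \<open>0\<close> is \<open>x\<close> and, given the first \<open>n\<close> coordinates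
  \<open>\<omega> 0, \<dots>, \<omega> (n - 1)\<close> with \<open>n > 0\<close>, coordinate \<open>n\<close> is distributed as \<open>K (\<omega> (n - 1))\<close>.
\<close>

definition chain_step :: "('s \<Rightarrow> 's pmf) \<Rightarrow> 's \<Rightarrow> nat \<Rightarrow> (nat \<Rightarrow> 's) \<Rightarrow> 's measure" where
  "chain_step K x n \<omega> = measure_pmf (if n = 0 then return_pmf x else K (\<omega> (n - 1)))"

definition chain_law :: "('s \<Rightarrow> 's pmf) \<Rightarrow> 's \<Rightarrow> (nat \<Rightarrow> 's) measure" where
  "chain_law K x =
     projective_family.lim UNIV (Ionescu_Tulcea.CI (chain_step K x) (\<lambda>_. count_space UNIV))
       (\<lambda>_. count_space UNIV)"

lemma Ionescu_Tulcea_chain_step: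
  fixes K :: "'s::countable \<Rightarrow> 's pmf"
  shows "Ionescu_Tulcea (chain_step K x) (\<lambda>_. count_space UNIV)"
proof (rule Ionescu_Tulcea.intro)
  fix i
  show "chain_step K x i \<in> PiM {0..<i} (\<lambda>_. count_space UNIV) \<rightarrow>\<^sub>M subprob_algebra (count_space UNIV)"
  proof (cases i)
    case 0
    then show ?thesis
      by (simp add: chain_step_def[abs_def] measure_pmf_in_subprob_space)
  next
    case (Suc j)
    have [measurable]: "(\<lambda>\<omega>. \<omega> j) \<in> PiM {0..<Suc j} (\<lambda>_. count_space (UNIV :: 's set)) \<rightarrow>\<^sub>M count_space UNIV"
      by (rule measurable_component_singleton) simp
    have [measurable]: "(\<lambda>y. measure_pmf (K y)) \<in> count_space UNIV \<rightarrow>\<^sub>M subprob_algebra (count_space UNIV)"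
      by (simp add: measure_pmf_in_subprob_space)
    show ?thesis
      unfolding Suc chain_step_def[abs_def] by simp
  qed
qed (simp add: chain_step_def measure_pmf.prob_space_axioms)

lemma emeasure_chain_law:
  fixes K :: "'s::countable \<Rightarrow> 's pmf"
  shows "emeasure (chain_law K x) {Y. \<forall>k\<le>n. Y k = y k} =
    (if y 0 = x then (\<Prod>k<n. ennreal (pmf (K (y k)) (y (Suc k)))) else 0)"
proof -
  interpret Ionescu_Tulcea "chain_step K x" "\<lambda>_. count_space (UNIV::'s set)"
    by (rule Ionescu_Tulcea_chain_step)
  let ?M = "\<lambda>_::nat. count_space (UNIV::'s set)"
  let ?A = "\<lambda>n. PiE {0..<n} (\<lambda>k. {y k})"
  have sA[measurable]: "?A n \<in> sets (PiM {0..<n} ?M)" for n by (rule sets_PiM_I_finite) auto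
  have "{Y. \<forall>k\<le>n. Y k = y k} = PF.emb UNIV {0..<Suc n} (?A (Suc n))"
    by (auto simp: prod_emb_def space_PiM PiE_iff less_Suc_eq_le)
  then have "emeasure (chain_law K x) {Y. \<forall>k\<le>n. Y k = y k} = C 0 (Suc n) (\<lambda>_. undefined) (?A (Suc n))"
  proof -
    assume *: "{Y. \<forall>k\<le>n. Y k = y k} = PF.emb UNIV {0..<Suc n} (?A (Suc n))"
    have **: "PF.emb {0..<Suc n} {0..<Suc n} (?A (Suc n)) = ?A (Suc n)"
      by (rule prod_emb_id) (simp add: PiE_mono)
    show ?thesis
      unfolding chain_law_def * lim[OF finite_atLeastLessThan sA] emeasure_CI[OF order_refl sA] ** ..
  qed
  also have "\<dots> = (if y 0 = x then (\<Prod>k<n. ennreal (pmf (K (y k)) (y (Suc k)))) else 0)"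
  proof (induction n)
    have C_space_ne: "space (C 0 m (\<lambda>_. undefined)) \<noteq> {}" for m
      by (rule prob_space.not_empty[OF prob_space_C]) simp
    have eq: "C 0 (Suc m) (\<lambda>_. undefined) (?A (Suc m)) =
       C 0 m (\<lambda>_. undefined) (?A m) * emeasure (chain_step K x m (restrict y {0..<m})) {y m}" for m
    proof -
      have "C 0 (Suc m) (\<lambda>_. undefined) (?A (Suc m)) =
        (\<integral>\<^sup>+\<omega>. emeasure (eP m \<omega>) (?A (Suc m)) \<partial>C 0 m (\<lambda>_. undefined))"
        unfolding C.simps add_0
        by (rule emeasure_bind[where N="PiM {0..<Suc m} ?M", OF _ _ sA])
           (simp_all add: space_C measurable_cong_sets[OF sets_C refl] measurable_eP C_space_ne)
      also have "\<dots> = (\<integral>\<^sup>+\<omega>. emeasure (chain_step K x m (restrict y {0..<m})) {y m} * indicator (?A m) \<omega> \<partial>C 0 m (\<lambda>_. undefined))"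
      proof (rule nn_integral_cong)
        fix \<omega> assume w: "\<omega> \<in> space (C 0 m (\<lambda>_. undefined))"
        then have w': "\<omega> \<in> space (PiM {0..<m} ?M)" by (simp add: space_C)
        have "(fun_upd \<omega> m) -` ?A (Suc m) \<inter> UNIV = (if \<omega> \<in> ?A m then {y m} else {})"
          using w' by (auto simp: PiE_iff space_PiM extensional_def less_Suc_eq split: if_splits)
        moreover have "\<omega> = restrict y {0..<m}" if "\<omega> \<in> ?A m"
          using that by (auto simp: PiE_iff extensional_def restrict_def fun_eq_iff)
        ultimately show "emeasure (eP m \<omega>) (?A (Suc m)) = emeasure (chain_step K x m (restrict y {0..<m})) {y m} * indicator (?A m) \<omega>"
          by (subst emeasure_eP[OF w' sA]) (auto split: split_indicator)
      qed
      also have "\<dots> = emeasure (chain_step K x m (restrict y {0..<m})) {y m} * C 0 m (\<lambda>_. undefined) (?A m)"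
        by (subst nn_integral_cmult_indicator) (auto simp: sets_C)
      finally show ?thesis by (simp add: mult.commute del: C.simps)
    qed
    {
      case 0
      show ?case
        by (subst eq) (auto simp: chain_step_def emeasure_pmf_single PiM_empty emeasure_return sets_return)
    next
      case (Suc n)
      show ?case
        by (subst eq, subst Suc) (auto simp: chain_step_def emeasure_pmf_single)
    }
  qed
  finally show ?thesis .
qed


section \<open>Continuous-time Markov chains with countable state space\<close>

text \<open>
  A chain is given by its transition rates \<open>q x y\<close> for \<open>x \<noteq> y\<close>, with \<open>q x x = 0\<close>.
  All states are assumed to have a positive and finite total exit rate, so there are no
  absorbing states.
\<close>

definition exit_rate :: "('s \<Rightarrow> 's \<Rightarrow> real) \<Rightarrow> 's \<Rightarrow> real" where
  "exit_rate q x = (\<Sum>\<^sub>\<infinity>y. q x y)"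

definition jump_kernel :: "('s \<Rightarrow> 's \<Rightarrow> real) \<Rightarrow> 's \<Rightarrow> 's pmf" where
  "jump_kernel q x = embed_pmf (\<lambda>y. q x y / exit_rate q x)"

text \<open>
  Jump chain/holding time construction: an outcome is a pair \<open>(Y, T)\<close> of a trajectory \<open>Y\<close> of the
  embedded jump chain and an independent i.i.d. sequence \<open>T\<close> of standard exponential variables; the
  chain stays in its \<open>n\<close>-th state \<open>Y n\<close> for the time \<open>T n / exit_rate q (Y n)\<close>.
\<close>

definition ctmc_law :: "('s \<Rightarrow> 's \<Rightarrow> real) \<Rightarrow> 's \<Rightarrow> ((nat \<Rightarrow> 's) \<times> (nat \<Rightarrow> real)) measure" where
  "ctmc_law q x =
     chain_law (jump_kernel q) x \<Otimes>\<^sub>M (\<Pi>\<^sub>M n\<in>UNIV. density lborel (exponential_density 1))"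

definition jump_time ::
    "('s \<Rightarrow> 's \<Rightarrow> real) \<Rightarrow> (nat \<Rightarrow> 's) \<times> (nat \<Rightarrow> real) \<Rightarrow> nat \<Rightarrow> real" where
  "jump_time q \<omega> n = (\<Sum>k<n. snd \<omega> k / exit_rate q (fst \<omega> k))"

text \<open>The state at time \<open>t\<close>; it is \<open>None\<close> from the explosion time on.\<close>

definition ctmc_state ::
    "('s \<Rightarrow> 's \<Rightarrow> real) \<Rightarrow> (nat \<Rightarrow> 's) \<times> (nat \<Rightarrow> real) \<Rightarrow> real \<Rightarrow> 's option" where
  "ctmc_state q \<omega> t =
     (if \<exists>n. jump_time q \<omega> n \<le> t \<and> t < jump_time q \<omega> (Suc n)
      then Some (fst \<omega> (LEAST n. jump_time q \<omega> n \<le> t \<and> t < jump_time q \<omega> (Suc n)))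
      else None)"

text \<open>The first time after the first jump at which the chain is in \<open>x\<close>; \<open>\<infinity>\<close> if there is none.\<close>

definition return_time ::
    "('s \<Rightarrow> 's \<Rightarrow> real) \<Rightarrow> 's \<Rightarrow> (nat \<Rightarrow> 's) \<times> (nat \<Rightarrow> real) \<Rightarrow> ennreal" where
  "return_time q x \<omega> =
     Inf (ennreal ` {t. jump_time q \<omega> 1 \<le> t \<and> ctmc_state q \<omega> t = Some x})"

definition expected_return_time :: "('s \<Rightarrow> 's \<Rightarrow> real) \<Rightarrow> 's \<Rightarrow> ennreal" where
  "expected_return_time q x = (\<integral>\<^sup>+\<omega>. return_time q x \<omega> \<partial>ctmc_law q x)"

definition return_probability :: "('s \<Rightarrow> 's \<Rightarrow> real) \<Rightarrow> 's \<Rightarrow> real" where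
  "return_probability q x =
     \<P>(Y in chain_law (jump_kernel q) x. \<exists>n\<ge>1. Y n = x)"

text \<open>
  Below, \<open>S\<close> is the (closed) set of states on which the chain is considered. Recurrence and transience
  refer to the embedded jump chain, positive and null recurrence to the continuous-time chain.
\<close>

definition recurrent_on :: "('s \<Rightarrow> 's \<Rightarrow> real) \<Rightarrow> 's set \<Rightarrow> bool" where
  "recurrent_on q S \<longleftrightarrow> (\<forall>x\<in>S. return_probability q x = 1)"

definition transient_on :: "('s \<Rightarrow> 's \<Rightarrow> real) \<Rightarrow> 's set \<Rightarrow> bool" where
  "transient_on q S \<longleftrightarrow> (\<forall>x\<in>S. return_probability q x < 1)"

definition positive_recurrent_on :: "('s \<Rightarrow> 's \<Rightarrow> real) \<Rightarrow> 's set \<Rightarrow> bool" where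
  "positive_recurrent_on q S \<longleftrightarrow> recurrent_on q S \<and> (\<forall>x\<in>S. expected_return_time q x < \<infinity>)"

definition null_recurrent_on :: "('s \<Rightarrow> 's \<Rightarrow> real) \<Rightarrow> 's set \<Rightarrow> bool" where
  "null_recurrent_on q S \<longleftrightarrow> recurrent_on q S \<and> (\<forall>x\<in>S. expected_return_time q x = \<infinity>)"


section \<open>The interacting birth-and-death chain on a graph\<close>

text \<open>
  The exponential with \<open>e^(-\<infinity>) = 0\<close>. Its value at \<open>\<infinity>\<close> is irrelevant, since \<open>\<beta> < \<infinity>\<close> throughout.
\<close>

definition exp_ereal :: "ereal \<Rightarrow> real" where
  "exp_ereal x = (if x = -\<infinity> then 0 else exp (real_of_ereal x))"

text \<open>The convention \<open>0 \<cdot> \<infinity> = 0\<close> is built into the multiplication on type \<^typ>\<open>ereal\<close>.\<close>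

definition birth_rate ::
    "real \<Rightarrow> ereal \<Rightarrow> ('v::finite \<Rightarrow> 'v \<Rightarrow> bool) \<Rightarrow> nat^'v \<Rightarrow> 'v \<Rightarrow> real" where
  "birth_rate \<alpha> \<beta> E \<xi> i =
     exp_ereal (ereal (\<alpha> * real (\<xi> $ i)) + \<beta> * ereal (\<Sum>j | E i j. real (\<xi> $ j)))"

text \<open>
  The unit vector \<open>e_i\<close> is \<^term>\<open>axis i 1\<close>. For each pair of states at most one summand below is
  nonzero.
\<close>

definition transition_rate ::
    "real \<Rightarrow> ereal \<Rightarrow> ('v::finite \<Rightarrow> 'v \<Rightarrow> bool) \<Rightarrow> nat^'v \<Rightarrow> nat^'v \<Rightarrow> real" where
  "transition_rate \<alpha> \<beta> E \<xi> \<eta> =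
     (\<Sum>i\<in>UNIV. if \<eta> = \<xi> + axis i 1 then birth_rate \<alpha> \<beta> E \<xi> i else 0) +
     (\<Sum>i\<in>UNIV. if \<xi> $ i > 0 \<and> \<eta> = \<xi> - axis i 1 then 1 else 0)"

definition state_space :: "ereal \<Rightarrow> ('v::finite \<Rightarrow> 'v \<Rightarrow> bool) \<Rightarrow> (nat^'v) set" where
  "state_space \<beta> E =
     (if \<beta> = -\<infinity> then {\<xi>. \<forall>i j. E i j \<longrightarrow> \<xi> $ i * \<xi> $ j = 0} else UNIV)"


text \<open>The rates are those prescribed, and \<^const>\<open>jump_kernel\<close> is well-defined for them.\<close>

lemma axis_inject_nat: "axis i (1::nat) = axis j 1 \<longleftrightarrow> i = j"
  by (auto simp: vec_eq_iff axis_def split: if_splits)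

lemma up_ne_down:
  fixes \<xi> :: "nat^'v::finite"
  assumes "\<xi> $ j > 0" shows "\<xi> + axis i 1 \<noteq> \<xi> - axis j 1"
proof
  assume "\<xi> + axis i 1 = \<xi> - axis j 1"
  then have "(\<xi> + axis i 1) $ j = (\<xi> - axis j 1) $ j" by simp
  with assms show False by simp
qed

lemma down_inject:
  fixes \<xi> :: "nat^'v::finite"
  assumes "\<xi> $ i > 0" "\<xi> $ j > 0" "\<xi> - axis i 1 = \<xi> - axis j 1" shows "i = j"
proof (rule ccontr)
  assume "i \<noteq> j"
  from assms have "(\<xi> - axis i 1) $ i = (\<xi> - axis j 1) $ i" by simp
  then have "\<xi> $ i - 1 = \<xi> $ i - (if i = j then 1 else 0)"
    by (simp add: axis_def)
  with assms \<open>i \<noteq> j\<close> show False by simp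
qed

lemma transition_rate_birth:
  "transition_rate \<alpha> \<beta> E \<xi> (\<xi> + axis i 1) = birth_rate \<alpha> \<beta> E \<xi> i"
proof -
  have "(\<Sum>j\<in>UNIV. if \<xi> + axis i 1 = \<xi> + axis j 1 then birth_rate \<alpha> \<beta> E \<xi> j else 0)
      = birth_rate \<alpha> \<beta> E \<xi> i" by (simp add: axis_inject_nat del: One_nat_def)
  moreover have "(\<Sum>j\<in>UNIV. if \<xi> $ j > 0 \<and> \<xi> + axis i 1 = \<xi> - axis j 1 then 1 else 0::real) = 0"
    by (rule sum.neutral) (use up_ne_down in auto)
  ultimately show ?thesis unfolding transition_rate_def by simp
qed

lemma transition_rate_death:
  assumes "\<xi> $ i > 0"
  shows "transition_rate \<alpha> \<beta> E \<xi> (\<xi> - axis i 1) = 1"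
proof -
  have "(\<Sum>j\<in>UNIV. if \<xi> - axis i 1 = \<xi> + axis j 1 then birth_rate \<alpha> \<beta> E \<xi> j else 0) = 0"
    by (rule sum.neutral) (use up_ne_down[OF assms, symmetric] in auto)
  moreover have "(\<Sum>j\<in>UNIV. if \<xi> $ j > 0 \<and> \<xi> - axis i 1 = \<xi> - axis j 1 then 1 else 0::real)
     = (\<Sum>j\<in>UNIV. if j = i then 1 else 0)"
    by (rule sum.cong) (use down_inject assms in auto)
  ultimately show ?thesis unfolding transition_rate_def by simp
qed

lemma transition_rate_other:
  assumes "\<And>i. \<eta> \<noteq> \<xi> + axis i 1" "\<And>i. \<xi> $ i > 0 \<Longrightarrow> \<eta> \<noteq> \<xi> - axis i 1"
  shows "transition_rate \<alpha> \<beta> E \<xi> \<eta> = 0"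
proof -
  have "(\<Sum>j\<in>UNIV. if \<xi> $ j > 0 \<and> \<eta> = \<xi> - axis j 1 then 1 else 0::real) = 0"
    by (rule sum.neutral) (use assms(2) in auto)
  then show ?thesis unfolding transition_rate_def by (simp add: assms(1) del: One_nat_def)
qed

lemma transition_rate_nonneg: "transition_rate \<alpha> \<beta> E \<xi> \<eta> \<ge> 0"
  unfolding transition_rate_def birth_rate_def exp_ereal_def
  by (intro add_nonneg_nonneg sum_nonneg) auto

lemma finite_transitions: "finite {\<eta>. transition_rate \<alpha> \<beta> E \<xi> \<eta> \<noteq> 0}"
proof (rule finite_subset)
  show "{\<eta>. transition_rate \<alpha> \<beta> E \<xi> \<eta> \<noteq> 0} \<subseteq> range (\<lambda>i. \<xi> + axis i 1) \<union> range (\<lambda>i. \<xi> - axis i 1)"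
    using transition_rate_other[of _ \<xi> \<alpha> \<beta> E] by blast
qed auto

lemma exit_rate_eq_sum:
  "exit_rate (transition_rate \<alpha> \<beta> E) \<xi> =
     (\<Sum>\<eta> | transition_rate \<alpha> \<beta> E \<xi> \<eta> \<noteq> 0. transition_rate \<alpha> \<beta> E \<xi> \<eta>)"
proof -
  have "exit_rate (transition_rate \<alpha> \<beta> E) \<xi> =
    (\<Sum>\<^sub>\<infinity>\<eta>\<in>{\<eta>. transition_rate \<alpha> \<beta> E \<xi> \<eta> \<noteq> 0}. transition_rate \<alpha> \<beta> E \<xi> \<eta>)"
    unfolding exit_rate_def by (rule infsum_cong_neutral) auto
  also have "\<dots> = (\<Sum>\<eta> | transition_rate \<alpha> \<beta> E \<xi> \<eta> \<noteq> 0. transition_rate \<alpha> \<beta> E \<xi> \<eta>)"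
    by (rule infsum_finite[OF finite_transitions])
  finally show ?thesis .
qed

lemma exit_rate_pos: "exit_rate (transition_rate \<alpha> \<beta> E) \<xi> > 0"
proof -
  have "\<exists>\<eta>. transition_rate \<alpha> \<beta> E \<xi> \<eta> \<noteq> 0"
  proof (cases "\<exists>i. \<xi> $ i > 0")
    case True
    then show ?thesis using transition_rate_death by (metis zero_neq_one)
  next
    case False
    then have "birth_rate \<alpha> \<beta> E \<xi> undefined \<noteq> 0"
      by (simp add: birth_rate_def exp_ereal_def zero_ereal_def[symmetric])
    then show ?thesis using transition_rate_birth by metis
  qed
  then show ?thesis
    unfolding exit_rate_eq_sum
    by (intro sum_pos finite_transitions) (auto simp: less_le transition_rate_nonneg)
qed

lemma pmf_jump_kernel:
  "pmf (jump_kernel (transition_rate \<alpha> \<beta> E) \<xi>) \<eta> =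
     transition_rate \<alpha> \<beta> E \<xi> \<eta> / exit_rate (transition_rate \<alpha> \<beta> E) \<xi>"
proof -
  let ?q = "transition_rate \<alpha> \<beta> E" and ?S = "{\<eta>. transition_rate \<alpha> \<beta> E \<xi> \<eta> \<noteq> 0}"
  have "(\<integral>\<^sup>+\<eta>. ennreal (?q \<xi> \<eta> / exit_rate ?q \<xi>) \<partial>count_space UNIV) =
        (\<Sum>\<eta>\<in>?S. ennreal (?q \<xi> \<eta> / exit_rate ?q \<xi>))"
    by (rule nn_integral_count_space') (auto simp: finite_transitions)
  also have "\<dots> = ennreal ((\<Sum>\<eta>\<in>?S. ?q \<xi> \<eta>) / exit_rate ?q \<xi>)"
    by (subst sum_ennreal)
       (auto simp: sum_divide_distrib transition_rate_nonneg less_imp_le[OF exit_rate_pos])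
  also have "\<dots> = 1"
    using exit_rate_pos[of \<alpha> \<beta> E \<xi>] by (simp add: exit_rate_eq_sum[symmetric])
  finally show ?thesis
    unfolding jump_kernel_def
    by (intro pmf_embed_pmf) (auto simp: transition_rate_nonneg less_imp_le[OF exit_rate_pos])
qed
end

theory Submission
  imports Defs
begin

text \<open>
The chain is reversible. Let
\<open>w \<xi> = exp (\<alpha>/2 \<Sum>\<^sub>i \<xi>\<^sub>i (\<xi>\<^sub>i - 1)) * e^(\<beta> \<Sum>\<^sub>{i~j} \<xi>\<^sub>i \<xi>\<^sub>j)\<close>, where the last sum runs over the edges. Raising \<open>\<xi>\<^sub>i\<close> by one
multiplies \<open>w\<close> by exactly the birth rate, and all death rates are \<open>1\<close>. Hence the jump chain is the random
walk on the electrical network in which the edge between \<open>\<xi>\<close> and \<open>\<xi> + e\<^sub>i\<close> has conductance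
\<open>w (\<xi> + e\<^sub>i)\<close>. With \<open>e^(-\<infinity>) = 0\<close> and \<open>0^0 = 1\<close> this includes the hard-core case, in which \<open>w\<close>
vanishes outside the state space.

Recurrence is decided by the Dirichlet energy \<open>\<E> f = 1/2 \<Sum> c(x,y) (f x - f y)\<^sup>2\<close>. Fix a state \<open>r\<close>, let
\<open>m(r)\<close> be its mass under the invariant measure of the jump chain, and let \<open>h\<^sub>n x\<close> be the probability to hit \<open>r\<close>
from \<open>x\<close> within \<open>n\<close> steps. The functions \<open>h\<^sub>n\<close> have finite support, \<open>h\<^sub>n r = 1\<close>, and away from \<open>r\<close> the
mean of \<open>h\<^sub>n\<close> over one step is \<open>h\<^sub>n\<^sub>+\<^sub>1 \<ge> h\<^sub>n\<close>; so Green's identity gives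
\<open>\<E> h\<^sub>n \<le> m(r) * P\<^sub>r(no return within n + 1 steps)\<close>. Two conclusions follow.
 \<^item> If \<open>(f r)\<^sup>2 \<le> C * \<E> f\<close> for all finitely supported \<open>f\<close>, then the return probability is less than \<open>1\<close>
   (\<open>return_prob_less_1\<close>). By Cauchy-Schwarz such an inequality follows from a unit flow from \<open>r\<close> to
   infinity that has finite energy (\<open>finite_resistance_if_flow\<close>).
 \<^item> Pairing a finitely supported \<open>f\<close> with \<open>h\<^sub>n\<close> and letting \<open>n\<close> grow yields
   \<open>m(r) * P\<^sub>r(no return) * (f r)\<^sup>2 \<le> \<E> f\<close> (\<open>escape_le_energy\<close>), so test functions of small energy
   force recurrence. If the conductances between the levels \<open>k - 1\<close> and \<open>k\<close> sum to \<open>O(k)\<close>, logarithmic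
   test functions do this (\<open>return_prob_eq_1_if_linear_cuts\<close>).

Positive and null recurrence are separated by the formula
\<open>E\<^sub>r[return time] = \<Sum>\<^sub>y w y * P\<^sub>y(hit r) / m(r)\<close> (\<open>expected_return_time_eq\<close>), which comes from reversing the
trajectories between two visits to \<open>r\<close>.

It remains to estimate \<open>w\<close>.
 \<^item> If \<open>\<alpha> < 0\<close> and \<open>\<alpha> + \<beta> \<lambda>\<^sub>1 < 0\<close>, then \<open>w\<close> has Gaussian decay by the Rayleigh principle, so the levels
   have bounded weight and the total weight is finite.
 \<^item> In the null recurrent cases \<open>w\<close> decays geometrically in the number of particles outside some pair of
   vertices: if \<open>\<beta> < 0\<close> and \<open>\<kappa> \<le> 2\<close>, the pair can be chosen such that every vertex outside it has a
   neighbour in it with at least as many particles (\<open>dominating_pair\<close>). Hence level \<open>k\<close> has weight \<open>O(k)\<close>,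
   but the coordinate axes already have infinite weight.
 \<^item> If \<open>\<alpha> > 0\<close>, or \<open>\<alpha> = 0 < \<beta>\<close> and there is an edge, or \<open>\<alpha> < 0 \<le> \<alpha> + \<beta> \<lambda>\<^sub>1\<close>, then \<open>w\<close> grows
   exponentially along a lattice path: an axis, the diagonal of an edge, or a path that follows the Perron
   eigenvector within bounded distance. The unit flow along that path has finite energy.
 \<^item> If \<open>\<alpha> = 0\<close> and three vertices do not interact, then \<open>w = 1\<close> on a three-dimensional octant. Polya's urn
   with three colours is a flow there; it is uniform on each level, so the energy in level \<open>m\<close> is
   at most \<open>2 / ((m + 1) (m + 2))\<close>.
\<close>

section \<open>The Markov property of the path measure\<close>

lemma sets_chain_law [measurable_cong]:
  fixes K :: "'s::countable \<Rightarrow> 's pmf"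
  shows "sets (chain_law K x) = sets (PiM UNIV (\<lambda>_. count_space UNIV))"
proof -
  interpret Ionescu_Tulcea "chain_step K x" "\<lambda>_. count_space (UNIV::'s set)"
    by (rule Ionescu_Tulcea_chain_step)
  show ?thesis unfolding chain_law_def by simp
qed

lemma space_chain_law [simp]:
  fixes K :: "'s::countable \<Rightarrow> 's pmf"
  shows "space (chain_law K x) = UNIV"
  using sets_eq_imp_space_eq[OF sets_chain_law[of K x]] by (simp add: space_PiM)

lemma measurable_coordinate_chain_law [measurable]:
  fixes K :: "'s::countable \<Rightarrow> 's pmf"
  shows "(\<lambda>Y. Y k) \<in> chain_law K x \<rightarrow>\<^sub>M count_space UNIV"
proof -
  have "(\<lambda>Y. Y k) \<in> PiM UNIV (\<lambda>_. count_space (UNIV::'s set)) \<rightarrow>\<^sub>M count_space UNIV"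
    by (rule measurable_component_singleton) simp
  then show ?thesis by (simp add: measurable_cong_sets[OF sets_chain_law refl])
qed

lemma prob_space_chain_law:
  fixes K :: "'s::countable \<Rightarrow> 's pmf"
  shows "prob_space (chain_law K x)"
proof
  have "space (chain_law K x) = (\<Union>s. {Y. Y 0 = s})" by auto
  then have "emeasure (chain_law K x) (space (chain_law K x)) =
      (\<integral>\<^sup>+s. emeasure (chain_law K x) {Y. Y 0 = s} \<partial>count_space UNIV)"
  proof (simp only:, intro emeasure_UN_countable)
    show "{Y. Y 0 = s} \<in> sets (chain_law K x)" for s
    proof -
      have "{Y \<in> space (chain_law K x). Y 0 = s} \<in> sets (chain_law K x)" by measurable
      then show ?thesis by simp
    qed
  qed (auto simp: disjoint_family_on_def)
  also have "\<dots> = (\<integral>\<^sup>+s. indicator {x} s \<partial>count_space UNIV)"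
  proof (rule nn_integral_cong)
    fix s
    show "emeasure (chain_law K x) {Y. Y 0 = s} = indicator {x} s"
      using emeasure_chain_law[of K x 0 "\<lambda>_. s"] by (auto simp: indicator_def)
  qed
  also have "\<dots> = 1" by (subst nn_integral_indicator) auto
  finally show "emeasure (chain_law K x) (space (chain_law K x)) = 1" .
qed

text \<open>
Events that depend on the coordinates \<open>0, \<dots>, n\<close> only; they are countable unions of cylinders, whose
probabilities are known.
\<close>

definition determined_by_prefix :: "nat \<Rightarrow> (nat \<Rightarrow> 's) set \<Rightarrow> bool" where
  "determined_by_prefix n A \<longleftrightarrow> (\<forall>Y Y'. (\<forall>k\<le>n. Y k = Y' k) \<longrightarrow> (Y \<in> A \<longleftrightarrow> Y' \<in> A))"

lemma measurable_prefix_cylinder: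
  fixes K :: "'s::countable \<Rightarrow> 's pmf"
  shows "{Y. \<forall>k\<le>n. Y k = y k} \<in> sets (chain_law K x)"
proof -
  have "{Y \<in> space (chain_law K x). \<forall>k\<in>{..n}. Y k = y k} \<in> sets (chain_law K x)" by measurable
  then show ?thesis by (simp add: Ball_def)
qed

lemma determined_by_prefix_cylinders:
  fixes A :: "(nat \<Rightarrow> 's) set"
  assumes "determined_by_prefix n A"
  defines "I \<equiv> (\<lambda>Y. map Y [0..<Suc n]) ` A"
  shows "A = (\<Union>l\<in>I. {Y. \<forall>k\<le>n. Y k = l ! k})" "disjoint_family_on (\<lambda>l. {Y. \<forall>k\<le>n. Y k = l ! k}) I"
proof -
  have nth: "map Y [0..<Suc n] ! k = Y k" if "k \<le> n" for Y :: "nat \<Rightarrow> 's" and k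
    using that by (simp del: upt_Suc)
  show "A = (\<Union>l\<in>I. {Y. \<forall>k\<le>n. Y k = l ! k})"
  proof (intro equalityI subsetI)
    fix Y assume "Y \<in> A"
    then show "Y \<in> (\<Union>l\<in>I. {Y. \<forall>k\<le>n. Y k = l ! k})"
      unfolding I_def by (intro UN_I[of "map Y [0..<Suc n]"]) (auto simp: nth simp del: upt_Suc)
  next
    fix Y assume "Y \<in> (\<Union>l\<in>I. {Y. \<forall>k\<le>n. Y k = l ! k})"
    then obtain Z where "Z \<in> A" "\<And>k. k \<le> n \<Longrightarrow> Y k = Z k"
      unfolding I_def by (auto simp: nth simp del: upt_Suc)
    then show "Y \<in> A" using assms(1) unfolding determined_by_prefix_def by blast
  qed
  show "disjoint_family_on (\<lambda>l. {Y. \<forall>k\<le>n. Y k = l ! k}) I"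
    unfolding disjoint_family_on_def
  proof (intro ballI impI)
    fix l l' assume "l \<in> I" "l' \<in> I" "l \<noteq> l'"
    have "length l = Suc n" "length l' = Suc n"
      using \<open>l \<in> I\<close> \<open>l' \<in> I\<close> unfolding I_def by auto
    then have "\<exists>k\<le>n. l ! k \<noteq> l' ! k"
      using \<open>l \<noteq> l'\<close> nth_equalityI[of l l'] by (metis less_Suc_eq_le)
    then show "{Y. \<forall>k\<le>n. Y k = l ! k} \<inter> {Y. \<forall>k\<le>n. Y k = l' ! k} = {}" by auto
  qed
qed

lemma determined_by_prefix_measurable:
  fixes K :: "'s::countable \<Rightarrow> 's pmf"
  assumes "determined_by_prefix n A"
  shows "A \<in> sets (chain_law K x)"
  by (subst determined_by_prefix_cylinders(1)[OF assms], rule sets.countable_UN')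
     (auto intro: measurable_prefix_cylinder countable_subset[OF subset_UNIV])

text \<open>
The Markov property at time \<open>n\<close>: decompose \<open>A\<close> into cylinders, for each of which the product formula
for the probability splits off its last factor.
\<close>

lemma chain_law_last_step:
  fixes K :: "'s::countable \<Rightarrow> 's pmf"
  assumes A: "determined_by_prefix n A" and last: "\<And>Y. Y \<in> A \<Longrightarrow> Y n = z"
  shows "emeasure (chain_law K x) (A \<inter> {Y. Y (Suc n) = y}) =
         emeasure (chain_law K x) A * ennreal (pmf (K z) y)"
proof -
  define I where "I = (\<lambda>Y. map Y [0..<Suc n]) ` A"
  define C where "C l = {Y. \<forall>k\<le>n. Y k = l ! k}" for l :: "'s list"
  note cyl = determined_by_prefix_cylinders[OF A, folded I_def]
  have C_sets: "C l \<in> sets (chain_law K x)" for l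
    unfolding C_def by (rule measurable_prefix_cylinder)
  have y_sets: "{Y. Y (Suc n) = y} \<in> sets (chain_law K x)"
  proof -
    have "{Y \<in> space (chain_law K x). Y (Suc n) = y} \<in> sets (chain_law K x)" by measurable
    then show ?thesis by simp
  qed
  have I_count: "countable I" by (rule countable_subset[OF subset_UNIV]) simp
  have disj: "disjoint_family_on (\<lambda>l. C l \<inter> {Y. Y (Suc n) = y}) I"
    using cyl(2) unfolding disjoint_family_on_def C_def by blast
  have "A \<inter> {Y. Y (Suc n) = y} = (\<Union>l\<in>I. C l \<inter> {Y. Y (Suc n) = y})"
    using cyl(1) unfolding C_def by blast
  then have "emeasure (chain_law K x) (A \<inter> {Y. Y (Suc n) = y}) =
      (\<integral>\<^sup>+l. emeasure (chain_law K x) (C l \<inter> {Y. Y (Suc n) = y}) \<partial>count_space I)"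
    using emeasure_UN_countable[OF _ I_count disj, of "chain_law K x"] C_sets y_sets by simp
  also have "\<dots> = (\<integral>\<^sup>+l. emeasure (chain_law K x) (C l) * ennreal (pmf (K z) y) \<partial>count_space I)"
  proof (rule nn_integral_cong)
    fix l assume "l \<in> space (count_space I)"
    then have l: "length l = Suc n" "l ! n = z"
      unfolding I_def by (auto simp: last nth_append)
    let ?w = "\<lambda>k. (l @ [y]) ! k"
    have w: "?w k = l ! k" if "k \<le> n" for k using that l by (simp add: nth_append)
    have wn: "?w (Suc n) = y" using l(1) by (metis nth_append_length)
    have eq: "C l \<inter> {Y. Y (Suc n) = y} = {Y. \<forall>k\<le>Suc n. Y k = ?w k}" "C l = {Y. \<forall>k\<le>n. Y k = ?w k}"
      unfolding C_def by (auto simp: le_Suc_eq w wn)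
    show "emeasure (chain_law K x) (C l \<inter> {Y. Y (Suc n) = y}) =
        emeasure (chain_law K x) (C l) * ennreal (pmf (K z) y)"
      unfolding eq(1) unfolding eq(2) emeasure_chain_law using w[of n] wn l by simp
  qed
  also have "\<dots> = (\<integral>\<^sup>+l. emeasure (chain_law K x) (C l) \<partial>count_space I) * ennreal (pmf (K z) y)"
    by (rule nn_integral_multc) simp
  also have "(\<integral>\<^sup>+l. emeasure (chain_law K x) (C l) \<partial>count_space I) = emeasure (chain_law K x) A"
  proof -
    have "emeasure (chain_law K x) (\<Union>l\<in>I. C l) = (\<integral>\<^sup>+l. emeasure (chain_law K x) (C l) \<partial>count_space I)"
      using cyl(2) by (intro emeasure_UN_countable C_sets I_count) (auto simp: C_def)
    moreover have "(\<Union>l\<in>I. C l) = A" using cyl(1) by (simp add: C_def)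
    ultimately show ?thesis by simp
  qed
  finally show ?thesis .
qed

text \<open>
The trajectories that are in \<open>y\<close> at time \<open>n\<close> and have not visited \<open>x\<close> at the times \<open>1, \<dots>, n\<close>. Time
\<open>0\<close> is left out because the chain starts in \<open>x\<close>.
\<close>

definition away :: "'s \<Rightarrow> nat \<Rightarrow> 's \<Rightarrow> (nat \<Rightarrow> 's) set" where
  "away x n y = {Y. Y n = y \<and> (\<forall>j. 0 < j \<and> j \<le> n \<longrightarrow> Y j \<noteq> x)}"

lemma determined_by_prefix_away: "determined_by_prefix n (away x n y)"
  unfolding determined_by_prefix_def away_def by auto

lemma away_measurable [measurable]:
  fixes K :: "'s::countable \<Rightarrow> 's pmf"
  shows "away x n y \<in> sets (chain_law K x')"
  by (rule determined_by_prefix_measurable[OF determined_by_prefix_away])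

lemma emeasure_away_step:
  fixes K :: "'s::countable \<Rightarrow> 's pmf"
  shows "emeasure (chain_law K x) {Y. Y (Suc n) = y \<and> (\<forall>j. 0 < j \<and> j \<le> n \<longrightarrow> Y j \<noteq> x)} =
    (\<integral>\<^sup>+z. emeasure (chain_law K x) (away x n z) * ennreal (pmf (K z) y) \<partial>count_space UNIV)"
proof -
  have "{Y. Y (Suc n) = y \<and> (\<forall>j. 0 < j \<and> j \<le> n \<longrightarrow> Y j \<noteq> x)} = (\<Union>z. away x n z \<inter> {Y. Y (Suc n) = y})"
    unfolding away_def by auto
  moreover have "emeasure (chain_law K x) (\<Union>z. away x n z \<inter> {Y. Y (Suc n) = y}) =
      (\<integral>\<^sup>+z. emeasure (chain_law K x) (away x n z \<inter> {Y. Y (Suc n) = y}) \<partial>count_space UNIV)"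
  proof (rule emeasure_UN_countable)
    show "away x n z \<inter> {Y. Y (Suc n) = y} \<in> sets (chain_law K x)" for z
      by (rule determined_by_prefix_measurable[of "Suc n"])
         (auto simp: determined_by_prefix_def away_def)
  qed (auto simp: disjoint_family_on_def away_def)
  moreover have "emeasure (chain_law K x) (away x n z \<inter> {Y. Y (Suc n) = y}) =
      emeasure (chain_law K x) (away x n z) * ennreal (pmf (K z) y)" for z
    by (rule chain_law_last_step[OF determined_by_prefix_away]) (simp add: away_def)
  ultimately show ?thesis by simp
qed


section \<open>Reversible chains as electrical networks\<close>

text \<open>
A chain whose rates are in detailed balance with a weight \<open>w\<close>. The weight may vanish: the hard-core chain
is treated on all of the lattice, with \<open>w = 0\<close> outside its state space. Each state has finitely many
neighbours in both directions, so that means and energies are finite sums.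
\<close>

locale reversible_chain =
  fixes q :: "'s::countable \<Rightarrow> 's \<Rightarrow> real" and w :: "'s \<Rightarrow> real"
  assumes rate_nonneg: "q x y \<ge> 0"
    and finite_neighbours: "finite {y. q x y \<noteq> 0 \<or> q y x \<noteq> 0}"
    and exit_rate_positive: "exit_rate q x > 0"
    and weight_nonneg: "w x \<ge> 0"
    and detailed_balance: "w x * q x y = w y * q y x"
    and pmf_jump: "pmf (jump_kernel q x) y = q x y / exit_rate q x"
begin

definition nbrs :: "'s \<Rightarrow> 's set" where
  "nbrs x = {y. q x y \<noteq> 0 \<or> q y x \<noteq> 0}"

definition step_prob :: "'s \<Rightarrow> 's \<Rightarrow> real" where
  "step_prob x y = q x y / exit_rate q x"

definition conductance :: "'s \<Rightarrow> 's \<Rightarrow> real" where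
  "conductance x y = w x * q x y"

definition mean :: "('s \<Rightarrow> real) \<Rightarrow> 's \<Rightarrow> real" where
  "mean f x = (\<Sum>y\<in>nbrs x. step_prob x y * f y)"

text \<open>
The invariant measure of the jump chain, which is also the sum of the conductances at \<open>x\<close>.
\<close>

definition mass :: "'s \<Rightarrow> real" where
  "mass x = w x * exit_rate q x"

lemma finite_nbrs [simp]: "finite (nbrs x)"
  unfolding nbrs_def by (rule finite_neighbours)

lemma nbrs_sym: "y \<in> nbrs x \<longleftrightarrow> x \<in> nbrs y"
  unfolding nbrs_def by auto

lemma conductance_sym: "conductance x y = conductance y x"
  unfolding conductance_def by (rule detailed_balance)

lemma conductance_nonneg [simp]: "conductance x y \<ge> 0"
  unfolding conductance_def by (simp add: weight_nonneg rate_nonneg)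

lemma conductance_outside: "y \<notin> nbrs x \<Longrightarrow> conductance x y = 0"
  unfolding conductance_def nbrs_def by simp

lemma exit_rate_sum: "exit_rate q x = (\<Sum>y\<in>nbrs x. q x y)"
proof -
  have "exit_rate q x = (\<Sum>\<^sub>\<infinity>y\<in>nbrs x. q x y)"
    unfolding exit_rate_def by (rule infsum_cong_neutral) (auto simp: nbrs_def)
  then show ?thesis by simp
qed

lemma step_prob_nonneg [simp]: "step_prob x y \<ge> 0"
  unfolding step_prob_def using exit_rate_positive[of x] by (simp add: rate_nonneg)

lemma step_prob_sum: "(\<Sum>y\<in>nbrs x. step_prob x y) = 1"
  unfolding step_prob_def using exit_rate_positive[of x]
  by (simp add: sum_divide_distrib[symmetric] exit_rate_sum[symmetric])

lemma mass_step_prob: "mass x * step_prob x y = conductance x y"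
  unfolding mass_def step_prob_def conductance_def using exit_rate_positive[of x] by simp

lemma mass_nonneg: "mass x \<ge> 0"
  unfolding mass_def using exit_rate_positive[of x] weight_nonneg[of x] by simp

lemma mean_mono: "(\<And>y. f y \<le> g y) \<Longrightarrow> mean f x \<le> mean g x"
  unfolding mean_def by (intro sum_mono mult_left_mono) auto

lemma mean_const: "mean (\<lambda>_. a) x = a"
  unfolding mean_def by (simp add: sum_distrib_right[symmetric] step_prob_sum)

lemma sum_conductance_diff:
  "(\<Sum>y\<in>nbrs x. conductance x y * (g x - g y)) = mass x * (g x - mean g x)"
proof -
  have "(\<Sum>y\<in>nbrs x. conductance x y * (g x - g y)) = mass x * (\<Sum>y\<in>nbrs x. step_prob x y * (g x - g y))"
    by (simp add: sum_distrib_left mass_step_prob[symmetric] mult.assoc)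
  also have "(\<Sum>y\<in>nbrs x. step_prob x y * (g x - g y)) = g x - mean g x"
    unfolding mean_def
    by (simp add: right_diff_distrib sum_subtractf sum_distrib_right[symmetric] step_prob_sum)
  finally show ?thesis .
qed


section \<open>The Dirichlet form\<close>

text \<open>
For finitely supported \<open>f\<close> the Dirichlet form is the same over every finite set \<open>F\<close> that contains the support of \<open>f\<close> and
its neighbours, so it is restricted to such sets and no infinite sum arises.
\<close>

definition dirichlet_form :: "'s set \<Rightarrow> ('s \<Rightarrow> real) \<Rightarrow> ('s \<Rightarrow> real) \<Rightarrow> real" where
  "dirichlet_form F f g = (\<Sum>x\<in>F. \<Sum>y\<in>F. conductance x y * (f x - f y) * (g x - g y)) / 2"

abbreviation energy :: "'s set \<Rightarrow> ('s \<Rightarrow> real) \<Rightarrow> real" where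
  "energy F f \<equiv> dirichlet_form F f f"

definition supported :: "'s set \<Rightarrow> ('s \<Rightarrow> real) \<Rightarrow> bool" where
  "supported F f \<longleftrightarrow> finite F \<and> (\<forall>x. f x \<noteq> 0 \<longrightarrow> x \<in> F \<and> nbrs x \<subseteq> F)"

lemma supported_exists:
  assumes "finite A" "finite {x. f x \<noteq> 0}"
  obtains F where "supported F f" "A \<subseteq> F"
proof
  show "supported (A \<union> {x. f x \<noteq> 0} \<union> (\<Union>x\<in>{x. f x \<noteq> 0}. nbrs x)) f"
    unfolding supported_def using assms by auto
qed auto

text \<open>
Summation by parts: as \<open>conductance\<close> is symmetric, the contributions of \<open>f x\<close> and of \<open>- f y\<close> are equal.
\<close>

lemma green_identity:
  assumes F: "supported F f"
  shows "dirichlet_form F f g = (\<Sum>x\<in>F. f x * mass x * (g x - mean g x))"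
proof -
  let ?S = "\<Sum>x\<in>F. \<Sum>y\<in>F. conductance x y * f x * (g x - g y)"
  have "(\<Sum>x\<in>F. \<Sum>y\<in>F. conductance x y * f y * (g x - g y)) = (\<Sum>y\<in>F. \<Sum>x\<in>F. conductance x y * f y * (g x - g y))"
    by (rule sum.swap)
  also have "\<dots> = - ?S"
    by (simp add: sum_negf[symmetric] conductance_sym algebra_simps)
  finally have "(\<Sum>x\<in>F. \<Sum>y\<in>F. conductance x y * f y * (g x - g y)) = - ?S" .
  moreover have "(\<Sum>x\<in>F. \<Sum>y\<in>F. conductance x y * (f x - f y) * (g x - g y)) =
      ?S - (\<Sum>x\<in>F. \<Sum>y\<in>F. conductance x y * f y * (g x - g y))"
    unfolding sum_subtractf[symmetric]
    by (intro sum.cong refl) (simp only: right_diff_distrib left_diff_distrib)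
  ultimately have "dirichlet_form F f g = ?S"
    unfolding dirichlet_form_def by simp
  also have "\<dots> = (\<Sum>x\<in>F. f x * mass x * (g x - mean g x))"
  proof (rule sum.cong[OF refl])
    fix x assume "x \<in> F"
    show "(\<Sum>y\<in>F. conductance x y * f x * (g x - g y)) = f x * mass x * (g x - mean g x)"
    proof (cases "f x = 0")
      case False
      then have "nbrs x \<subseteq> F" "finite F" using F unfolding supported_def by auto
      then have "(\<Sum>y\<in>F. conductance x y * f x * (g x - g y)) = (\<Sum>y\<in>nbrs x. conductance x y * f x * (g x - g y))"
        by (intro sum.mono_neutral_right) (auto simp: conductance_outside)
      also have "\<dots> = f x * (\<Sum>y\<in>nbrs x. conductance x y * (g x - g y))"
        by (simp add: sum_distrib_left mult_ac)
      finally show ?thesis by (simp add: sum_conductance_diff)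
    qed simp
  qed
  finally show ?thesis .
qed

lemma energy_as_sum: "energy F f = (\<Sum>x\<in>F. \<Sum>y\<in>F. conductance x y * (f x - f y)\<^sup>2) / 2"
  unfolding dirichlet_form_def by (simp add: power2_eq_square mult.assoc)

lemma energy_nonneg: "energy F f \<ge> 0"
  unfolding energy_as_sum by (intro divide_nonneg_nonneg sum_nonneg) auto

lemma energy_mono: "finite F' \<Longrightarrow> F \<subseteq> F' \<Longrightarrow> energy F f \<le> energy F' f"
  unfolding energy_as_sum sum.cartesian_product
  by (intro divide_right_mono sum_mono2) auto

lemma dirichlet_form_cauchy_schwarz: "(dirichlet_form F f g)\<^sup>2 \<le> energy F f * energy F g"
proof -
  let ?P = "F \<times> F"
  let ?u = "\<lambda>(x,y). sqrt (conductance x y) * (f x - f y)" and ?v = "\<lambda>(x,y). sqrt (conductance x y) * (g x - g y)"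
  have "(\<Sum>p\<in>?P. ?u p * ?v p)\<^sup>2 \<le> (\<Sum>p\<in>?P. (?u p)\<^sup>2) * (\<Sum>p\<in>?P. (?v p)\<^sup>2)"
    by (rule Cauchy_Schwarz_ineq_sum)
  moreover have "?u p * ?v p = (\<lambda>(x,y). conductance x y * (f x - f y) * (g x - g y)) p" for p
  proof (cases p)
    case (Pair x y)
    have "?u (x, y) * ?v (x, y) = (sqrt (conductance x y) * sqrt (conductance x y)) * (f x - f y) * (g x - g y)"
      by (simp only: case_prod_conv mult_ac)
    then show ?thesis using Pair by simp
  qed
  moreover have "(?u p)\<^sup>2 = (\<lambda>(x,y). conductance x y * (f x - f y)\<^sup>2) p"
      "(?v p)\<^sup>2 = (\<lambda>(x,y). conductance x y * (g x - g y)\<^sup>2) p" for p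
    by (cases p; simp add: power_mult_distrib)+
  ultimately show ?thesis
    unfolding energy_as_sum dirichlet_form_def sum.cartesian_product
    by (simp add: power_divide) 
qed


section \<open>Hitting probabilities\<close>

text \<open>
The probability that a walk started in \<open>y\<close> is in \<open>r\<close> at time \<open>k\<close> for the first time (time \<open>0\<close> included),
given by the recursion over the first step.
\<close>

primrec first_hit :: "'s \<Rightarrow> nat \<Rightarrow> 's \<Rightarrow> real" where
  "first_hit r 0 = (\<lambda>y. if y = r then 1 else 0)"
| "first_hit r (Suc k) = (\<lambda>y. if y = r then 0 else mean (first_hit r k) y)"

definition hit_within :: "'s \<Rightarrow> nat \<Rightarrow> 's \<Rightarrow> real" where
  "hit_within r n y = (\<Sum>k\<le>n. first_hit r k y)"

lemma mean_sum: "mean (\<lambda>y. \<Sum>k\<in>A. f k y) x = (\<Sum>k\<in>A. mean (f k) x)"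
  unfolding mean_def by (simp add: sum_distrib_left) (rule sum.swap)

lemma first_hit_nonneg [simp]: "first_hit r k y \<ge> 0"
proof (induction k arbitrary: y)
  case (Suc k)
  have "0 \<le> mean (first_hit r k) y"
    unfolding mean_def by (intro sum_nonneg mult_nonneg_nonneg step_prob_nonneg Suc)
  then show ?case by simp
qed simp

lemma hit_within_root [simp]: "hit_within r n r = 1"
  unfolding hit_within_def by (induction n) auto

lemma hit_within_Suc: "y \<noteq> r \<Longrightarrow> hit_within r (Suc n) y = mean (hit_within r n) y"
  unfolding hit_within_def mean_sum sum.atMost_Suc_shift by simp

lemma mean_hit_within: "mean (hit_within r n) r = (\<Sum>k\<le>n. mean (first_hit r k) r)"
  unfolding hit_within_def by (rule mean_sum)

lemma hit_within_nonneg: "hit_within r n y \<ge> 0"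
  unfolding hit_within_def by (intro sum_nonneg) simp

lemma hit_within_mono: "hit_within r n y \<le> hit_within r (Suc n) y"
  unfolding hit_within_def by (simp del: first_hit.simps)

lemma hit_within_le_1: "hit_within r n y \<le> 1"
proof (induction n arbitrary: y)
  case 0
  then show ?case by (simp add: hit_within_def)
next
  case (Suc n)
  show ?case
  proof (cases "y = r")
    case False
    have "mean (hit_within r n) y \<le> mean (\<lambda>_. 1) y" by (rule mean_mono) (rule Suc)
    then show ?thesis using False by (simp add: hit_within_Suc mean_const)
  qed simp
qed

lemma finite_support_first_hit: "finite {y. first_hit r k y \<noteq> 0}"
proof (induction k)
  case (Suc k)
  have "{y. first_hit r (Suc k) y \<noteq> 0} \<subseteq> (\<Union>z\<in>{z. first_hit r k z \<noteq> 0}. nbrs z)"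
  proof
    fix y assume "y \<in> {y. first_hit r (Suc k) y \<noteq> 0}"
    then have "mean (first_hit r k) y \<noteq> 0" by (simp split: if_splits)
    then have "(\<Sum>z\<in>nbrs y. step_prob y z * first_hit r k z) \<noteq> 0"
      unfolding mean_def .
    then have "\<exists>z\<in>nbrs y. step_prob y z * first_hit r k z \<noteq> 0"
      by (rule contrapos_np) (auto intro: sum.neutral)
    then obtain z where "z \<in> nbrs y" "first_hit r k z \<noteq> 0"
      by auto
    then show "y \<in> (\<Union>z\<in>{z. first_hit r k z \<noteq> 0}. nbrs z)" using nbrs_sym by blast
  qed
  then show ?case by (rule finite_subset) (use Suc in auto)
qed simp

lemma finite_support_hit_within: "finite {y. hit_within r n y \<noteq> 0}"
proof (rule finite_subset)
  show "{y. hit_within r n y \<noteq> 0} \<subseteq> (\<Union>k\<le>n. {y. first_hit r k y \<noteq> 0})"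
    unfolding hit_within_def using sum.neutral by fastforce
qed (simp add: finite_support_first_hit)

text \<open>
By Green's identity only \<open>r\<close> contributes positively: at another state \<open>x\<close> the mean of \<open>hit_within r n\<close>
is \<open>hit_within r (Suc n) x\<close>, which is at least \<open>hit_within r n x\<close>.
\<close>

lemma energy_hit_within:
  assumes F: "supported F (hit_within r n)" and r: "r \<in> F"
  shows "energy F (hit_within r n) \<le> mass r * (1 - mean (hit_within r n) r)"
proof -
  let ?h = "hit_within r n"
  have fin: "finite F" using F by (simp add: supported_def)
  let ?rest = "\<Sum>x\<in>F-{r}. ?h x * mass x * (?h x - mean ?h x)"
  have "energy F ?h = (\<Sum>x\<in>F. ?h x * mass x * (?h x - mean ?h x))" by (rule green_identity[OF F])
  also have "\<dots> = ?h r * mass r * (?h r - mean ?h r) + ?rest"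
    by (rule sum.remove[OF fin r])
  finally have "energy F ?h = mass r * (1 - mean ?h r) + ?rest" by simp
  moreover have "?rest \<le> 0"
  proof (rule sum_nonpos)
    fix x assume "x \<in> F - {r}"
    then have "?h x - mean ?h x \<le> 0"
      using hit_within_mono[of r n x] by (simp add: hit_within_Suc)
    then show "?h x * mass x * (?h x - mean ?h x) \<le> 0"
      by (intro mult_nonneg_nonpos mult_nonneg_nonneg hit_within_nonneg mass_nonneg)
  qed
  ultimately show ?thesis by linarith
qed

lemma mean_hit_within_le_1: "mean (hit_within r n) x \<le> 1"
  using mean_mono[of "hit_within r n" "\<lambda>_. 1" x] by (simp add: hit_within_le_1 mean_const)

lemma mean_first_hit_nonneg: "mean (first_hit r k) x \<ge> 0"
  using mean_mono[of "\<lambda>_. 0" "first_hit r k" x] by (simp add: mean_const)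

text \<open>
The probability to return to \<open>r\<close>, decomposed over the first step and the time that is then needed to hit \<open>r\<close>.
\<close>

definition return_prob :: "'s \<Rightarrow> real" where
  "return_prob r = (\<Sum>k. mean (first_hit r k) r)"

lemma summable_mean_first_hit: "summable (\<lambda>k. mean (first_hit r k) r)"
proof (rule summableI_nonneg_bounded[where x = 1])
  fix n
  have "(\<Sum>k<n. mean (first_hit r k) r) \<le> (\<Sum>k\<le>n. mean (first_hit r k) r)"
    by (intro sum_mono2 mean_first_hit_nonneg) auto
  then show "(\<Sum>k<n. mean (first_hit r k) r) \<le> 1"
    using mean_hit_within_le_1[of r n r] unfolding mean_hit_within by linarith
qed (rule mean_first_hit_nonneg)

lemma mean_hit_within_tendsto: "(\<lambda>n. mean (hit_within r n) r) \<longlonglongrightarrow> return_prob r"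
  unfolding mean_hit_within return_prob_def
  by (rule summable_LIMSEQ'[OF summable_mean_first_hit])

lemma summable_first_hit: "summable (\<lambda>k. first_hit r k y)"
proof (rule summableI_nonneg_bounded[where x = 1])
  fix n
  have "(\<Sum>k<n. first_hit r k y) \<le> (\<Sum>k\<le>n. first_hit r k y)"
    by (intro sum_mono2 first_hit_nonneg) auto
  then show "(\<Sum>k<n. first_hit r k y) \<le> 1"
    using hit_within_le_1[of r n y] unfolding hit_within_def by linarith
qed (rule first_hit_nonneg)

section \<open>Criteria for transience and recurrence\<close>

text \<open>
The effective resistance between \<open>r\<close> and infinity is the best constant \<open>C\<close> in this inequality.
\<close>

definition finite_resistance :: "'s \<Rightarrow> bool" where
  "finite_resistance r \<longleftrightarrow> (\<exists>C. \<forall>F f. supported F f \<longrightarrow> (f r)\<^sup>2 \<le> C * energy F f)"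

text \<open>
Values of \<open>f\<close> at neighbouring states differ by at most the square root of the energy over the conductance of the
edge between them.
\<close>

lemma finite_resistance_step:
  assumes x: "finite_resistance x" and c: "conductance x y > 0"
  shows "finite_resistance y"
proof -
  obtain C where C: "\<And>F f. supported F f \<Longrightarrow> (f x)\<^sup>2 \<le> C * energy F f"
    using x unfolding finite_resistance_def by blast
  have "(f y)\<^sup>2 \<le> (2 * C + 2 / conductance x y) * energy F f" if F: "supported F f" for F f
  proof (cases "f y = 0 \<and> f x = 0")
    case True
    have "0 \<le> C * energy F f" using C[OF F] True by simp
    then show ?thesis using True c energy_nonneg[of F f]
      by (simp add: algebra_simps)
  next
    case False
    have xy: "y \<in> nbrs x" using c conductance_outside by force
    have fin: "finite F" using F by (simp add: supported_def)
    have inF: "x \<in> F" "y \<in> F"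
      using False F xy nbrs_sym unfolding supported_def by blast+
    have "2 * (conductance x y * (f x - f y)\<^sup>2) \<le> (\<Sum>p\<in>F\<times>F. (case p of (a, b) \<Rightarrow> conductance a b * (f a - f b)\<^sup>2))"
    proof (cases "x = y")
      case False
      have "2 * (conductance x y * (f x - f y)\<^sup>2) = (\<Sum>p\<in>{(x,y),(y,x)}. (case p of (a, b) \<Rightarrow> conductance a b * (f a - f b)\<^sup>2))"
        using False by (simp add: conductance_sym[of y x] power2_commute[of "f y"])
      also have "\<dots> \<le> (\<Sum>p\<in>F\<times>F. (case p of (a, b) \<Rightarrow> conductance a b * (f a - f b)\<^sup>2))"
        using inF fin by (intro sum_mono2) auto
      finally show ?thesis .
    qed (auto intro!: sum_nonneg)
    then have "conductance x y * (f x - f y)\<^sup>2 \<le> energy F f"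
      unfolding energy_as_sum sum.cartesian_product by simp
    then have "(f x - f y)\<^sup>2 \<le> energy F f / conductance x y"
      using c by (simp add: pos_le_divide_eq mult.commute)
    moreover have "(f y)\<^sup>2 \<le> 2 * (f x)\<^sup>2 + 2 * (f x - f y)\<^sup>2"
      using sum_squares_bound[of "f x" "f y"] zero_le_power2[of "2 * f x - f y"]
      by (simp add: power2_eq_square algebra_simps)
    moreover note C[OF F]
    ultimately show ?thesis by (simp add: algebra_simps)
  qed
  then show ?thesis unfolding finite_resistance_def by blast
qed

text \<open>
The inequality is applied to \<open>hit_within r n\<close>, whose value at \<open>r\<close> is \<open>1\<close> and whose energy is at most
\<open>mass r\<close> times the probability not to return within \<open>n + 1\<close> steps. That probability is therefore bounded
below uniformly in \<open>n\<close>.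
\<close>

lemma return_prob_less_1:
  assumes "finite_resistance r" shows "return_prob r < 1"
proof -
  obtain C where C: "\<And>F f. supported F f \<Longrightarrow> (f r)\<^sup>2 \<le> C * energy F f"
    using assms unfolding finite_resistance_def by blast
  define D where "D = max C 1"
  have le: "1 \<le> D * (mass r * (1 - mean (hit_within r n) r))" for n
  proof -
    obtain F where F: "supported F (hit_within r n)" "{r} \<subseteq> F"
      by (rule supported_exists[of "{r}" "hit_within r n"]) (auto simp: finite_support_hit_within)
    have "1 \<le> C * energy F (hit_within r n)" using C[OF F(1)] by simp
    also have "\<dots> \<le> D * energy F (hit_within r n)"
      by (intro mult_right_mono energy_nonneg) (simp add: D_def)
    also have "\<dots> \<le> D * (mass r * (1 - mean (hit_within r n) r))"
      using energy_hit_within[OF F(1)] F(2) by (intro mult_left_mono) (auto simp: D_def)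
    finally show ?thesis .
  qed
  have "(\<lambda>n. D * (mass r * (1 - mean (hit_within r n) r))) \<longlonglongrightarrow> D * (mass r * (1 - return_prob r))"
    by (intro tendsto_intros mean_hit_within_tendsto)
  then have "1 \<le> D * (mass r * (1 - return_prob r))"
    by (rule LIMSEQ_le_const) (use le in auto)
  moreover have "D * (mass r * (1 - return_prob r)) \<le> 0" if "return_prob r \<ge> 1"
    using that by (intro mult_nonneg_nonpos) (auto simp: D_def mass_nonneg)
  ultimately show ?thesis by fastforce
qed

lemma return_prob_le_1: "return_prob r \<le> 1"
  by (rule LIMSEQ_le_const2[OF mean_hit_within_tendsto]) (use mean_hit_within_le_1 in blast)

text \<open>
Green's identity shows that the pairing of \<open>f\<close> with \<open>hit_within r n\<close> converges to \<open>f r * d\<close> with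
\<open>d = mass r * (1 - return_prob r)\<close>, since the defect of harmonicity of \<open>hit_within r n\<close> vanishes in the limit off
\<open>r\<close>. By Cauchy-Schwarz the square of this pairing is at most \<open>energy F f\<close> times the energy of
\<open>hit_within r n\<close>, which is asymptotically at most \<open>d\<close>. Cancelling one factor \<open>d\<close> gives the claim.
\<close>

lemma escape_le_energy:
  assumes F: "supported F f" and r: "w r > 0"
  shows "mass r * (1 - return_prob r) * (f r)\<^sup>2 \<le> energy F f"
proof (cases "f r = 0 \<or> return_prob r = 1")
  case True
  then show ?thesis using energy_nonneg by auto
next
  case False
  have rF: "r \<in> F" and fin: "finite F" using F False by (auto simp: supported_def)
  have m: "mass r > 0" unfolding mass_def using r exit_rate_positive[of r] by simp
  define d where "d = mass r * (1 - return_prob r)"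
  have d: "d > 0" unfolding d_def using m False return_prob_le_1[of r] by simp
  let ?D = "\<lambda>n. dirichlet_form F f (hit_within r n)"
  have term0: "(\<lambda>n. f x * mass x * (hit_within r n x - mean (hit_within r n) x))
      \<longlonglongrightarrow> (if x = r then f r * d else 0)" for x
  proof (cases "x = r")
    case True
    have "(\<lambda>n. f r * mass r * (1 - mean (hit_within r n) r)) \<longlonglongrightarrow> f r * mass r * (1 - return_prob r)"
      by (intro tendsto_intros mean_hit_within_tendsto)
    then show ?thesis using True by (simp add: d_def mult.assoc)
  next
    case False
    have "(\<lambda>n. f x * mass x * (- first_hit r (Suc n) x)) \<longlonglongrightarrow> f x * mass x * (- 0)"
      by (intro tendsto_intros LIMSEQ_Suc[OF summable_LIMSEQ_zero[OF summable_first_hit[of r x]]])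
    moreover have "hit_within r n x - mean (hit_within r n) x = - first_hit r (Suc n) x" for n
      unfolding hit_within_Suc[OF False, symmetric] by (simp add: hit_within_def del: first_hit.simps)
    ultimately show ?thesis using False by (simp del: first_hit.simps)
  qed
  have "(\<lambda>n. \<Sum>x\<in>F. f x * mass x * (hit_within r n x - mean (hit_within r n) x))
      \<longlonglongrightarrow> (\<Sum>x\<in>F. if x = r then f r * d else 0)"
    by (intro tendsto_sum term0)
  then have lim1: "?D \<longlonglongrightarrow> f r * d"
    using rF fin by (simp add: green_identity[OF F])
  have le: "(?D n)\<^sup>2 \<le> energy F f * (mass r * (1 - mean (hit_within r n) r))" for n
  proof -
    obtain F' where F': "supported F' (hit_within r n)" "F \<subseteq> F'"
      by (rule supported_exists[of F "hit_within r n"]) (auto simp: fin finite_support_hit_within)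
    have "(?D n)\<^sup>2 \<le> energy F f * energy F (hit_within r n)"
      by (rule dirichlet_form_cauchy_schwarz)
    also have "\<dots> \<le> energy F f * energy F' (hit_within r n)"
      using F' by (intro mult_left_mono energy_mono energy_nonneg) (auto simp: supported_def)
    also have "\<dots> \<le> energy F f * (mass r * (1 - mean (hit_within r n) r))"
      using F' rF by (intro mult_left_mono energy_hit_within energy_nonneg) auto
    finally show ?thesis .
  qed
  have "(\<lambda>n. (?D n)\<^sup>2) \<longlonglongrightarrow> (f r * d)\<^sup>2" by (intro tendsto_intros lim1)
  moreover have "(\<lambda>n. energy F f * (mass r * (1 - mean (hit_within r n) r))) \<longlonglongrightarrow> energy F f * d"
    unfolding d_def by (intro tendsto_intros mean_hit_within_tendsto)
  ultimately have "(f r * d)\<^sup>2 \<le> energy F f * d"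
    by (rule LIMSEQ_le) (use le in auto)
  then have "(d * (f r)\<^sup>2) * d \<le> energy F f * d" by (simp add: power2_eq_square mult_ac)
  then show ?thesis using d by (simp add: d_def[symmetric] mult.commute)
qed

lemma return_prob_eq_1:
  assumes r: "w r > 0"
    and small: "\<And>\<epsilon>. \<epsilon> > 0 \<Longrightarrow> \<exists>F f. supported F f \<and> f r > 0 \<and> energy F f \<le> \<epsilon> * (f r)\<^sup>2"
  shows "return_prob r = 1"
proof (rule ccontr)
  assume "return_prob r \<noteq> 1"
  then have "mass r * (1 - return_prob r) > 0"
    using return_prob_le_1[of r] r exit_rate_positive[of r] unfolding mass_def by simp
  then obtain \<epsilon> where e: "\<epsilon> > 0" "\<epsilon> < mass r * (1 - return_prob r)" using dense by blast
  obtain F f where F: "supported F f" "f r > 0" "energy F f \<le> \<epsilon> * (f r)\<^sup>2" using small[OF e(1)] by blast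
  have "\<epsilon> * (f r)\<^sup>2 < mass r * (1 - return_prob r) * (f r)\<^sup>2"
    using e F(2) by (intro mult_strict_right_mono) auto
  then show False using escape_le_energy[OF F(1) r] F(3) by linarith
qed

definition hit_prob :: "'s \<Rightarrow> 's \<Rightarrow> real" where
  "hit_prob r y = (\<Sum>k. first_hit r k y)"

lemma hit_within_tendsto: "(\<lambda>n. hit_within r n y) \<longlonglongrightarrow> hit_prob r y"
  unfolding hit_within_def hit_prob_def by (rule summable_LIMSEQ'[OF summable_first_hit])

lemma hit_prob_le_1: "hit_prob r y \<le> 1"
  by (rule LIMSEQ_le_const2[OF hit_within_tendsto]) (use hit_within_le_1 in blast)

lemma hit_prob_nonneg: "hit_prob r y \<ge> 0"
  unfolding hit_prob_def by (intro suminf_nonneg summable_first_hit) simp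

lemma mean_hit_within_tendsto': "(\<lambda>n. mean (hit_within r n) x) \<longlonglongrightarrow> mean (hit_prob r) x"
  unfolding mean_def by (intro tendsto_intros hit_within_tendsto)

lemma hit_prob_root: "hit_prob r r = 1"
  using hit_within_tendsto[of r r] by (simp add: LIMSEQ_const_iff)

lemma hit_prob_harmonic:
  assumes "return_prob r = 1"
  shows "hit_prob r x = mean (hit_prob r) x"
proof (cases "x = r")
  case True
  have "mean (hit_prob r) r = 1"
    using LIMSEQ_unique[OF mean_hit_within_tendsto mean_hit_within_tendsto'] assms by simp
  then show ?thesis using True by (simp add: hit_prob_root)
next
  case False
  have "(\<lambda>n. hit_within r (Suc n) x) \<longlonglongrightarrow> hit_prob r x"
    by (rule LIMSEQ_Suc[OF hit_within_tendsto])
  then show ?thesis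
    using LIMSEQ_unique[OF mean_hit_within_tendsto'] by (simp add: hit_within_Suc[OF False])
qed

text \<open>
Maximum principle: for a recurrent \<open>r\<close> the hitting probability is harmonic everywhere and at most \<open>1\<close>, so
the value \<open>1\<close> propagates along positive rates.
\<close>

lemma hit_prob_eq_1_step:
  assumes ret: "return_prob r = 1" and x: "hit_prob r x = 1" and c: "q x y > 0"
  shows "hit_prob r y = 1"
proof (rule ccontr)
  assume ne: "hit_prob r y \<noteq> 1"
  have y: "y \<in> nbrs x" "step_prob x y > 0"
    using c exit_rate_positive[of x] by (auto simp: nbrs_def step_prob_def)
  have "mean (hit_prob r) x < mean (\<lambda>_. 1) x"
    unfolding mean_def
  proof (rule sum_strict_mono_ex1)
    show "\<forall>z\<in>nbrs x. step_prob x z * hit_prob r z \<le> step_prob x z * 1"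
      by (auto intro!: mult_left_mono hit_prob_le_1 simp del: mult_1_right)
    show "\<exists>z\<in>nbrs x. step_prob x z * hit_prob r z < step_prob x z * 1"
      using y ne hit_prob_le_1[of r y] by (intro bexI[of _ y] mult_strict_left_mono) auto
  qed simp
  then show False using hit_prob_harmonic[OF ret, of x] x by (simp add: mean_const)
qed


section \<open>Flows of finite energy\<close>

text \<open>
Thomson's principle. A flow \<open>\<theta>\<close> on the edges in \<open>T\<close>, with source \<open>r\<close> and no sink, is described by
its pairing with gradients of finitely supported functions. The claim is Cauchy-Schwarz for that
pairing. The factor \<open>1/2\<close> in the energy leads to the constant \<open>2 * R\<close>.
\<close>

lemma finite_resistance_if_flow:
  fixes src dst :: "'e \<Rightarrow> 's" and \<theta> :: "'e \<Rightarrow> real"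
  assumes unit: "\<And>f. finite {x. f x \<noteq> 0} \<Longrightarrow>
      \<exists>P. finite P \<and> P \<subseteq> T \<and> f r = (\<Sum>e\<in>P. \<theta> e * (f (src e) - f (dst e)))"
    and finite_energy: "\<And>P. finite P \<Longrightarrow> P \<subseteq> T \<Longrightarrow> (\<Sum>e\<in>P. (\<theta> e)\<^sup>2 / conductance (src e) (dst e)) \<le> R"
    and positive: "\<And>e. e \<in> T \<Longrightarrow> conductance (src e) (dst e) > 0"
    and inj: "inj_on (\<lambda>e. (src e, dst e)) T"
  shows "finite_resistance r"
proof -
  have R: "R \<ge> 0" using finite_energy[of "{}"] by simp
  have "(f r)\<^sup>2 \<le> (2 * R) * energy F f" if F: "supported F f" for F f
  proof -
    have fin: "finite F" using F by (simp add: supported_def)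
    have "finite {x. f x \<noteq> 0}"
      by (rule finite_subset[OF _ fin]) (use F in \<open>auto simp: supported_def\<close>)
    then obtain P where P: "finite P" "P \<subseteq> T" "f r = (\<Sum>e\<in>P. \<theta> e * (f (src e) - f (dst e)))"
      using unit by blast
    define Q where "Q = {e\<in>P. src e \<in> F \<and> dst e \<in> F}"
    let ?c = "\<lambda>e. conductance (src e) (dst e)" and ?d = "\<lambda>e. f (src e) - f (dst e)"
    have "f r = (\<Sum>e\<in>Q. \<theta> e * ?d e)"
      unfolding P(3)
    proof (rule sum.mono_neutral_right[OF P(1)])
      show "\<forall>e\<in>P - Q. \<theta> e * ?d e = 0"
      proof
        fix e assume e: "e \<in> P - Q"
        then have "conductance (src e) (dst e) > 0" using P(2) positive by blast
        then have "dst e \<in> nbrs (src e)" using conductance_outside by force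
        then have "f (src e) = 0 \<and> f (dst e) = 0"
          using e F nbrs_sym unfolding Q_def supported_def by blast
        then show "\<theta> e * ?d e = 0" by simp
      qed
    qed (auto simp: Q_def)
    also have "\<dots> = (\<Sum>e\<in>Q. (\<theta> e / sqrt (?c e)) * (sqrt (?c e) * ?d e))"
    proof (rule sum.cong[OF refl])
      fix e assume "e \<in> Q"
      then have "?c e > 0" using P(2) positive unfolding Q_def by blast
      then show "\<theta> e * ?d e = (\<theta> e / sqrt (?c e)) * (sqrt (?c e) * ?d e)" by simp
    qed
    finally have eq: "f r = (\<Sum>e\<in>Q. (\<theta> e / sqrt (?c e)) * (sqrt (?c e) * ?d e))" .
    have "(f r)\<^sup>2 \<le> (\<Sum>e\<in>Q. (\<theta> e / sqrt (?c e))\<^sup>2) * (\<Sum>e\<in>Q. (sqrt (?c e) * ?d e)\<^sup>2)"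
      unfolding eq by (rule Cauchy_Schwarz_ineq_sum)
    also have "\<dots> = (\<Sum>e\<in>Q. (\<theta> e)\<^sup>2 / ?c e) * (\<Sum>e\<in>Q. ?c e * (?d e)\<^sup>2)"
      by (simp add: power_divide power_mult_distrib)
    also have "\<dots> \<le> R * (\<Sum>(x,y)\<in>F\<times>F. conductance x y * (f x - f y)\<^sup>2)"
    proof (rule mult_mono)
      show "(\<Sum>e\<in>Q. (\<theta> e)\<^sup>2 / ?c e) \<le> R"
        by (rule finite_energy) (use P in \<open>auto simp: Q_def\<close>)
      have injQ: "inj_on (\<lambda>e. (src e, dst e)) Q"
        by (rule inj_on_subset[OF inj]) (use P in \<open>auto simp: Q_def\<close>)
      have "(\<Sum>e\<in>Q. ?c e * (?d e)\<^sup>2) = (\<Sum>(x,y)\<in>(\<lambda>e. (src e, dst e)) ` Q. conductance x y * (f x - f y)\<^sup>2)"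
        by (subst sum.reindex[OF injQ]) simp
      also have "\<dots> \<le> (\<Sum>(x,y)\<in>F\<times>F. conductance x y * (f x - f y)\<^sup>2)"
        using fin by (intro sum_mono2) (auto simp: Q_def)
      finally show "(\<Sum>e\<in>Q. ?c e * (?d e)\<^sup>2) \<le> (\<Sum>(x,y)\<in>F\<times>F. conductance x y * (f x - f y)\<^sup>2)" .
    qed (auto intro!: sum_nonneg R)
    also have "\<dots> = (2 * R) * energy F f"
      unfolding energy_as_sum sum.cartesian_product by simp
    finally show ?thesis .
  qed
  then show ?thesis unfolding finite_resistance_def by blast
qed

text \<open>
The unit flow along a path: its energy is the sum of the resistances of the edges, and its pairing with a gradient
telescopes.
\<close>

lemma finite_resistance_if_path:
  fixes p :: "nat \<Rightarrow> 's"
  assumes inj: "inj p" and positive: "\<And>m. conductance (p m) (p (Suc m)) > 0"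
    and resistance: "summable (\<lambda>m. 1 / conductance (p m) (p (Suc m)))"
  shows "finite_resistance (p 0)"
proof (rule finite_resistance_if_flow[where T = UNIV and \<theta> = "\<lambda>_. 1" and src = p
      and dst = "\<lambda>m. p (Suc m)" and R = "\<Sum>m. 1 / conductance (p m) (p (Suc m))"])
  fix f :: "'s \<Rightarrow> real" assume "finite {x. f x \<noteq> 0}"
  then have "finite (p -` {x. f x \<noteq> 0})" using inj by (rule finite_vimageI)
  then obtain M where "p -` {x. f x \<noteq> 0} \<subseteq> {..<M}" using finite_nat_iff_bounded by blast
  then have "f (p M) = 0" by auto
  then have "f (p 0) = (\<Sum>m<M. 1 * (f (p m) - f (p (Suc m))))"
    using sum_lessThan_telescope'[of "\<lambda>m. f (p m)" M] by simp
  then show "\<exists>P. finite P \<and> P \<subseteq> UNIV \<and> f (p 0) = (\<Sum>m\<in>P. 1 * (f (p m) - f (p (Suc m))))"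
    by (intro exI[of _ "{..<M}"]) simp
next
  fix P :: "nat set" assume "finite P"
  then have "(\<Sum>m\<in>P. 1 / conductance (p m) (p (Suc m))) \<le> (\<Sum>m. 1 / conductance (p m) (p (Suc m)))"
    by (intro sum_le_suminf[OF resistance]) auto
  then show "(\<Sum>m\<in>P. 1\<^sup>2 / conductance (p m) (p (Suc m))) \<le> (\<Sum>m. 1 / conductance (p m) (p (Suc m)))"
    by simp
next
  show "inj (\<lambda>m. (p m, p (Suc m)))" using inj by (auto simp: inj_def)
qed (rule positive)

section \<open>Networks with linearly growing cuts\<close>

text \<open>
Pairs with \<open>L y = L x + 1\<close> and pairs with \<open>L x = L y + 1\<close> contribute equally, which cancels the
factor \<open>1/2\<close> of the energy.
\<close>

lemma energy_radial:
  fixes L :: "'s \<Rightarrow> nat"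
  assumes level: "\<And>x y. conductance x y > 0 \<Longrightarrow> L y = Suc (L x) \<or> L x = Suc (L y)" and fin: "finite F"
  shows "energy F (\<lambda>x. \<phi> (L x)) =
    (\<Sum>y\<in>F. \<Sum>x\<in>{x\<in>F. L y = Suc (L x)}. conductance x y * (\<phi> (L x) - \<phi> (L y))\<^sup>2)"
proof -
  let ?t = "\<lambda>x y. conductance x y * (\<phi> (L x) - \<phi> (L y))\<^sup>2"
  let ?u = "\<lambda>x y. if L y = Suc (L x) then ?t x y else 0"
  have split: "?t x y = ?u x y + ?u y x" for x y
  proof (cases "conductance x y = 0")
    case True
    then have "conductance y x = 0" by (simp only: conductance_sym[of y x])
    then show ?thesis using True by simp
  next
    case False
    then consider "L y = Suc (L x)" | "L x = Suc (L y)"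
      using level[of x y] conductance_nonneg[of x y] by linarith
    then show ?thesis
    proof cases
      case 2
      have "?t x y = ?t y x"
        by (rule arg_cong2[where f = "(*)", OF conductance_sym power2_commute])
      then show ?thesis using 2 by (simp only: if_True refl) simp
    qed simp
  qed
  have "(\<Sum>x\<in>F. \<Sum>y\<in>F. ?t x y) = (\<Sum>x\<in>F. \<Sum>y\<in>F. ?u x y) + (\<Sum>x\<in>F. \<Sum>y\<in>F. ?u y x)"
    by (subst split) (simp add: sum.distrib)
  also have "(\<Sum>x\<in>F. \<Sum>y\<in>F. ?u x y) = (\<Sum>x\<in>F. \<Sum>y\<in>F. ?u y x)" by (rule sum.swap)
  finally have "energy F (\<lambda>x. \<phi> (L x)) = (\<Sum>y\<in>F. \<Sum>x\<in>F. ?u x y)"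
    unfolding energy_as_sum by simp
  also have "\<dots> = (\<Sum>y\<in>F. \<Sum>x\<in>{x\<in>F. L y = Suc (L x)}. ?t x y)"
    unfolding sum.inter_filter[OF fin] ..
  finally show ?thesis .
qed

text \<open>
A form of the Nash-Williams criterion. The test function decreases from level to level like
\<open>\<phi> k = H\<^sub>N - H\<^sub>k\<close> with harmonic numbers \<open>H\<close>. The step into level \<open>k\<close> costs at most
\<open>A * k * (1/k)\<^sup>2\<close>, so the energy is at most \<open>A * H\<^sub>N\<close>, while \<open>\<phi>\<close> at the level of \<open>r\<close> is of order \<open>H\<^sub>N\<close>. The energy divided by
the square of that value tends to \<open>0\<close> because \<open>H\<^sub>N\<close> diverges.
\<close>

lemma return_prob_eq_1_if_linear_cuts:
  fixes L :: "'s \<Rightarrow> nat"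
  assumes r: "w r > 0"
    and level: "\<And>x y. conductance x y > 0 \<Longrightarrow> L y = Suc (L x) \<or> L x = Suc (L y)"
    and fin: "\<And>n. finite {x. L x \<le> n}"
    and cut: "\<And>k F. finite F \<Longrightarrow> (\<Sum>y\<in>{y\<in>F. L y = k}. \<Sum>x\<in>{x\<in>F. L y = Suc (L x)}. conductance x y) \<le> A * real k"
  shows "return_prob r = 1"
proof (rule return_prob_eq_1[OF r])
  fix \<epsilon> :: real assume e: "\<epsilon> > 0"
  define H where "H n = (harm n :: real)" for n
  have H_pos: "H n \<ge> 0" for n unfolding H_def by (rule harm_nonneg)
  have A: "A \<ge> 0" using cut[of "{}" 1] by simp
  have lim: "filterlim H at_top sequentially" unfolding H_def by (rule harm_at_top)
  \<comment> \<open>So large that the test function is at least \<open>H N / 2\<close> at \<open>r\<close> and \<open>A * H N \<le> \<epsilon> * (H N / 2)\<^sup>2\<close>.\<close>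
  obtain N where N: "H N \<ge> 2 * H (L r) + 1 + 4 * A / \<epsilon>"
    using filterlim_at_top_ge[of H sequentially "0"] lim
    unfolding filterlim_at_top eventually_sequentially by (meson order_refl)
  define \<phi> where "\<phi> k = (if k \<le> N then H N - H k else 0)" for k
  define f where "f x = \<phi> (L x)" for x
  have HN1: "H N \<ge> 1" using N H_pos[of "L r"] A e
    by (smt (verit) divide_nonneg_pos)
  have A4: "4 * A \<le> \<epsilon> * H N"
  proof -
    have "4 * A / \<epsilon> \<le> H N" using N H_pos[of "L r"] by linarith
    then show ?thesis using e by (simp add: pos_divide_le_eq mult.commute)
  qed
  have rN: "L r \<le> N"
  proof (rule ccontr)
    assume "\<not> L r \<le> N"
    then have "H N \<le> H (L r)" unfolding H_def by (intro harm_mono) simp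
    moreover have "H N > H (L r)" using N H_pos[of "L r"] A e by (smt (verit) divide_nonneg_pos)
    ultimately show False by linarith
  qed
  have fr: "f r \<ge> H N / 2" unfolding f_def \<phi>_def using rN N A e
    by simp (smt (verit) divide_nonneg_pos)
  have step: "(\<phi> k - \<phi> (Suc k))\<^sup>2 \<le> (if k < N then (1 / real (Suc k))\<^sup>2 else 0)" for k
  proof -
    consider "k < N" | "k = N" | "k > N" by linarith
    then show ?thesis
    proof cases
      case 1
      then have "\<phi> k - \<phi> (Suc k) = 1 / real (Suc k)"
        unfolding \<phi>_def H_def by (simp add: harm_Suc inverse_eq_divide)
      then show ?thesis using 1 by simp
    qed (auto simp: \<phi>_def)
  qed
  obtain F where F: "supported F f"
  proof (rule supported_exists[of "{}" f])
    show "finite {x. f x \<noteq> 0}"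
      by (rule finite_subset[OF _ fin[of N]]) (auto simp: f_def \<phi>_def)
  qed auto
  have finF: "finite F" using F by (simp add: supported_def)
  have "energy F f = (\<Sum>y\<in>F. \<Sum>x\<in>{x\<in>F. L y = Suc (L x)}. conductance x y * (\<phi> (L x) - \<phi> (L y))\<^sup>2)"
    unfolding f_def by (rule energy_radial[OF level finF])
  also have "\<dots> \<le> (\<Sum>y\<in>F. \<Sum>x\<in>{x\<in>F. L y = Suc (L x)}. if L y \<in> {1..N} then conductance x y * (1 / real (L y))\<^sup>2 else 0)"
  proof (intro sum_mono)
    fix y x assume "y \<in> F" "x \<in> {x\<in>F. L y = Suc (L x)}"
    then have "L y = Suc (L x)" by simp
    then show "conductance x y * (\<phi> (L x) - \<phi> (L y))\<^sup>2 \<le> (if L y \<in> {1..N} then conductance x y * (1 / real (L y))\<^sup>2 else 0)"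
      using mult_left_mono[OF step[of "L x"] conductance_nonneg[of x y]] by (auto simp: Suc_le_eq)
  qed
  also have "\<dots> = (\<Sum>y\<in>{y\<in>F. L y \<in> {1..N}}. (\<Sum>x\<in>{x\<in>F. L y = Suc (L x)}. conductance x y) * (1 / real (L y))\<^sup>2)"
  proof (rule sum.mono_neutral_cong_right[OF finF])
    show "\<forall>y\<in>F - {y\<in>F. L y \<in> {1..N}}. (\<Sum>x\<in>{x\<in>F. L y = Suc (L x)}.
        if L y \<in> {1..N} then conductance x y * (1 / real (L y))\<^sup>2 else 0) = 0"
      by (intro ballI sum.neutral) simp
  qed (auto simp: sum_distrib_right)
  also have "\<dots> = (\<Sum>k\<in>{1..N}. \<Sum>y\<in>{y\<in>{y\<in>F. L y \<in> {1..N}}. L y = k}. (\<Sum>x\<in>{x\<in>F. L y = Suc (L x)}. conductance x y) * (1 / real (L y))\<^sup>2)"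
    using finF by (intro sum.group[symmetric]) auto
  also have "\<dots> \<le> (\<Sum>k\<in>{1..N}. A * (1 / real k))"
  proof (rule sum_mono)
    fix k assume k: "k \<in> {1..N}"
    have "(\<Sum>y\<in>{y\<in>{y\<in>F. L y \<in> {1..N}}. L y = k}. (\<Sum>x\<in>{x\<in>F. L y = Suc (L x)}. conductance x y) * (1 / real (L y))\<^sup>2)
       = (\<Sum>y\<in>{y\<in>F. L y = k}. \<Sum>x\<in>{x\<in>F. L y = Suc (L x)}. conductance x y) * (1 / real k)\<^sup>2"
      unfolding sum_distrib_right using k by (intro sum.cong) auto
    also have "\<dots> \<le> (A * real k) * (1 / real k)\<^sup>2"
      by (intro mult_right_mono cut finF) auto
    also have "\<dots> = A * (1 / real k)" using k by (simp add: power2_eq_square)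
    finally show "(\<Sum>y\<in>{y\<in>{y\<in>F. L y \<in> {1..N}}. L y = k}. (\<Sum>x\<in>{x\<in>F. L y = Suc (L x)}. conductance x y) * (1 / real (L y))\<^sup>2) \<le> A * (1 / real k)" .
  qed
  also have "\<dots> = A * H N" unfolding H_def harm_def by (simp add: sum_distrib_left inverse_eq_divide)
  also have "\<dots> \<le> \<epsilon> * (H N / 2)\<^sup>2"
    using mult_right_mono[OF A4, of "H N"] HN1 by (simp add: power2_eq_square field_simps)
  also have "\<dots> \<le> \<epsilon> * (f r)\<^sup>2"
    using fr HN1 e by (intro mult_left_mono power_mono) auto
  finally show "\<exists>F f. supported F f \<and> f r > 0 \<and> energy F f \<le> \<epsilon> * (f r)\<^sup>2"
    using F fr HN1 by (intro exI[of _ F] exI[of _ f]) auto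
qed

end


section \<open>The return time in terms of the jump chain\<close>

lemma ctmc_state_eq:
  assumes mono: "strict_mono (jump_time q \<omega>)"
    and t: "jump_time q \<omega> n \<le> t" "t < jump_time q \<omega> (Suc n)"
  shows "ctmc_state q \<omega> t = Some (fst \<omega> n)"
proof -
  have unique: "m = n" if m: "jump_time q \<omega> m \<le> t" "t < jump_time q \<omega> (Suc m)" for m
  proof -
    have "jump_time q \<omega> m < jump_time q \<omega> (Suc n)" "jump_time q \<omega> n < jump_time q \<omega> (Suc m)"
      using m t by linarith+
    then show ?thesis using strict_mono_less[OF mono] by (simp add: less_Suc_eq_le)
  qed
  have "(LEAST m. jump_time q \<omega> m \<le> t \<and> t < jump_time q \<omega> (Suc m)) = n"
  proof (rule Least_equality)
    show "n \<le> m" if "jump_time q \<omega> m \<le> t \<and> t < jump_time q \<omega> (Suc m)" for m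
      using unique[of m] that by simp
  qed (use t in simp)
  moreover have "\<exists>m. jump_time q \<omega> m \<le> t \<and> t < jump_time q \<omega> (Suc m)" using t by blast
  ultimately show ?thesis unfolding ctmc_state_def by simp
qed

text \<open>
If all holding times are positive, the jump times increase strictly, so the infimum in the definition of
the return time is the jump time at the first return. It is the sum of the holding times before that return.
\<close>

lemma return_time_eq_sum:
  assumes T: "\<And>n. T n > 0" and exit_pos: "\<And>y. exit_rate q y > 0" and ret: "\<exists>n\<ge>1. Y n = x"
  shows "return_time q x (Y, T) =
    (\<Sum>k. ennreal (T k / exit_rate q (Y k)) * indicator {Y. \<forall>j. 0 < j \<and> j \<le> k \<longrightarrow> Y j \<noteq> x} Y)"
proof -
  define J where "J = jump_time q (Y, T)"
  define \<tau> where "\<tau> = (LEAST n. n \<ge> 1 \<and> Y n = x)"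
  have J_Suc: "J (Suc n) = J n + T n / exit_rate q (Y n)" for n
    unfolding J_def jump_time_def by simp
  have mono: "strict_mono J"
    unfolding strict_mono_Suc_iff J_Suc using T exit_pos by simp
  have \<tau>: "\<tau> \<ge> 1" "Y \<tau> = x" and before: "\<And>n. n \<ge> 1 \<Longrightarrow> Y n = x \<Longrightarrow> \<tau> \<le> n"
    unfolding \<tau>_def using LeastI_ex[of "\<lambda>n. n \<ge> 1 \<and> Y n = x"] ret by (auto intro: Least_le)
  have state: "ctmc_state q (Y, T) t = Some (Y n)" if "J n \<le> t" "t < J (Suc n)" for n t
    using ctmc_state_eq[of q "(Y, T)" n t] mono that unfolding J_def by simp
  let ?S = "{t. J 1 \<le> t \<and> ctmc_state q (Y, T) t = Some x}"
  have "Inf (ennreal ` ?S) = ennreal (J \<tau>)"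
  proof (rule antisym)
    have "J \<tau> \<in> ?S"
      using state[of \<tau> "J \<tau>"] \<tau> mono by (simp add: strict_mono_less_eq strict_mono_less)
    then show "Inf (ennreal ` ?S) \<le> ennreal (J \<tau>)" by (intro Inf_lower) auto
    show "ennreal (J \<tau>) \<le> Inf (ennreal ` ?S)"
    proof (rule Inf_greatest, clarify)
      fix t assume t: "J 1 \<le> t" "ctmc_state q (Y, T) t = Some x"
      then obtain n where n: "J n \<le> t" "t < J (Suc n)"
        unfolding ctmc_state_def J_def by (auto split: if_splits)
      have "J 1 < J (Suc n)" using t n by linarith
      then have "n \<ge> 1" using strict_mono_less[OF mono] by simp
      moreover have "Y n = x" using state[OF n] t(2) by simp
      ultimately have "J \<tau> \<le> J n" using before mono by (simp add: strict_mono_less_eq)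
      then show "ennreal (J \<tau>) \<le> ennreal t" using n by (intro ennreal_leI) linarith
    qed
  qed
  then have "return_time q x (Y, T) = ennreal (J \<tau>)" unfolding return_time_def J_def .
  also have "\<dots> = (\<Sum>k<\<tau>. ennreal (T k / exit_rate q (Y k)))"
    unfolding J_def jump_time_def using T exit_pos by (subst sum_ennreal) (auto simp: less_imp_le)
  also have "\<dots> = (\<Sum>k<\<tau>. ennreal (T k / exit_rate q (Y k)) * indicator {Y. \<forall>j. 0 < j \<and> j \<le> k \<longrightarrow> Y j \<noteq> x} Y)"
  proof (rule sum.cong[OF refl])
    fix k assume k: "k \<in> {..<\<tau>}"
    have "Y j \<noteq> x" if "0 < j" "j \<le> k" for j using before[of j] that k by force
    then show "ennreal (T k / exit_rate q (Y k)) = ennreal (T k / exit_rate q (Y k)) *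
        indicator {Y. \<forall>j. 0 < j \<and> j \<le> k \<longrightarrow> Y j \<noteq> x} Y" by simp
  qed
  also have "\<dots> = (\<Sum>k. ennreal (T k / exit_rate q (Y k)) * indicator {Y. \<forall>j. 0 < j \<and> j \<le> k \<longrightarrow> Y j \<noteq> x} Y)"
  proof (rule suminf_finite[symmetric])
    fix k assume "k \<notin> {..<\<tau>}"
    then have "Y \<notin> {Y. \<forall>j. 0 < j \<and> j \<le> k \<longrightarrow> Y j \<noteq> x}"
      using \<tau> by (auto intro!: exI[of _ \<tau>])
    then show "ennreal (T k / exit_rate q (Y k)) * indicator {Y. \<forall>j. 0 < j \<and> j \<le> k \<longrightarrow> Y j \<noteq> x} Y = 0"
      by simp
  qed simp
  finally show ?thesis .
qed

abbreviation holding_law :: "(nat \<Rightarrow> real) measure" where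
  "holding_law \<equiv> \<Pi>\<^sub>M n\<in>UNIV. density lborel (exponential_density 1)"

lemma prob_space_exponential_1: "prob_space (density lborel (exponential_density 1))"
  by (rule prob_space_exponential_density) simp

lemma prob_space_holding_law: "prob_space holding_law"
  by (rule prob_space_PiM) (rule prob_space_exponential_1)

lemma measurable_holding [measurable]: "(\<lambda>T. T k) \<in> holding_law \<rightarrow>\<^sub>M borel"
proof -
  have "(\<lambda>T. T k) \<in> holding_law \<rightarrow>\<^sub>M density lborel (exponential_density 1)"
    by (rule measurable_component_singleton) simp
  then show ?thesis by simp
qed

lemma AE_holding_positive: "AE T in holding_law. \<forall>n. T n > 0"
proof -
  have "AE x in density lborel (exponential_density 1). x > 0"
  proof (subst AE_density)
    show "AE x in lborel. 0 < ennreal (exponential_density 1 x) \<longrightarrow> 0 < x"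
      using AE_lborel_singleton[of "0::real"]
      by eventually_elim (auto simp: exponential_density_def)
  qed simp
  then have "AE T in holding_law. T n > 0" for n
    by (intro AE_PiM_component[where P = "\<lambda>x. 0 < x"]) (auto intro: prob_space_exponential_1)
  then show ?thesis unfolding AE_all_countable by blast
qed

lemma nn_integral_holding: "(\<integral>\<^sup>+T. ennreal (T k) \<partial>holding_law) = 1"
proof -
  have "(\<integral>\<^sup>+x. ennreal x \<partial>density lborel (exponential_density 1)) =
      (\<integral>\<^sup>+x. ennreal x \<partial>distr holding_law (density lborel (exponential_density 1)) (\<lambda>T. T k))"
    by (subst distr_PiM_component) (auto intro: prob_space_exponential_1)
  also have "\<dots> = (\<integral>\<^sup>+T. ennreal (T k) \<partial>holding_law)"
    by (rule nn_integral_distr) (auto intro: measurable_component_singleton)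
  finally have "(\<integral>\<^sup>+T. ennreal (T k) \<partial>holding_law) = (\<integral>\<^sup>+x. ennreal x \<partial>density lborel (exponential_density 1))" ..
  also have "\<dots> = (\<integral>\<^sup>+x. ennreal (erlang_density 0 1 x) * ennreal x \<partial>lborel)"
    by (rule nn_integral_density) auto
  also have "\<dots> = (\<integral>\<^sup>+x. ennreal (erlang_density 0 1 x * x ^ 1) \<partial>lborel)"
    by (intro nn_integral_cong) (auto simp: erlang_density_def ennreal_mult'')
  also have "\<dots> = 1" by (subst nn_integral_erlang_ith_moment) auto
  finally show ?thesis .
qed

context reversible_chain begin

abbreviation path_law :: "'s \<Rightarrow> (nat \<Rightarrow> 's) measure" where
  "path_law r \<equiv> chain_law (jump_kernel q) r"

text \<open>
The step from \<open>n\<close> to \<open>n + 1\<close> in \<open>emeasure_away\<close>; the case \<open>y = r\<close> is the probability that the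
first return happens at time \<open>n + 1\<close>.
\<close>

lemma emeasure_away_next:
  assumes r: "w r > 0"
    and away: "\<And>z. emeasure (path_law r) (away r n z) = ennreal (mass z * first_hit r n z / mass r)"
  shows "emeasure (path_law r) {Y. Y (Suc n) = y \<and> (\<forall>j. 0 < j \<and> j \<le> n \<longrightarrow> Y j \<noteq> r)} =
    ennreal (mass y * mean (first_hit r n) y / mass r)"
proof -
  have nonneg: "mass z * first_hit r n z / mass r \<ge> 0" for z
    by (intro divide_nonneg_nonneg mult_nonneg_nonneg mass_nonneg first_hit_nonneg)
  have "emeasure (path_law r) {Y. Y (Suc n) = y \<and> (\<forall>j. 0 < j \<and> j \<le> n \<longrightarrow> Y j \<noteq> r)} =
      (\<integral>\<^sup>+z. ennreal (mass z * first_hit r n z / mass r) * ennreal (step_prob z y) \<partial>count_space UNIV)"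
    unfolding emeasure_away_step away pmf_jump step_prob_def ..
  also have "\<dots> = (\<Sum>z\<in>nbrs y. ennreal (mass z * first_hit r n z / mass r) * ennreal (step_prob z y))"
    by (rule nn_integral_count_space'[OF finite_nbrs]) (auto simp: nbrs_def step_prob_def)
  also have "\<dots> = (\<Sum>z\<in>nbrs y. ennreal (mass y * (step_prob y z * first_hit r n z) / mass r))"
  proof (rule sum.cong[OF refl])
    fix z
    have "mass z * step_prob z y = mass y * step_prob y z"
      unfolding mass_step_prob by (rule conductance_sym)
    then have "(mass z * step_prob z y) * first_hit r n z / mass r =
        (mass y * step_prob y z) * first_hit r n z / mass r"
      by (simp only:)
    then have "mass z * first_hit r n z / mass r * step_prob z y =
        mass y * (step_prob y z * first_hit r n z) / mass r"
      by (simp only: mult_ac times_divide_eq_left times_divide_eq_right)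
    then show "ennreal (mass z * first_hit r n z / mass r) * ennreal (step_prob z y) =
        ennreal (mass y * (step_prob y z * first_hit r n z) / mass r)"
      by (simp only: ennreal_mult[OF nonneg step_prob_nonneg, symmetric])
  qed
  also have "\<dots> = ennreal (\<Sum>z\<in>nbrs y. mass y * (step_prob y z * first_hit r n z) / mass r)"
    by (intro sum_ennreal divide_nonneg_nonneg mult_nonneg_nonneg mass_nonneg first_hit_nonneg step_prob_nonneg)
  also have "(\<Sum>z\<in>nbrs y. mass y * (step_prob y z * first_hit r n z) / mass r) =
      mass y * mean (first_hit r n) y / mass r"
    unfolding mean_def by (simp add: sum_distrib_left sum_divide_distrib)
  finally show ?thesis .
qed

text \<open>
Time reversal: weighting with the invariant measure turns trajectories from \<open>r\<close> to \<open>y\<close> that avoid \<open>r\<close>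
in between into trajectories from \<open>y\<close> that hit \<open>r\<close> at time \<open>n\<close> for the first time.
\<close>

lemma emeasure_away:
  assumes r: "w r > 0"
  shows "emeasure (path_law r) (away r n y) = ennreal (mass y * first_hit r n y / mass r)"
proof (induction n arbitrary: y)
  case 0
  have "mass r > 0" unfolding mass_def using r exit_rate_positive[of r] by simp
  moreover have "away r 0 y = {Y. \<forall>k\<le>0. Y k = y}" unfolding away_def by auto
  ultimately show ?case using emeasure_chain_law[of "jump_kernel q" r 0 "\<lambda>_. y"] by auto
next
  case (Suc n)
  show ?case
  proof (cases "y = r")
    case True
    then have "away r (Suc n) y = {}" unfolding away_def by auto
    then show ?thesis using True by simp
  next
    case False
    then have "away r (Suc n) y = {Y. Y (Suc n) = y \<and> (\<forall>j. 0 < j \<and> j \<le> n \<longrightarrow> Y j \<noteq> r)}"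
      unfolding away_def by (auto simp: le_Suc_eq)
    then show ?thesis using False emeasure_away_next[OF r Suc, of y] by simp
  qed
qed

lemma first_return_measurable:
  "{Y. Y (Suc n) = r \<and> (\<forall>j. 0 < j \<and> j \<le> n \<longrightarrow> Y j \<noteq> r)} \<in> sets (path_law r)"
  by (rule determined_by_prefix_measurable[of "Suc n"]) (auto simp: determined_by_prefix_def)

lemma return_probability_eq:
  assumes r: "w r > 0"
  shows "return_probability q r = return_prob r"
proof -
  interpret P: prob_space "path_law r" by (rule prob_space_chain_law)
  have mass: "mass r > 0" unfolding mass_def using r exit_rate_positive[of r] by simp
  define A where "A n = {Y. Y (Suc n) = r \<and> (\<forall>j. 0 < j \<and> j \<le> n \<longrightarrow> Y j \<noteq> r)}" for n
  have A: "A n \<in> sets (path_law r)" for n unfolding A_def by (rule first_return_measurable)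
  have "{Y. \<exists>n\<ge>1. Y n = r} = (\<Union>n. A n)"
  proof (intro equalityI subsetI)
    fix Y :: "nat \<Rightarrow> 's" assume "Y \<in> {Y. \<exists>n\<ge>1. Y n = r}"
    then have ex: "\<exists>n. Y (Suc n) = r" by (auto simp: Suc_le_eq gr0_conv_Suc)
    define m where "m = (LEAST n. Y (Suc n) = r)"
    have "Y (Suc m) = r" unfolding m_def by (rule LeastI_ex[OF ex])
    moreover have "Y j \<noteq> r" if "0 < j" "j \<le> m" for j
      using not_less_Least[of "j - 1" "\<lambda>n. Y (Suc n) = r"] that unfolding m_def[symmetric] by simp
    ultimately show "Y \<in> (\<Union>n. A n)" unfolding A_def by blast
  qed (auto simp: A_def)
  moreover have "disjoint_family A"
    unfolding disjoint_family_on_def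
  proof (intro ballI impI)
    fix m n :: nat assume "m \<noteq> n"
    then show "A m \<inter> A n = {}"
    proof (cases "m < n")
      case True
      then show ?thesis unfolding A_def by (auto simp: Suc_le_eq)
    next
      case False
      then have "n < m" using \<open>m \<noteq> n\<close> by simp
      then show ?thesis unfolding A_def by (auto simp: Suc_le_eq)
    qed
  qed
  moreover have "range A \<subseteq> sets (path_law r)" using A by blast
  ultimately have "emeasure (path_law r) {Y. \<exists>n\<ge>1. Y n = r} = (\<Sum>n. emeasure (path_law r) (A n))"
    using suminf_emeasure[of A "path_law r", symmetric] by (simp only:)
  also have "\<dots> = (\<Sum>n. ennreal (mean (first_hit r n) r))"
    unfolding A_def emeasure_away_next[OF r emeasure_away[OF r]] using mass by simp
  also have "\<dots> = ennreal (return_prob r)"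
    unfolding return_prob_def
    by (rule suminf_ennreal2[OF mean_first_hit_nonneg summable_mean_first_hit])
  finally show ?thesis
    unfolding return_probability_def measure_def return_prob_def
    by (simp add: suminf_nonneg summable_mean_first_hit mean_first_hit_nonneg)
qed

lemma nn_integral_away:
  assumes r: "w r > 0"
  shows "(\<integral>\<^sup>+Y. g (Y k) * indicator {Y. \<forall>j. 0 < j \<and> j \<le> k \<longrightarrow> Y j \<noteq> r} Y \<partial>path_law r) =
    (\<integral>\<^sup>+y. g y * ennreal (mass y * first_hit r k y / mass r) \<partial>count_space UNIV)"
proof -
  have "(\<integral>\<^sup>+Y. g (Y k) * indicator {Y. \<forall>j. 0 < j \<and> j \<le> k \<longrightarrow> Y j \<noteq> r} Y \<partial>path_law r) =
      (\<integral>\<^sup>+Y. (\<integral>\<^sup>+y. g y * indicator (away r k y) Y \<partial>count_space UNIV) \<partial>path_law r)"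
  proof (rule nn_integral_cong)
    fix Y :: "nat \<Rightarrow> 's"
    have "(\<integral>\<^sup>+y. g y * indicator (away r k y) Y \<partial>count_space UNIV) =
        (\<Sum>y\<in>{Y k}. g y * indicator (away r k y) Y)"
      by (rule nn_integral_count_space') (auto simp: away_def indicator_def)
    then show "g (Y k) * indicator {Y. \<forall>j. 0 < j \<and> j \<le> k \<longrightarrow> Y j \<noteq> r} Y =
        (\<integral>\<^sup>+y. g y * indicator (away r k y) Y \<partial>count_space UNIV)"
      by (simp add: away_def indicator_def)
  qed
  also have "\<dots> = (\<integral>\<^sup>+y. (\<integral>\<^sup>+Y. g y * indicator (away r k y) Y \<partial>path_law r) \<partial>count_space UNIV)"
    by (rule nn_integral_count_space_nn_integral) auto
  also have "\<dots> = (\<integral>\<^sup>+y. g y * emeasure (path_law r) (away r k y) \<partial>count_space UNIV)"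
    by (intro nn_integral_cong nn_integral_cmult_indicator away_measurable)
  finally show ?thesis unfolding emeasure_away[OF r] .
qed

text \<open>
The expected return time is the sum over all \<open>k\<close> and \<open>y\<close> of the probability to be in \<open>y\<close> at time \<open>k\<close>
before returning, times the mean holding time in \<open>y\<close>. Time reversal turns the probability into
\<open>mass y * first_hit r k y / mass r\<close>, and \<open>mass y\<close> over the exit rate is \<open>w y\<close>.
\<close>

theorem expected_return_time_eq:
  assumes r: "w r > 0" and ret: "return_prob r = 1"
  shows "expected_return_time q r = (\<integral>\<^sup>+y. ennreal (w y * hit_prob r y / mass r) \<partial>count_space UNIV)"
proof -
  interpret P: prob_space "path_law r" by (rule prob_space_chain_law)
  interpret H: prob_space holding_law by (rule prob_space_holding_law)
  interpret PH: pair_sigma_finite "path_law r" holding_law ..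
  have mass: "mass r > 0" unfolding mass_def using r exit_rate_positive[of r] by simp
  define B where "B k = {Y :: nat \<Rightarrow> 's. \<forall>j. 0 < j \<and> j \<le> k \<longrightarrow> Y j \<noteq> r}" for k
  have B_meas [measurable]: "B k \<in> sets (path_law r)" for k
    by (rule determined_by_prefix_measurable[of k]) (auto simp: determined_by_prefix_def B_def)
  define Ret where "Ret = {Y :: nat \<Rightarrow> 's. \<exists>n\<ge>1. Y n = r}"
  have Ret_meas [measurable]: "Ret \<in> sets (path_law r)"
  proof -
    have "{Y \<in> space (path_law r). \<exists>n\<in>{1..}. Y n = r} \<in> sets (path_law r)" by measurable
    then show ?thesis unfolding Ret_def by (simp add: Bex_def)
  qed
  have "P.prob Ret = 1"
    using return_probability_eq[OF r] ret unfolding return_probability_def Ret_def by simp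
  then have AE_ret: "AE Y in path_law r. Y \<in> Ret" using P.prob_eq_1[OF Ret_meas] by simp
  have meas: "(\<lambda>\<omega>. ennreal (snd \<omega> k / exit_rate q (fst \<omega> k)) * indicator (B k) (fst \<omega>))
      \<in> borel_measurable (path_law r \<Otimes>\<^sub>M holding_law)" for k
  proof -
    have [measurable]: "(\<lambda>\<omega>. exit_rate q (fst \<omega> k)) \<in> borel_measurable (path_law r \<Otimes>\<^sub>M holding_law)"
      by (rule measurable_compose[of _ _ "count_space UNIV"]) auto
    show ?thesis by measurable
  qed
  have AE_AE: "AE Y in path_law r. AE T in holding_law. Y \<in> Ret \<and> (\<forall>n. T n > 0)"
    using AE_ret by eventually_elim (use AE_holding_positive in simp)
  have AE: "AE \<omega> in path_law r \<Otimes>\<^sub>M holding_law. fst \<omega> \<in> Ret \<and> (\<forall>n. snd \<omega> n > 0)"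
  proof (rule PH.AE_pair_measure)
    have pos: "{T \<in> space holding_law. \<forall>n. T n > 0} \<in> sets holding_law" by measurable
    have "{\<omega> \<in> space (path_law r \<Otimes>\<^sub>M holding_law). fst \<omega> \<in> Ret \<and> (\<forall>n. snd \<omega> n > 0)} =
        Ret \<times> {T \<in> space holding_law. \<forall>n. T n > 0}"
      by (auto simp: space_pair_measure)
    then show "{\<omega> \<in> space (path_law r \<Otimes>\<^sub>M holding_law). fst \<omega> \<in> Ret \<and> (\<forall>n. snd \<omega> n > 0)}
        \<in> sets (path_law r \<Otimes>\<^sub>M holding_law)"
      using pair_measureI[OF Ret_meas pos] by (simp only:)
  qed (use AE_AE in simp)
  have "expected_return_time q r =
      (\<integral>\<^sup>+\<omega>. (\<Sum>k. ennreal (snd \<omega> k / exit_rate q (fst \<omega> k)) * indicator (B k) (fst \<omega>)) \<partial>(path_law r \<Otimes>\<^sub>M holding_law))"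
    unfolding expected_return_time_def ctmc_law_def
  proof (rule nn_integral_cong_AE, use AE in eventually_elim)
    fix \<omega> :: "(nat \<Rightarrow> 's) \<times> (nat \<Rightarrow> real)"
    assume "fst \<omega> \<in> Ret \<and> (\<forall>n. snd \<omega> n > 0)"
    then show "return_time q r \<omega> = (\<Sum>k. ennreal (snd \<omega> k / exit_rate q (fst \<omega> k)) * indicator (B k) (fst \<omega>))"
      using return_time_eq_sum[of "snd \<omega>" q "fst \<omega>" r] exit_rate_positive
      unfolding Ret_def B_def by simp
  qed
  also have "\<dots> = (\<Sum>k. \<integral>\<^sup>+\<omega>. ennreal (snd \<omega> k / exit_rate q (fst \<omega> k)) * indicator (B k) (fst \<omega>) \<partial>(path_law r \<Otimes>\<^sub>M holding_law))"
    by (rule nn_integral_suminf[OF meas])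
  also have "\<dots> = (\<Sum>k. \<integral>\<^sup>+y. ennreal (w y * first_hit r k y / mass r) \<partial>count_space UNIV)"
  proof (rule arg_cong[where f = suminf], rule ext)
    fix k
    have "(\<integral>\<^sup>+\<omega>. ennreal (snd \<omega> k / exit_rate q (fst \<omega> k)) * indicator (B k) (fst \<omega>) \<partial>(path_law r \<Otimes>\<^sub>M holding_law)) =
        (\<integral>\<^sup>+Y. \<integral>\<^sup>+T. ennreal (T k / exit_rate q (Y k)) * indicator (B k) Y \<partial>holding_law \<partial>path_law r)"
      using H.nn_integral_fst[OF meas[of k]] by simp
    also have "\<dots> = (\<integral>\<^sup>+Y. ennreal (1 / exit_rate q (Y k)) * indicator (B k) Y \<partial>path_law r)"
    proof (rule nn_integral_cong)
      fix Y :: "nat \<Rightarrow> 's"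
      have "(\<integral>\<^sup>+T. ennreal (T k / exit_rate q (Y k)) * indicator (B k) Y \<partial>holding_law) =
          (\<integral>\<^sup>+T. ennreal (T k) * (ennreal (1 / exit_rate q (Y k)) * indicator (B k) Y) \<partial>holding_law)"
        using exit_rate_positive[of "Y k"]
        by (intro nn_integral_cong) (simp add: ennreal_mult''[symmetric] mult.assoc[symmetric])
      also have "\<dots> = (\<integral>\<^sup>+T. ennreal (T k) \<partial>holding_law) * (ennreal (1 / exit_rate q (Y k)) * indicator (B k) Y)"
        by (rule nn_integral_multc) measurable
      finally show "(\<integral>\<^sup>+T. ennreal (T k / exit_rate q (Y k)) * indicator (B k) Y \<partial>holding_law) =
          ennreal (1 / exit_rate q (Y k)) * indicator (B k) Y"
        by (simp add: nn_integral_holding)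
    qed
    also have "\<dots> = (\<integral>\<^sup>+y. ennreal (1 / exit_rate q y) * ennreal (mass y * first_hit r k y / mass r) \<partial>count_space UNIV)"
      unfolding B_def by (rule nn_integral_away[OF r])
    also have "\<dots> = (\<integral>\<^sup>+y. ennreal (w y * first_hit r k y / mass r) \<partial>count_space UNIV)"
    proof (rule nn_integral_cong)
      fix y
      have "1 / exit_rate q y * (mass y * first_hit r k y / mass r) = w y * first_hit r k y / mass r"
        unfolding mass_def[of y] using exit_rate_positive[of y] by simp
      then show "ennreal (1 / exit_rate q y) * ennreal (mass y * first_hit r k y / mass r) =
          ennreal (w y * first_hit r k y / mass r)"
        using exit_rate_positive[of y] by (subst ennreal_mult'[symmetric]) auto
    qed
    finally show "(\<integral>\<^sup>+\<omega>. ennreal (snd \<omega> k / exit_rate q (fst \<omega> k)) * indicator (B k) (fst \<omega>) \<partial>(path_law r \<Otimes>\<^sub>M holding_law)) =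
        (\<integral>\<^sup>+y. ennreal (w y * first_hit r k y / mass r) \<partial>count_space UNIV)" .
  qed
  also have "\<dots> = (\<integral>\<^sup>+y. (\<Sum>k. ennreal (w y * first_hit r k y / mass r)) \<partial>count_space UNIV)"
    by (rule nn_integral_suminf[symmetric]) simp
  also have "\<dots> = (\<integral>\<^sup>+y. ennreal (w y * hit_prob r y / mass r) \<partial>count_space UNIV)"
  proof (rule nn_integral_cong)
    fix y
    have "(\<Sum>k. ennreal (w y * first_hit r k y / mass r)) = ennreal (\<Sum>k. w y * first_hit r k y / mass r)"
      using mass weight_nonneg[of y]
      by (intro suminf_ennreal2 summable_divide summable_mult summable_first_hit) simp
    also have "(\<Sum>k. w y * first_hit r k y / mass r) = w y * hit_prob r y / mass r"
      unfolding hit_prob_def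
      by (subst suminf_divide) (auto intro: summable_mult summable_first_hit simp: suminf_mult summable_first_hit)
    finally show "(\<Sum>k. ennreal (w y * first_hit r k y / mass r)) = ennreal (w y * hit_prob r y / mass r)" .
  qed
  finally show ?thesis .
qed

lemma expected_return_time_finite:
  assumes r: "w r > 0" and ret: "return_prob r = 1"
    and bound: "\<And>F. finite F \<Longrightarrow> sum w F \<le> B"
  shows "expected_return_time q r < \<infinity>"
proof -
  have mass: "mass r > 0" unfolding mass_def using r exit_rate_positive[of r] by simp
  have "w summable_on UNIV"
    by (rule nonneg_bdd_above_summable_on) (use bound weight_nonneg in \<open>auto intro!: bdd_aboveI[of _ B]\<close>)
  then have "(\<lambda>y. w y / mass r) summable_on UNIV"
    unfolding divide_inverse by (rule summable_on_cmult_left)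
  then have "Infinite_Set_Sum.abs_summable_on (\<lambda>y. w y / mass r) UNIV"
    unfolding abs_summable_equivalent[symmetric]
    using mass weight_nonneg by (simp add: abs_of_nonneg)
  then have "(\<integral>\<^sup>+y. ennreal (w y / mass r) \<partial>count_space UNIV) < \<infinity>"
    using mass weight_nonneg by (subst nn_integral_conv_infsetsum) auto
  moreover have "expected_return_time q r \<le> (\<integral>\<^sup>+y. ennreal (w y / mass r) \<partial>count_space UNIV)"
    unfolding expected_return_time_eq[OF r ret]
    using mass weight_nonneg hit_prob_le_1 hit_prob_nonneg
    by (intro nn_integral_mono ennreal_leI divide_right_mono mult_left_le) auto
  ultimately show ?thesis by (rule le_less_trans[rotated])
qed

lemma expected_return_time_infinite:
  assumes r: "w r > 0" and ret: "return_prob r = 1"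
    and A: "infinite A" "\<And>y. y \<in> A \<Longrightarrow> w y \<ge> 1" "\<And>y. y \<in> A \<Longrightarrow> hit_prob r y = 1"
  shows "expected_return_time q r = \<infinity>"
proof -
  have mass: "mass r > 0" unfolding mass_def using r exit_rate_positive[of r] by simp
  have "ennreal (1 / mass r) * emeasure (count_space UNIV) A =
      (\<integral>\<^sup>+y. ennreal (1 / mass r) * indicator A y \<partial>count_space UNIV)"
    by (rule nn_integral_cmult_indicator[symmetric]) simp
  also have "\<dots> \<le> expected_return_time q r"
    unfolding expected_return_time_eq[OF r ret]
    using mass A(2,3) by (intro nn_integral_mono) (auto simp: indicator_def intro!: ennreal_leI divide_right_mono)
  finally show ?thesis using A(1) mass by (simp add: ennreal_mult_top top_unique ennreal_eq_0_iff)
qed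

end


section \<open>The largest eigenvalue of a graph\<close>

text \<open>
Eigenvectors of a symmetric matrix for different eigenvalues are orthogonal, hence independent. Finiteness is
what makes the maximum in the definition of the largest eigenvalue meaningful.
\<close>

lemma finite_eigenvalues:
  fixes A :: "real^'n^'n"
  assumes sym: "\<And>x y. x \<bullet> (A *v y) = y \<bullet> (A *v x)"
  shows "finite (eigenvalues A)"
proof -
  define v where "v l = (SOME v. v \<noteq> 0 \<and> A *v v = l *\<^sub>R v)" for l
  have v: "v l \<noteq> 0 \<and> A *v v l = l *\<^sub>R v l" if "l \<in> eigenvalues A" for l
    unfolding v_def by (rule someI_ex) (use that in \<open>simp add: eigenvalues_def\<close>)
  have orth: "v l \<bullet> v l' = 0" if l: "l \<in> eigenvalues A" "l' \<in> eigenvalues A" "l \<noteq> l'" for l l'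
  proof -
    have "l' * (v l \<bullet> v l') = l * (v l' \<bullet> v l)"
      using sym[of "v l" "v l'"] v[OF l(1)] v[OF l(2)] by simp
    then show ?thesis using l(3) by (simp add: inner_commute)
  qed
  have inj: "inj_on v (eigenvalues A)"
  proof (rule inj_onI, rule ccontr)
    fix l l' assume "l \<in> eigenvalues A" "l' \<in> eigenvalues A" "v l = v l'" "l \<noteq> l'"
    then show False using orth[of l l'] v[of l] by simp
  qed
  have "independent (v ` eigenvalues A)"
    by (rule pairwise_orthogonal_independent)
       (use orth v in \<open>auto simp: pairwise_def orthogonal_def inj_on_eq_iff[OF inj]\<close>)
  then have "finite (v ` eigenvalues A)" by (rule finiteI_independent)
  then show ?thesis using inj by (simp add: finite_image_iff)
qed

lemma adjacency_matrix_mult: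
  "(adjacency_matrix E *v x) $ i = (\<Sum>j | E i j. x $ j)"
  unfolding adjacency_matrix_def matrix_vector_mult_def
  by (simp add: if_distrib[of "\<lambda>a. a * _"] sum.If_cases cong: if_cong)

lemma adjacency_form:
  "x \<bullet> (adjacency_matrix E *v y) = (\<Sum>i\<in>UNIV. \<Sum>j | E i j. x $ i * y $ j)"
  by (simp add: inner_vec_def adjacency_matrix_mult sum_distrib_left)

lemma adjacency_form_sym:
  assumes "symp E"
  shows "x \<bullet> (adjacency_matrix E *v y) = y \<bullet> (adjacency_matrix E *v x)"
proof -
  have E: "E i j = E j i" for i j using assms by (auto dest: sympD)
  have "(\<Sum>i\<in>UNIV. \<Sum>j | E i j. x $ i * y $ j) = (\<Sum>i\<in>UNIV. \<Sum>j\<in>UNIV. if E i j then x $ i * y $ j else 0)"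
    by (simp add: sum.If_cases)
  also have "\<dots> = (\<Sum>j\<in>UNIV. \<Sum>i\<in>UNIV. if E i j then x $ i * y $ j else 0)"
    by (rule sum.swap)
  also have "\<dots> = (\<Sum>j\<in>UNIV. \<Sum>i\<in>UNIV. if E j i then y $ j * x $ i else 0)"
    by (intro sum.cong refl if_cong E mult.commute)
  also have "\<dots> = (\<Sum>j\<in>UNIV. \<Sum>i | E j i. y $ j * x $ i)"
    by (simp add: sum.If_cases)
  finally show ?thesis unfolding adjacency_form .
qed

text \<open>
The quadratic form attains its maximum \<open>\<mu>\<close> on the unit sphere. As the entries of the matrix are nonnegative,
replacing a maximiser by its vector \<open>a\<close> of absolute values does not decrease the form, so \<open>a\<close> is a
maximiser as well; and a maximiser is an eigenvector, because otherwise a small step in the direction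
\<open>y = A a - \<mu> a\<close> would make the form exceed \<open>\<mu>\<close> times the squared norm. So \<open>\<mu>\<close> is the largest eigenvalue, with a nonnegative eigenvector.
\<close>

lemma largest_eigenvalue_adjacency:
  fixes E :: "'v::finite \<Rightarrow> 'v \<Rightarrow> bool"
  assumes "symp E"
  defines "A \<equiv> adjacency_matrix E"
  shows rayleigh: "x \<bullet> (A *v x) \<le> largest_eigenvalue A * (x \<bullet> x)"
    and perron_vector: "\<exists>v. (\<forall>i. v $ i \<ge> 0) \<and> (\<Sum>i\<in>UNIV. v $ i) = 1 \<and>
      A *v v = largest_eigenvalue A *\<^sub>R v"
proof -
  have sym: "x \<bullet> (A *v y) = y \<bullet> (A *v x)" for x y
    unfolding A_def by (rule adjacency_form_sym[OF assms(1)])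
  have cont: "continuous_on (sphere 0 1) (\<lambda>x. x \<bullet> (A *v x))"
    by (intro continuous_intros linear_continuous_on matrix_vector_mul_linear
        linear_conv_bounded_linear[THEN iffD1])
  have "axis undefined 1 \<in> sphere (0 :: real^'v) 1" by simp
  then have ne: "sphere (0 :: real^'v) 1 \<noteq> {}" by blast
  then obtain u where u: "norm u = 1" and max: "\<And>x. norm x = 1 \<Longrightarrow> x \<bullet> (A *v x) \<le> u \<bullet> (A *v u)"
    using continuous_attains_sup[OF compact_sphere ne cont] by (auto simp: sphere_def dist_norm)
  define \<mu> where "\<mu> = u \<bullet> (A *v u)"
  have ray: "x \<bullet> (A *v x) \<le> \<mu> * (x \<bullet> x)" for x
  proof (cases "x = 0")
    case False
    let ?y = "(1 / norm x) *\<^sub>R x"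
    have "norm ?y = 1" using False by simp
    then have "?y \<bullet> (A *v ?y) \<le> \<mu>" unfolding \<mu>_def by (rule max)
    then have "(x \<bullet> (A *v x)) / (norm x * norm x) \<le> \<mu>"
      by (simp add: matrix_vector_mult_scaleR)
    then show ?thesis using False by (simp add: pos_divide_le_eq dot_square_norm power2_eq_square)
  qed simp
  define a where "a = (\<chi> i. \<bar>u $ i\<bar>)"
  have aa: "a \<bullet> a = 1"
    using u by (simp add: a_def inner_vec_def norm_eq_1)
  have "u \<bullet> (A *v u) \<le> a \<bullet> (A *v a)"
    unfolding A_def adjacency_form a_def
    by (intro sum_mono) (simp add: abs_mult[symmetric])
  then have a_max: "a \<bullet> (A *v a) = \<mu> * (a \<bullet> a)"
    using ray[of a] aa unfolding \<mu>_def by simp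
  have eig: "A *v a = \<mu> *\<^sub>R a"
  proof -
    define y where "y = A *v a - \<mu> *\<^sub>R a"
    \<comment> \<open>The inequality \<open>ray\<close> at \<open>a + t y\<close>; for small \<open>t > 0\<close> the linear term would violate it.\<close>
    have quad: "0 \<le> t * (t * (\<mu> * (y \<bullet> y) - y \<bullet> (A *v y)) - 2 * (y \<bullet> y))" for t
    proof -
      have form: "(a + t *\<^sub>R y) \<bullet> (A *v (a + t *\<^sub>R y)) =
          a \<bullet> (A *v a) + 2 * t * (y \<bullet> (A *v a)) + t * t * (y \<bullet> (A *v y))"
        using sym[of a y]
        by (simp add: matrix_vector_right_distrib matrix_vector_mult_scaleR inner_simps algebra_simps)
      have square: "(a + t *\<^sub>R y) \<bullet> (a + t *\<^sub>R y) = a \<bullet> a + 2 * t * (y \<bullet> a) + t * t * (y \<bullet> y)"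
        by (simp add: inner_add_left inner_add_right inner_commute)
      have split: "y \<bullet> (A *v a) = y \<bullet> y + \<mu> * (y \<bullet> a)"
        using arg_cong[OF y_def, of "inner y"] by (simp add: inner_diff_right)
      have "\<mu> * n + 2 * t * (Y + \<mu> * s) + t * t * r \<le> \<mu> * (n + 2 * t * s + t * t * Y) \<Longrightarrow>
          0 \<le> t * (t * (\<mu> * Y - r) - 2 * Y)" for n Y s r :: real
        by (simp add: algebra_simps)
      then show ?thesis
        using ray[of "a + t *\<^sub>R y"] unfolding form square split a_max by blast
    qed
    have "y \<bullet> y = 0"
    proof (rule ccontr)
      assume ne: "y \<bullet> y \<noteq> 0"
      then have pos: "y \<bullet> y > 0" using inner_ge_zero[of y] by linarith
      define d where "d = \<bar>\<mu> * (y \<bullet> y) - y \<bullet> (A *v y)\<bar> + 1"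
      define t where "t = (y \<bullet> y) / d"
      have d: "d > 0" by (simp add: d_def)
      have t: "t > 0" using pos d by (simp add: t_def)
      have "t * (\<mu> * (y \<bullet> y) - y \<bullet> (A *v y)) \<le> t * d"
        using t by (intro mult_left_mono) (auto simp: d_def)
      also have "t * d = y \<bullet> y" using d by (simp add: t_def)
      finally have "t * (\<mu> * (y \<bullet> y) - y \<bullet> (A *v y)) - 2 * (y \<bullet> y) < 0" using pos by linarith
      then have "t * (t * (\<mu> * (y \<bullet> y) - y \<bullet> (A *v y)) - 2 * (y \<bullet> y)) < 0"
        using t by (simp add: mult_pos_neg)
      then show False using quad[of t] by linarith
    qed
    then show ?thesis unfolding y_def by simp
  qed
  have a0: "a \<noteq> 0" using aa by auto
  have le: "l \<le> \<mu>" if l: "l \<in> eigenvalues A" for l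
  proof -
    obtain v where v: "v \<noteq> 0" "A *v v = l *\<^sub>R v" using l unfolding eigenvalues_def by auto
    have "l * (v \<bullet> v) \<le> \<mu> * (v \<bullet> v)" using ray[of v] v by simp
    moreover have "v \<bullet> v > 0" using v by simp
    ultimately show ?thesis by simp
  qed
  have "\<mu> \<in> eigenvalues A" unfolding eigenvalues_def using eig a0 by auto
  then have mu: "largest_eigenvalue A = \<mu>"
    unfolding largest_eigenvalue_def by (intro Max_eqI finite_eigenvalues sym le)
  show "x \<bullet> (A *v x) \<le> largest_eigenvalue A * (x \<bullet> x)" unfolding mu by (rule ray)
  define s where "s = (\<Sum>i\<in>UNIV. a $ i)"
  have a_nonneg: "a $ i \<ge> 0" for i by (simp add: a_def)
  have s: "s > 0"
  proof -
    have "s \<noteq> 0"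
    proof
      assume "s = 0"
      then have "a $ i = 0" for i
        unfolding s_def using sum_nonneg_eq_0_iff[of UNIV "\<lambda>i. a $ i"] a_nonneg by simp
      then show False using a0 by (simp add: vec_eq_iff)
    qed
    moreover have "s \<ge> 0" unfolding s_def by (intro sum_nonneg) (simp add: a_nonneg)
    ultimately show ?thesis by simp
  qed
  show "\<exists>v. (\<forall>i. v $ i \<ge> 0) \<and> (\<Sum>i\<in>UNIV. v $ i) = 1 \<and> A *v v = largest_eigenvalue A *\<^sub>R v"
  proof (intro exI[of _ "(1 / s) *\<^sub>R a"] conjI allI)
    show "(\<Sum>i\<in>UNIV. ((1 / s) *\<^sub>R a) $ i) = 1"
      using s by (simp add: sum_divide_distrib[symmetric] s_def[symmetric])
    show "A *v ((1 / s) *\<^sub>R a) = largest_eigenvalue A *\<^sub>R ((1 / s) *\<^sub>R a)"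
      by (simp add: matrix_vector_mult_scaleR eig mu)
  qed (use s a_nonneg in simp)
qed


section \<open>Sums over lattice points\<close>

text \<open>
The image of \<open>F\<close> lies in a box, over which the sum of products is the product of sums.
\<close>

lemma sum_prod_coordinates_le:
  fixes W :: "'v::finite \<Rightarrow> nat \<Rightarrow> real" and u :: "'a \<Rightarrow> 'v \<Rightarrow> nat"
  assumes "finite F" "inj_on u F" and nonneg: "\<And>k x. W k x \<ge> 0"
    and bound: "\<And>\<xi> k. \<xi> \<in> F \<Longrightarrow> u \<xi> k \<le> N"
  shows "(\<Sum>\<xi>\<in>F. \<Prod>k\<in>UNIV. W k (u \<xi> k)) \<le> (\<Prod>k\<in>UNIV. \<Sum>x\<le>N. W k x)"
proof -
  have "(\<Sum>\<xi>\<in>F. \<Prod>k\<in>UNIV. W k (u \<xi> k)) = (\<Sum>g\<in>u ` F. \<Prod>k\<in>UNIV. W k (g k))"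
    by (simp add: sum.reindex[OF assms(2)])
  also have "\<dots> \<le> (\<Sum>g\<in>PiE UNIV (\<lambda>_. {..N}). \<Prod>k\<in>UNIV. W k (g k))"
    using bound by (intro sum_mono2 finite_PiE prod_nonneg) (auto simp: nonneg)
  also have "\<dots> = (\<Prod>k\<in>UNIV. \<Sum>x\<le>N. W k x)"
    by (rule prod_sum_PiE[symmetric]) auto
  finally show ?thesis .
qed

lemma sum_powers_le: "0 \<le> b \<Longrightarrow> b < 1 \<Longrightarrow> (\<Sum>x\<le>N. b ^ x) \<le> 1 / (1 - b :: real)"
  using sum_le_suminf[OF summable_geometric[of b], of "{..N}"] by (simp add: suminf_geometric)


section \<open>The Gibbs weight of the interacting chain\<close>

locale graph_chain =
  fixes E :: "'v::finite \<Rightarrow> 'v \<Rightarrow> bool" and \<alpha> :: real and \<beta> :: ereal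
  assumes graph: "simple_graph E" and beta_finite: "\<beta> < \<infinity>"
begin

abbreviation rate :: "nat^'v \<Rightarrow> nat^'v \<Rightarrow> real" where
  "rate \<equiv> transition_rate \<alpha> \<beta> E"

abbreviation boltzmann :: real where
  "boltzmann \<equiv> exp_ereal \<beta>"

text \<open>
Each edge is counted in both directions, so this is twice the interaction energy; the weight below
compensates by using the square root of \<open>exp_ereal \<beta>\<close>. Using a natural number as exponent makes \<open>\<beta> = -\<infinity>\<close> a
regular case: the Boltzmann factor is then \<open>0\<close>, and \<open>0 ^ 0 = 1\<close>.
\<close>

definition interaction :: "nat^'v \<Rightarrow> nat" where
  "interaction \<xi> = (\<Sum>i\<in>UNIV. \<Sum>j | E i j. \<xi> $ i * \<xi> $ j)"

definition population :: "nat^'v \<Rightarrow> nat" where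
  "population \<xi> = (\<Sum>i\<in>UNIV. \<xi> $ i)"

definition gibbs :: "nat^'v \<Rightarrow> real" where
  "gibbs \<xi> = exp (\<alpha> / 2 * (\<Sum>i\<in>UNIV. real (\<xi> $ i) * (real (\<xi> $ i) - 1))) * sqrt boltzmann ^ interaction \<xi>"

lemma E_sym: "E i j \<longleftrightarrow> E j i"
  using graph unfolding simple_graph_def by (auto dest: sympD)

lemma E_irrefl [simp]: "\<not> E i i"
  using graph unfolding simple_graph_def by (auto dest: irreflpD)

lemma boltzmann_nonneg [simp]: "boltzmann \<ge> 0"
  by (simp add: exp_ereal_def)

lemma population_add: "population (\<xi> + axis i 1) = Suc (population \<xi>)"
proof -
  have "population (\<xi> + axis i 1) = (\<Sum>j\<in>UNIV. \<xi> $ j + (if j = i then 1 else 0))"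
    unfolding population_def by (intro sum.cong) (auto simp: axis_def)
  then show ?thesis by (simp add: sum.distrib population_def)
qed

declare population_add [unfolded One_nat_def, simp]

lemma sum_adjacent: "(\<Sum>j | E i j. f j) = (\<Sum>j\<in>UNIV. if E i j then f j else 0)"
  by (simp add: sum.If_cases)

lemma interaction_add: "interaction (\<xi> + axis i 1) = interaction \<xi> + 2 * (\<Sum>j | E i j. \<xi> $ j)"
proof -
  let ?d = "\<lambda>k. if k = i then 1 else 0 :: nat"
  have "interaction (\<xi> + axis i 1) = (\<Sum>k\<in>UNIV. \<Sum>j\<in>UNIV. if E k j then (\<xi> $ k + ?d k) * (\<xi> $ j + ?d j) else 0)"
    unfolding interaction_def sum_adjacent by (intro sum.cong refl if_cong) (auto simp: axis_def)
  also have "\<dots> = (\<Sum>k\<in>UNIV. \<Sum>j\<in>UNIV. (if E k j then \<xi> $ k * \<xi> $ j else 0) +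
      ((if k = i then if E i j then \<xi> $ j else 0 else 0) + (if j = i then if E i k then \<xi> $ k else 0 else 0)))"
    by (intro sum.cong refl) (auto simp: algebra_simps E_sym)
  also have "\<dots> = interaction \<xi> + ((\<Sum>k\<in>UNIV. \<Sum>j\<in>UNIV. if k = i then if E i j then \<xi> $ j else 0 else 0) +
      (\<Sum>k\<in>UNIV. \<Sum>j\<in>UNIV. if j = i then if E i k then \<xi> $ k else 0 else 0))"
    unfolding interaction_def by (simp add: sum.distrib sum.If_cases)
  also have "(\<Sum>k\<in>UNIV. \<Sum>j\<in>UNIV. if k = i then if E i j then \<xi> $ j else 0 else 0) = (\<Sum>j | E i j. \<xi> $ j)"
    by (subst sum.swap) (simp add: sum.If_cases)
  also have "(\<Sum>k\<in>UNIV. \<Sum>j\<in>UNIV. if j = i then if E i k then \<xi> $ k else 0 else 0) = (\<Sum>j | E i j. \<xi> $ j)"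
    by (simp add: sum.If_cases)
  finally show ?thesis by simp
qed

lemma birth_rate_eq: "birth_rate \<alpha> \<beta> E \<xi> i = exp (\<alpha> * real (\<xi> $ i)) * boltzmann ^ (\<Sum>j | E i j. \<xi> $ j)"
proof (cases \<beta>)
  case (real b)
  then show ?thesis
    unfolding birth_rate_def by (simp add: exp_ereal_def exp_add exp_of_nat_mult[symmetric] mult.commute)
next
  case MInf
  show ?thesis
  proof (cases "(\<Sum>j | E i j. \<xi> $ j) = 0")
    case True
    then have "(\<Sum>j | E i j. real (\<xi> $ j)) = 0" by simp
    then show ?thesis using True MInf unfolding birth_rate_def exp_ereal_def
      by (simp add: zero_ereal_def[symmetric])
  next
    case False
    then have "(\<Sum>j | E i j. real (\<xi> $ j)) > 0"
      by (metis of_nat_0_less_iff of_nat_sum neq0_conv)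
    then show ?thesis using False MInf unfolding birth_rate_def exp_ereal_def
      by (simp add: power_0_left)
  qed
qed (use beta_finite in simp)

text \<open>
The identity behind reversibility: the death rate is \<open>1\<close>, so the birth rate must be the quotient of
the weights.
\<close>

lemma gibbs_add: "gibbs (\<xi> + axis i 1) = gibbs \<xi> * birth_rate \<alpha> \<beta> E \<xi> i"
proof -
  let ?g = "\<lambda>x :: nat. real x * (real x - 1)"
  have "(\<Sum>k\<in>UNIV. ?g ((\<xi> + axis i 1) $ k)) = (\<Sum>k\<in>UNIV. ?g (\<xi> $ k) + (if k = i then 2 * real (\<xi> $ i) else 0))"
    by (intro sum.cong refl) (auto simp: axis_def algebra_simps)
  also have "\<dots> = (\<Sum>k\<in>UNIV. ?g (\<xi> $ k)) + 2 * real (\<xi> $ i)" by (simp add: sum.distrib)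
  finally have "exp (\<alpha> / 2 * (\<Sum>k\<in>UNIV. ?g ((\<xi> + axis i 1) $ k))) =
      exp (\<alpha> / 2 * (\<Sum>k\<in>UNIV. ?g (\<xi> $ k))) * exp (\<alpha> * real (\<xi> $ i))"
    by (simp add: exp_add[symmetric] algebra_simps)
  moreover have "sqrt boltzmann ^ interaction (\<xi> + axis i 1) = sqrt boltzmann ^ interaction \<xi> * boltzmann ^ (\<Sum>j | E i j. \<xi> $ j)"
    unfolding interaction_add by (simp add: power_add power_mult)
  ultimately show ?thesis unfolding gibbs_def birth_rate_eq by simp
qed

lemma gibbs_nonneg: "gibbs \<xi> \<ge> 0"
  unfolding gibbs_def by simp

lemma add_diff_axis: "\<xi> $ i > 0 \<Longrightarrow> \<xi> - axis i 1 + axis i 1 = (\<xi> :: nat^'v)"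
  by (auto simp: vec_eq_iff axis_def)

lemma rate_up: "rate \<xi> (\<xi> + axis i 1) = birth_rate \<alpha> \<beta> E \<xi> i"
  by (rule transition_rate_birth)

lemma rate_down: "rate (\<xi> + axis i 1) \<xi> = 1"
  using transition_rate_death[of "\<xi> + axis i 1" i \<alpha> \<beta> E] by simp

lemma rate_nonzero_cases:
  assumes "rate \<xi> \<eta> \<noteq> 0"
  obtains i where "\<eta> = \<xi> + axis i 1" | i where "\<xi> = \<eta> + axis i 1"
  using assms transition_rate_other[of \<eta> \<xi> \<alpha> \<beta> E] add_diff_axis by metis

lemma adjacent_states:
  "rate \<xi> \<eta> \<noteq> 0 \<or> rate \<eta> \<xi> \<noteq> 0 \<Longrightarrow> (\<exists>i. \<eta> = \<xi> + axis i 1) \<or> (\<exists>i. \<xi> = \<eta> + axis i 1)"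
  by (elim disjE rate_nonzero_cases) blast+

lemma neighbours_subset:
  "{\<eta>. rate \<xi> \<eta> \<noteq> 0 \<or> rate \<eta> \<xi> \<noteq> 0} \<subseteq> range (\<lambda>i. \<xi> + axis i 1) \<union> range (\<lambda>i. \<xi> - axis i 1)"
proof
  fix \<eta> assume "\<eta> \<in> {\<eta>. rate \<xi> \<eta> \<noteq> 0 \<or> rate \<eta> \<xi> \<noteq> 0}"
  then have "(\<exists>i. \<eta> = \<xi> + axis i 1) \<or> (\<exists>i. \<xi> = \<eta> + axis i 1)"
    using adjacent_states by blast
  then have "(\<exists>i. \<eta> = \<xi> + axis i 1) \<or> (\<exists>i. \<eta> = \<xi> - axis i 1)"
    by (metis add_diff_cancel_right')
  then show "\<eta> \<in> range (\<lambda>i. \<xi> + axis i 1) \<union> range (\<lambda>i. \<xi> - axis i 1)" by blast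
qed

lemma gibbs_balance: "gibbs \<xi> * rate \<xi> \<eta> = gibbs \<eta> * rate \<eta> \<xi>"
proof (cases "rate \<xi> \<eta> \<noteq> 0 \<or> rate \<eta> \<xi> \<noteq> 0")
  case True
  then have "(\<exists>i. \<eta> = \<xi> + axis i 1) \<or> (\<exists>i. \<xi> = \<eta> + axis i 1)"
    by (rule adjacent_states)
  then show ?thesis by (auto simp: gibbs_add rate_up rate_down simp del: One_nat_def)
qed simp

sublocale reversible_chain rate gibbs
proof
  show "finite {\<eta>. rate \<xi> \<eta> \<noteq> 0 \<or> rate \<eta> \<xi> \<noteq> 0}" for \<xi>
    by (rule finite_subset[OF neighbours_subset]) auto
qed (rule transition_rate_nonneg exit_rate_pos gibbs_nonneg gibbs_balance pmf_jump_kernel)+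

lemma conductance_down: "conductance (\<xi> + axis i 1) \<xi> = gibbs (\<xi> + axis i 1)"
  unfolding conductance_def rate_down by simp

lemma conductance_up: "conductance \<xi> (\<xi> + axis i 1) = gibbs (\<xi> + axis i 1)"
  using conductance_sym conductance_down by metis

lemma conductance_level:
  assumes "conductance \<xi> \<eta> > 0" shows "population \<eta> = Suc (population \<xi>) \<or> population \<xi> = Suc (population \<eta>)"
proof -
  have "rate \<xi> \<eta> \<noteq> 0" using assms unfolding conductance_def by auto
  then show ?thesis by (cases rule: rate_nonzero_cases) auto
qed

lemma component_le_population: "\<xi> $ i \<le> population \<xi>"
  unfolding population_def by (rule member_le_sum) auto

lemma finite_population_le: "finite {\<xi>. population \<xi> \<le> n}"
proof (rule finite_subset)
  show "{\<xi>. population \<xi> \<le> n} \<subseteq> vec_lambda ` (PiE UNIV (\<lambda>_. {..n}))"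
  proof
    fix \<xi> assume "\<xi> \<in> {\<xi>. population \<xi> \<le> n}"
    then have "vec_nth \<xi> \<in> PiE UNIV (\<lambda>_. {..n})"
      using component_le_population[of \<xi>] by (auto intro: order_trans)
    then show "\<xi> \<in> vec_lambda ` (PiE UNIV (\<lambda>_. {..n}))"
      by (metis image_eqI vec_nth_inverse)
  qed
qed (simp add: finite_PiE)

lemma nonzero_has_component:
  assumes "\<xi> \<noteq> (0 :: nat^'v)" obtains \<eta> i where "\<xi> = \<eta> + axis i 1"
proof -
  obtain i where "\<xi> $ i > 0" using assms by (auto simp: vec_eq_iff)
  then show ?thesis using that[of "\<xi> - axis i 1" i] add_diff_axis by metis
qed

lemma population_0_iff: "population \<xi> = 0 \<longleftrightarrow> \<xi> = 0"
  unfolding population_def by (auto simp: vec_eq_iff)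

lemma gibbs_pos_below:
  assumes "gibbs (\<xi> + axis i 1) > 0" shows "gibbs \<xi> > 0"
  using assms gibbs_nonneg[of \<xi>] by (cases "gibbs \<xi> = 0") (auto simp: gibbs_add simp del: One_nat_def)

lemma state_space_gibbs_pos:
  assumes "\<xi> \<in> state_space \<beta> E" shows "gibbs \<xi> > 0"
proof (cases "\<beta> = -\<infinity>")
  case True
  then have "interaction \<xi> = 0" using assms unfolding interaction_def state_space_def by auto
  then show ?thesis unfolding gibbs_def by simp
next
  case False
  then have "boltzmann > 0" by (simp add: exp_ereal_def)
  then show ?thesis unfolding gibbs_def by simp
qed

text \<open>
Every state of positive weight is joined to the empty configuration by edges of positive conductance, which are passed
by removing particles one at a time.
\<close>

lemma transient_if_finite_resistance:
  assumes "finite_resistance 0"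
  shows "transient_on rate (state_space \<beta> E)"
proof -
  have res: "gibbs \<xi> > 0 \<Longrightarrow> finite_resistance \<xi>" for \<xi>
  proof (induction "population \<xi>" arbitrary: \<xi>)
    case 0
    then show ?case using assms population_0_iff by metis
  next
    case (Suc n)
    then have "\<xi> \<noteq> 0" using population_0_iff[of \<xi>] by auto
    then obtain \<eta> i where eq: "\<xi> = \<eta> + axis i 1" by (rule nonzero_has_component)
    have "finite_resistance \<eta>"
    proof (rule Suc.hyps(1))
      show "n = population \<eta>" using Suc.hyps(2) unfolding eq population_add by simp
      show "gibbs \<eta> > 0" using Suc.prems unfolding eq by (rule gibbs_pos_below)
    qed
    moreover have "conductance \<eta> \<xi> > 0" using Suc.prems unfolding eq conductance_up .
    ultimately show ?case by (rule finite_resistance_step)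
  qed
  show ?thesis unfolding transient_on_def
    using return_probability_eq return_prob_less_1 res state_space_gibbs_pos by metis
qed


section \<open>Recurrence from bounds on the Gibbs weight\<close>

lemma sum_geometric_population_le:
  fixes b :: real
  assumes b: "0 \<le> b" "b < 1" and F: "finite F"
  shows "(\<Sum>\<xi>\<in>F. b ^ population \<xi>) \<le> (1 / (1 - b)) ^ CARD('v)"
proof -
  define N where "N = Max (insert 0 (population ` F))"
  have "(\<Sum>\<xi>\<in>F. b ^ population \<xi>) = (\<Sum>\<xi>\<in>F. \<Prod>k\<in>UNIV. b ^ (\<xi> $ k))"
    by (simp add: population_def power_sum)
  also have "\<dots> \<le> (\<Prod>k\<in>(UNIV::'v set). \<Sum>x\<le>N. b ^ x)"
  proof (rule sum_prod_coordinates_le[OF F, of vec_nth "\<lambda>_ x. b ^ x"])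
    show "inj_on vec_nth F" by (rule inj_onI) (simp add: vec_eq_iff)
    fix \<xi> k assume "\<xi> \<in> F"
    then have "population \<xi> \<le> N" unfolding N_def using F by (intro Max_ge) auto
    then show "\<xi> $ k \<le> N" using component_le_population[of \<xi> k] by simp
  qed (simp add: b)
  also have "\<dots> \<le> (\<Prod>k\<in>(UNIV::'v set). 1 / (1 - b))"
    using b by (intro prod_mono conjI sum_nonneg sum_powers_le) auto
  finally show ?thesis by simp
qed

text \<open>
On a level the coordinate \<open>j\<close> is determined by the others, and \<open>i\<close> takes at most \<open>m + 1\<close> values; the remaining
coordinates are summed as geometric series.
\<close>

lemma sum_two_free_coordinates_le:
  fixes b :: real
  assumes b: "0 \<le> b" "b < 1" and F: "finite F" "\<And>\<xi>. \<xi> \<in> F \<Longrightarrow> population \<xi> = m"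
  shows "(\<Sum>\<xi>\<in>F. b ^ (\<Sum>k\<in>-{i,j}. \<xi> $ k)) \<le> real (Suc m) * (1 / (1 - b)) ^ CARD('v)"
proof -
  \<comment> \<open>The coordinate \<open>j\<close> is erased, \<open>i\<close> has weight \<open>1\<close>, and the others carry the geometric weight.\<close>
  define W where "W k x = (if k = j then (if x = 0 then 1 else 0) else if k = i then 1 else b ^ x)"
    for k and x :: nat
  define u where "u \<xi> k = (if k = j then 0 else \<xi> $ k)" for \<xi> :: "nat^'v" and k
  have split: "population \<xi> = \<xi> $ j + (\<Sum>k\<in>-{j}. \<xi> $ k)" for \<xi>
    unfolding population_def by (subst sum.remove[of _ j]) (auto simp: Compl_eq_Diff_UNIV)
  have inj: "inj_on u F"
  proof (rule inj_onI)
    fix \<xi> \<eta> assume F': "\<xi> \<in> F" "\<eta> \<in> F" and "u \<xi> = u \<eta>"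
    have eq: "\<xi> $ k = \<eta> $ k" if "k \<noteq> j" for k
      using fun_cong[OF \<open>u \<xi> = u \<eta>\<close>, of k] that by (simp add: u_def)
    then have "(\<Sum>k\<in>-{j}. \<xi> $ k) = (\<Sum>k\<in>-{j}. \<eta> $ k)" by (intro sum.cong) auto
    then have "\<xi> $ j = \<eta> $ j" using split[of \<xi>] split[of \<eta>] F(2)[OF F'(1)] F(2)[OF F'(2)] by simp
    then show "\<xi> = \<eta>" using eq unfolding vec_eq_iff by metis
  qed
  have "b ^ (\<Sum>k\<in>-{i,j}. \<xi> $ k) = (\<Prod>k\<in>UNIV. W k (u \<xi> k))" for \<xi>
  proof -
    have "(\<Prod>k\<in>UNIV. W k (u \<xi> k)) = (\<Prod>k\<in>-{i,j}. b ^ (\<xi> $ k))"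
      by (rule prod.mono_neutral_cong_right) (auto simp: W_def u_def)
    then show ?thesis by (simp add: power_sum)
  qed
  then have "(\<Sum>\<xi>\<in>F. b ^ (\<Sum>k\<in>-{i,j}. \<xi> $ k)) = (\<Sum>\<xi>\<in>F. \<Prod>k\<in>UNIV. W k (u \<xi> k))" by simp
  also have "\<dots> \<le> (\<Prod>k\<in>UNIV. \<Sum>x\<le>m. W k x)"
  proof (rule sum_prod_coordinates_le[OF F(1) inj])
    fix \<xi> k assume "\<xi> \<in> F"
    then show "u \<xi> k \<le> m" using F(2)[of \<xi>] component_le_population[of \<xi> k] by (simp add: u_def)
  qed (simp add: W_def b)
  also have "\<dots> \<le> (\<Prod>k\<in>UNIV. (if k = i then real (Suc m) else 1) * (1 / (1 - b)))"
  proof (intro prod_mono conjI sum_nonneg)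
    fix k
    have ge1: "1 \<le> 1 / (1 - b)" using b by (simp add: field_simps)
    have "1 * 1 \<le> real (Suc m) * (1 / (1 - b))" using ge1 by (intro mult_mono) auto
    moreover have "real (Suc m) * 1 \<le> real (Suc m) * (1 / (1 - b))" using ge1 by (intro mult_left_mono) auto
    moreover have "(\<Sum>x\<le>m. W k x) = (if k = j then 1 else if k = i then real (Suc m) else (\<Sum>x\<le>m. b ^ x))"
      by (simp add: W_def)
    ultimately show "(\<Sum>x\<le>m. W k x) \<le> (if k = i then real (Suc m) else 1) * (1 / (1 - b))"
      using sum_powers_le[OF b, of m] ge1 by auto
  qed (simp add: W_def b)
  also have "\<dots> = real (Suc m) * (1 / (1 - b)) ^ CARD('v)"
    unfolding prod.distrib by simp
  finally show ?thesis .
qed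

text \<open>
The edges from \<open>\<eta>\<close> to the level below all have conductance \<open>gibbs \<eta>\<close>, and there is at most one per vertex.
\<close>

lemma cut_le:
  assumes "finite F"
  shows "(\<Sum>\<xi>\<in>{\<xi>\<in>F. population \<eta> = Suc (population \<xi>)}. conductance \<xi> \<eta>) \<le> real CARD('v) * gibbs \<eta>"
proof -
  let ?S = "{\<xi>\<in>F. population \<eta> = Suc (population \<xi>)}"
  define S' where "S' = {\<xi>\<in>?S. conductance \<xi> \<eta> \<noteq> 0}"
  have S': "\<exists>i. \<eta> = \<xi> + axis i 1" if "\<xi> \<in> S'" for \<xi>
  proof -
    have "rate \<xi> \<eta> \<noteq> 0" using that unfolding S'_def conductance_def by auto
    then show ?thesis using that unfolding S'_def
      by (cases rule: rate_nonzero_cases) (blast, simp)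
  qed
  have "(\<Sum>\<xi>\<in>?S. conductance \<xi> \<eta>) = (\<Sum>\<xi>\<in>S'. gibbs \<eta>)"
  proof (rule sum.mono_neutral_cong_right)
    show "conductance \<xi> \<eta> = gibbs \<eta>" if "\<xi> \<in> S'" for \<xi>
      using S'[OF that] conductance_up by blast
  qed (use assms in \<open>auto simp: S'_def\<close>)
  also have "\<dots> = real (card S') * gibbs \<eta>" by simp
  also have "\<dots> \<le> real CARD('v) * gibbs \<eta>"
  proof (intro mult_right_mono gibbs_nonneg)
    have "S' \<subseteq> range (\<lambda>i. \<eta> - axis i 1)"
    proof
      fix \<xi> assume "\<xi> \<in> S'"
      then obtain i where "\<eta> = \<xi> + axis i 1" using S' by blast
      then have "\<xi> = \<eta> - axis i 1" by simp
      then show "\<xi> \<in> range (\<lambda>i. \<eta> - axis i 1)" by blast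
    qed
    then have "card S' \<le> card (range (\<lambda>i. \<eta> - axis i 1))" by (intro card_mono) auto
    also have "\<dots> \<le> CARD('v)" by (intro card_image_le) auto
    finally show "real (card S') \<le> real CARD('v)" by simp
  qed
  finally show ?thesis .
qed

text \<open>
If the weight decays geometrically in the number of particles outside some pair of vertices, the level \<open>k\<close> has weight
\<open>O(k)\<close>, as for the simple random walk on a quadrant.
\<close>

lemma return_prob_eq_1_if_concentrated:
  assumes b: "0 \<le> b" "b < 1" and C: "C \<ge> 0"
    and bound: "\<And>\<xi>. gibbs \<xi> \<le> C * (\<Sum>i\<in>UNIV. \<Sum>j\<in>UNIV. b ^ (\<Sum>k\<in>-{i,j}. \<xi> $ k))"
    and r: "gibbs r > 0"
  shows "return_prob r = 1"
proof -
  define n where "n = real CARD('v)"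
  define M where "M = (1 / (1 - b)) ^ CARD('v)"
  have M: "M \<ge> 0" unfolding M_def using b by simp
  show ?thesis
  proof (rule return_prob_eq_1_if_linear_cuts[where L = population and A = "n * (C * (n * (n * (2 * M))))"])
    show "finite {\<xi>. population \<xi> \<le> k}" for k by (rule finite_population_le)
    fix k and F :: "(nat^'v) set" assume F: "finite F"
    define Fk where "Fk = {\<eta>\<in>F. population \<eta> = k}"
    have Fk: "finite Fk" "\<And>\<eta>. \<eta> \<in> Fk \<Longrightarrow> population \<eta> = k" using F by (auto simp: Fk_def)
    show "(\<Sum>\<eta>\<in>{\<eta>\<in>F. population \<eta> = k}. \<Sum>\<xi>\<in>{\<xi>\<in>F. population \<eta> = Suc (population \<xi>)}. conductance \<xi> \<eta>)
        \<le> n * (C * (n * (n * (2 * M)))) * real k"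
      unfolding Fk_def[symmetric]
    proof (cases "k = 0")
      case True
      then have "(\<Sum>\<eta>\<in>Fk. \<Sum>\<xi>\<in>{\<xi>\<in>F. population \<eta> = Suc (population \<xi>)}. conductance \<xi> \<eta>) = 0"
        using Fk(2) by (intro sum.neutral ballI) simp
      then show "(\<Sum>\<eta>\<in>Fk. \<Sum>\<xi>\<in>{\<xi>\<in>F. population \<eta> = Suc (population \<xi>)}. conductance \<xi> \<eta>)
        \<le> n * (C * (n * (n * (2 * M)))) * real k" using True by simp
    next
      case False
      have "(\<Sum>\<eta>\<in>Fk. \<Sum>\<xi>\<in>{\<xi>\<in>F. population \<eta> = Suc (population \<xi>)}. conductance \<xi> \<eta>) \<le> (\<Sum>\<eta>\<in>Fk. n * gibbs \<eta>)"
        unfolding n_def by (intro sum_mono cut_le F)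
      also have "\<dots> \<le> (\<Sum>\<eta>\<in>Fk. n * (C * (\<Sum>i\<in>UNIV. \<Sum>j\<in>UNIV. b ^ (\<Sum>k\<in>-{i,j}. \<eta> $ k))))"
        by (intro sum_mono mult_left_mono bound) (simp add: n_def)
      also have "\<dots> = n * (C * (\<Sum>\<eta>\<in>Fk. \<Sum>i\<in>UNIV. \<Sum>j\<in>UNIV. b ^ (\<Sum>k\<in>-{i,j}. \<eta> $ k)))"
        by (simp only: sum_distrib_left)
      also have "(\<Sum>\<eta>\<in>Fk. \<Sum>i\<in>UNIV. \<Sum>j\<in>UNIV. b ^ (\<Sum>k\<in>-{i,j}. \<eta> $ k)) =
          (\<Sum>i\<in>UNIV. \<Sum>j\<in>UNIV. \<Sum>\<eta>\<in>Fk. b ^ (\<Sum>k\<in>-{i,j}. \<eta> $ k))"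
        by (subst sum.swap, rule sum.cong[OF refl], rule sum.swap)
      also have "n * (C * \<dots>) \<le> n * (C * (\<Sum>i\<in>(UNIV :: 'v set). \<Sum>j\<in>(UNIV :: 'v set). real (Suc k) * M))"
        unfolding M_def using C
        by (intro mult_left_mono sum_mono sum_two_free_coordinates_le b Fk) (auto simp: n_def)
      also have "\<dots> = n * (C * (n * (n * (real (Suc k) * M))))"
        by (simp add: n_def)
      also have "\<dots> \<le> n * (C * (n * (n * (2 * real k * M))))"
        using C M False by (intro mult_left_mono mult_right_mono) (auto simp: n_def)
      finally show "(\<Sum>\<eta>\<in>Fk. \<Sum>\<xi>\<in>{\<xi>\<in>F. population \<eta> = Suc (population \<xi>)}. conductance \<xi> \<eta>)
        \<le> n * (C * (n * (n * (2 * M)))) * real k" by (simp only: mult_ac)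
    qed
  qed (use r conductance_level in auto)
qed

lemma recurrent_if_concentrated:
  assumes "0 \<le> b" "b < 1" "C \<ge> 0"
    and "\<And>\<xi>. gibbs \<xi> \<le> C * (\<Sum>i\<in>UNIV. \<Sum>j\<in>UNIV. b ^ (\<Sum>k\<in>-{i,j}. \<xi> $ k))"
  shows "recurrent_on rate (state_space \<beta> E)"
  unfolding recurrent_on_def
  using return_probability_eq return_prob_eq_1_if_concentrated[OF assms] state_space_gibbs_pos
  by metis

lemma positive_recurrent_if_geometric:
  assumes b: "0 \<le> b" "b < 1" and C: "C \<ge> 0" and bound: "\<And>\<xi>. gibbs \<xi> \<le> C * b ^ population \<xi>"
  shows "positive_recurrent_on rate (state_space \<beta> E)"
proof -
  have conc: "gibbs \<xi> \<le> C * (\<Sum>i\<in>UNIV. \<Sum>j\<in>UNIV. b ^ (\<Sum>k\<in>-{i,j}. \<xi> $ k))" for \<xi>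
  proof -
    obtain i :: 'v where True by simp
    have "(\<Sum>k\<in>-{i,i}. \<xi> $ k) \<le> population \<xi>" unfolding population_def by (intro sum_mono2) auto
    then have "b ^ population \<xi> \<le> b ^ (\<Sum>k\<in>-{i,i}. \<xi> $ k)" using b by (intro power_decreasing) auto
    also have "\<dots> \<le> (\<Sum>j\<in>UNIV. b ^ (\<Sum>k\<in>-{i,j}. \<xi> $ k))"
      using b by (intro member_le_sum[of i UNIV "\<lambda>j. b ^ (\<Sum>k\<in>-{i,j}. \<xi> $ k)"]) auto
    also have "\<dots> \<le> (\<Sum>i\<in>UNIV. \<Sum>j\<in>UNIV. b ^ (\<Sum>k\<in>-{i,j}. \<xi> $ k))"
      using b by (intro member_le_sum[of i UNIV "\<lambda>i. \<Sum>j\<in>UNIV. b ^ (\<Sum>k\<in>-{i,j}. \<xi> $ k)"]) (auto intro!: sum_nonneg)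
    finally have "C * b ^ population \<xi> \<le> C * (\<Sum>i\<in>UNIV. \<Sum>j\<in>UNIV. b ^ (\<Sum>k\<in>-{i,j}. \<xi> $ k))"
      using C by (rule mult_left_mono)
    then show ?thesis using bound[of \<xi>] by linarith
  qed
  have "expected_return_time rate r < \<infinity>" if r: "gibbs r > 0" for r
  proof (rule expected_return_time_finite[OF r return_prob_eq_1_if_concentrated[OF b C conc r]])
    fix F :: "(nat^'v) set" assume F: "finite F"
    have "sum gibbs F \<le> (\<Sum>\<xi>\<in>F. C * b ^ population \<xi>)" by (intro sum_mono bound)
    also have "\<dots> = C * (\<Sum>\<xi>\<in>F. b ^ population \<xi>)" by (simp add: sum_distrib_left)
    also have "\<dots> \<le> C * (1 / (1 - b)) ^ CARD('v)"
      by (intro mult_left_mono sum_geometric_population_le b F C)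
    finally show "sum gibbs F \<le> C * (1 / (1 - b)) ^ CARD('v)" .
  qed
  then show ?thesis
    unfolding positive_recurrent_on_def
    using recurrent_if_concentrated[OF b C conc] state_space_gibbs_pos by blast
qed

lemma axis_Suc: "axis i (Suc m) = axis i m + (axis i 1 :: nat^'v)"
  by (auto simp: vec_eq_iff axis_def)

lemma interaction_axis [simp]: "interaction (axis i m) = 0"
  unfolding interaction_def by (auto simp: axis_def)

lemma gibbs_axis: "gibbs (axis i m) = exp (\<alpha> / 2 * (real m * (real m - 1)))"
proof -
  have "(\<Sum>k\<in>UNIV. real (axis i m $ k) * (real (axis i m $ k) - 1)) =
      (\<Sum>k\<in>UNIV. if k = i then real m * (real m - 1) else 0)"
    by (intro sum.cong) (auto simp: axis_def)
  then show ?thesis unfolding gibbs_def by simp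
qed

text \<open>
For \<open>\<alpha> = 0\<close> the states on an axis have weight \<open>1\<close>, and all of them can be reached through the empty
configuration. So the expected return time is at least an infinite sum of equal terms.
\<close>

lemma null_recurrent_if_concentrated:
  assumes alpha: "\<alpha> = 0" and b: "0 \<le> b" "b < 1" and C: "C \<ge> 0"
    and bound: "\<And>\<xi>. gibbs \<xi> \<le> C * (\<Sum>i\<in>UNIV. \<Sum>j\<in>UNIV. b ^ (\<Sum>k\<in>-{i,j}. \<xi> $ k))"
  shows "null_recurrent_on rate (state_space \<beta> E)"
proof -
  have "expected_return_time rate r = \<infinity>" if r: "gibbs r > 0" for r
  proof -
    obtain i :: 'v where True by simp
    note ret = return_prob_eq_1_if_concentrated[OF b C bound r]
    have down: "hit_prob r \<xi> = 1 \<Longrightarrow> hit_prob r 0 = 1" for \<xi>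
    proof (induction "population \<xi>" arbitrary: \<xi>)
      case 0
      then show ?case using population_0_iff by metis
    next
      case (Suc n)
      then have "\<xi> \<noteq> 0" using population_0_iff[of \<xi>] by auto
      then obtain \<eta> j where eq: "\<xi> = \<eta> + axis j 1" by (rule nonzero_has_component)
      have "rate \<xi> \<eta> > 0" unfolding eq rate_down by simp
      with ret Suc.prems have "hit_prob r \<eta> = 1" by (rule hit_prob_eq_1_step)
      moreover have "n = population \<eta>" using Suc.hyps(2) unfolding eq population_add by simp
      ultimately show ?case using Suc.hyps(1) by blast
    qed
    have "hit_prob r (axis i m) = 1" for m
    proof (induction m)
      case 0
      have zero: "axis i 0 = (0 :: nat^'v)" by (simp add: vec_eq_iff axis_def)
      show ?case unfolding zero by (rule down[OF hit_prob_root])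
    next
      case (Suc m)
      have "(\<Sum>j | E i j. axis i m $ j) = 0" by (auto simp: axis_def)
      then have "rate (axis i m) (axis i m + axis i 1) > 0"
        unfolding rate_up birth_rate_eq by simp
      with ret Suc show ?case unfolding axis_Suc by (rule hit_prob_eq_1_step)
    qed
    moreover have "inj (\<lambda>m. axis i m :: nat^'v)"
      by (rule injI) (simp add: vec_eq_iff axis_def split: if_splits)
    then have "infinite (range (\<lambda>m. axis i m :: nat^'v))" using range_inj_infinite by blast
    moreover have "gibbs (axis i m) = 1" for m unfolding gibbs_axis using alpha by simp
    ultimately show ?thesis
      by (intro expected_return_time_infinite[OF r ret, of "range (axis i)"]) auto
  qed
  then show ?thesis
    unfolding null_recurrent_on_def
    using recurrent_if_concentrated[OF b C bound] state_space_gibbs_pos by blast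
qed

section \<open>Null recurrence\<close>

text \<open>
Every \<open>k\<close> outside the pair has an edge to some \<open>l\<close> in the pair with \<open>\<xi> $ k \<le> \<xi> $ l\<close>, which contributes
\<open>\<xi> $ k * \<xi> $ l \<ge> \<xi> $ k\<close>. These edges are different for different \<open>k\<close>, and \<open>interaction\<close> counts each of them
twice.
\<close>

lemma interaction_lower_bound:
  assumes "\<And>k. k \<notin> {i, j} \<Longrightarrow> \<exists>l\<in>{i, j}. E l k \<and> \<xi> $ k \<le> \<xi> $ l"
  shows "2 * (\<Sum>k\<in>-{i,j}. \<xi> $ k) \<le> interaction \<xi>"
proof -
  let ?D = "-{i,j}" and ?f = "\<lambda>(k,l). \<xi> $ k * \<xi> $ l"
  obtain p where p: "p k \<in> {i, j}" "E (p k) k" "\<xi> $ k \<le> \<xi> $ p k" if "k \<in> ?D" for k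
    using assms by (metis ComplD)
  let ?S1 = "(\<lambda>k. (k, p k)) ` ?D" and ?S2 = "(\<lambda>k. (p k, k)) ` ?D"
  have sq: "(\<xi> $ k) \<le> \<xi> $ k * \<xi> $ p k" if "k \<in> ?D" for k
    using p(3)[OF that] by (cases "\<xi> $ k = 0") auto
  have disj: "?S1 \<inter> ?S2 = {}" using p(1) by blast
  have "2 * (\<Sum>k\<in>?D. \<xi> $ k) \<le> (\<Sum>k\<in>?D. \<xi> $ k * \<xi> $ p k) + (\<Sum>k\<in>?D. \<xi> $ p k * \<xi> $ k)"
    using sum_mono[of ?D "\<lambda>k. \<xi> $ k" "\<lambda>k. \<xi> $ k * \<xi> $ p k", OF sq] by (simp add: mult.commute)
  also have "\<dots> = sum ?f ?S1 + sum ?f ?S2"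
    by (subst (1 2) sum.reindex) (auto simp: inj_on_def)
  also have "\<dots> = sum ?f (?S1 \<union> ?S2)" using disj by (intro sum.union_disjoint[symmetric]) auto
  also have "\<dots> \<le> sum ?f (SIGMA k:UNIV. {l. E k l})"
    using p(2) E_sym by (intro sum_mono2) auto
  also have "\<dots> = interaction \<xi>" unfolding interaction_def by (subst sum.Sigma) auto
  finally show ?thesis .
qed

lemma independence_number_ge: "independent_set E S \<Longrightarrow> card S \<le> independence_number E"
  unfolding independence_number_def by (intro Max_ge) auto

text \<open>
Take for \<open>i\<close> a vertex with the most particles, and for \<open>j\<close> a vertex with the most particles among those
not adjacent to \<open>i\<close>, or \<open>j = i\<close> if there are none. A vertex adjacent to neither would give an
independent set with three elements.
\<close>

lemma dominating_pair:
  fixes \<xi> :: "nat^'v"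
  assumes kappa: "independence_number E \<le> 2"
  shows "\<exists>i j. \<forall>k. k \<notin> {i, j} \<longrightarrow> (\<exists>l\<in>{i, j}. E l k \<and> \<xi> $ k \<le> \<xi> $ l)"
proof -
  obtain i where "\<xi> $ i = Max (range (vec_nth \<xi>))"
    using Max_in[of "range (vec_nth \<xi>)"] by fastforce
  then have i: "\<xi> $ k \<le> \<xi> $ i" for k by simp
  define N where "N = {k. k \<noteq> i \<and> \<not> E i k}"
  show ?thesis
  proof (cases "N = {}")
    case True
    then show ?thesis using i by (intro exI[of _ i]) (auto simp: N_def)
  next
    case False
    obtain j where j: "j \<in> N" "\<And>k. k \<in> N \<Longrightarrow> \<xi> $ k \<le> \<xi> $ j"
      using Max_in[of "vec_nth \<xi> ` N"] Max_ge[of "vec_nth \<xi> ` N"] False by fastforce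
    have "\<exists>l\<in>{i, j}. E l k \<and> \<xi> $ k \<le> \<xi> $ l" if k: "k \<notin> {i, j}" for k
    proof (cases "E i k")
      case True
      then show ?thesis using i by blast
    next
      case False
      have "E j k"
      proof (rule ccontr)
        assume "\<not> E j k"
        then have "independent_set E {i, j, k}"
          using False j(1) E_sym unfolding independent_set_def N_def by auto
        moreover have "card {i, j, k} = 3" using k j(1) by (auto simp: N_def)
        ultimately show False using independence_number_ge kappa by fastforce
      qed
      then show ?thesis using j(2)[of k] False k by (auto simp: N_def)
    qed
    then show ?thesis by blast
  qed
qed

lemma null_recurrent_repulsive:
  assumes alpha: "\<alpha> = 0" and beta: "\<beta> < 0" and kappa: "independence_number E \<le> 2"
  shows "null_recurrent_on rate (state_space \<beta> E)"
proof (rule null_recurrent_if_concentrated[OF alpha boltzmann_nonneg, of 1])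
  show fug1: "boltzmann < 1" using beta by (cases \<beta>) (auto simp: exp_ereal_def)
  fix \<xi> :: "nat^'v"
  obtain i j where ij: "\<And>k. k \<notin> {i, j} \<Longrightarrow> \<exists>l\<in>{i, j}. E l k \<and> \<xi> $ k \<le> \<xi> $ l"
    using dominating_pair[OF kappa] by metis
  have "gibbs \<xi> = sqrt boltzmann ^ interaction \<xi>" unfolding gibbs_def using alpha by simp
  also have "\<dots> \<le> sqrt boltzmann ^ (2 * (\<Sum>k\<in>-{i,j}. \<xi> $ k))"
    using fug1 by (intro power_decreasing interaction_lower_bound ij) (auto simp: real_sqrt_le_1_iff)
  also have "\<dots> = boltzmann ^ (\<Sum>k\<in>-{i,j}. \<xi> $ k)" by (simp add: power_mult)
  also have "\<dots> \<le> (\<Sum>j\<in>UNIV. boltzmann ^ (\<Sum>k\<in>-{i,j}. \<xi> $ k))"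
    by (intro member_le_sum[of j UNIV "\<lambda>j. boltzmann ^ (\<Sum>k\<in>-{i,j}. \<xi> $ k)"]) auto
  also have "\<dots> \<le> (\<Sum>i\<in>UNIV. \<Sum>j\<in>UNIV. boltzmann ^ (\<Sum>k\<in>-{i,j}. \<xi> $ k))"
    by (intro member_le_sum[of i UNIV "\<lambda>i. \<Sum>j\<in>UNIV. boltzmann ^ (\<Sum>k\<in>-{i,j}. \<xi> $ k)"]) (auto intro!: sum_nonneg)
  finally show "gibbs \<xi> \<le> 1 * (\<Sum>i\<in>UNIV. \<Sum>j\<in>UNIV. boltzmann ^ (\<Sum>k\<in>-{i,j}. \<xi> $ k))" by simp
qed simp

lemma null_recurrent_free:
  assumes alpha: "\<alpha> = 0" and free: "\<beta> = 0 \<or> (\<forall>i j. \<not> E i j)" and card: "CARD('v) \<le> 2"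
  shows "null_recurrent_on rate (state_space \<beta> E)"
proof (rule null_recurrent_if_concentrated[OF alpha, of 0 1])
  fix \<xi> :: "nat^'v"
  have one: "gibbs \<xi> = 1"
  proof -
    have "sqrt boltzmann ^ interaction \<xi> = 1"
      using free
    proof
      assume "\<beta> = 0"
      then show ?thesis by (simp add: exp_ereal_def zero_ereal_def)
    next
      assume "\<forall>i j. \<not> E i j"
      then have "interaction \<xi> = 0" unfolding interaction_def by simp
      then show ?thesis by simp
    qed
    then show ?thesis unfolding gibbs_def using alpha by simp
  qed
  obtain i j :: 'v where ij: "-{i, j} = {}"
  proof -
    have "card (UNIV :: 'v set) = 1 \<or> card (UNIV :: 'v set) = 2"
      using card by (metis One_nat_def le_neq_implies_less less_2_cases zero_less_card_finite neq0_conv)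
    then have "\<exists>i j :: 'v. UNIV = {i, j}"
      by (auto simp: card_1_singleton_iff card_2_iff)
    then show ?thesis using that by auto
  qed
  have "1 = (0::real) ^ (\<Sum>k\<in>-{i,j}. \<xi> $ k)" unfolding ij by simp
  also have "\<dots> \<le> (\<Sum>j\<in>UNIV. (0::real) ^ (\<Sum>k\<in>-{i,j}. \<xi> $ k))"
    by (intro member_le_sum[of j UNIV "\<lambda>j. (0::real) ^ (\<Sum>k\<in>-{i,j}. \<xi> $ k)"]) auto
  also have "\<dots> \<le> (\<Sum>i\<in>UNIV. \<Sum>j\<in>UNIV. 0 ^ (\<Sum>k\<in>-{i,j}. \<xi> $ k))"
    by (intro member_le_sum[of i UNIV "\<lambda>i. \<Sum>j\<in>UNIV. (0::real) ^ (\<Sum>k\<in>-{i,j}. \<xi> $ k)"]) (auto intro!: sum_nonneg)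
  finally show "gibbs \<xi> \<le> 1 * (\<Sum>i\<in>UNIV. \<Sum>j\<in>UNIV. 0 ^ (\<Sum>k\<in>-{i,j}. \<xi> $ k))" by (simp add: one)
qed simp_all


section \<open>Positive recurrence\<close>

definition real_state :: "nat^'v \<Rightarrow> real^'v" where
  "real_state \<xi> = (\<chi> i. real (\<xi> $ i))"

lemma interaction_form: "real (interaction \<xi>) = real_state \<xi> \<bullet> (adjacency_matrix E *v real_state \<xi>)"
  unfolding interaction_def adjacency_form real_state_def by simp

lemma gibbs_exp:
  assumes "\<beta> = ereal b"
  shows "gibbs \<xi> = exp (\<alpha> / 2 * (\<Sum>i\<in>UNIV. real (\<xi> $ i) * (real (\<xi> $ i) - 1)) +
    b / 2 * (real_state \<xi> \<bullet> (adjacency_matrix E *v real_state \<xi>)))"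
proof -
  have "sqrt boltzmann = exp (b / 2)"
    using assms by (intro real_sqrt_unique) (auto simp: exp_ereal_def exp_double[symmetric])
  then have "sqrt boltzmann ^ interaction \<xi> = exp (real (interaction \<xi>) * (b / 2))"
    by (simp only: exp_of_nat_mult)
  then show ?thesis unfolding gibbs_def interaction_form[symmetric] exp_add by (simp add: mult.commute)
qed

text \<open>
Completing the square bounds \<open>- a * x\<^sup>2 + c * x\<close> by a constant minus \<open>x\<close>, so Gaussian decay gives
geometric decay in the number of particles.
\<close>

lemma positive_recurrent_if_gaussian:
  assumes a: "a > 0"
    and bound: "\<And>\<xi>. gibbs \<xi> \<le> exp (\<Sum>i\<in>UNIV. - a * (real (\<xi> $ i))\<^sup>2 + c * real (\<xi> $ i))"
  shows "positive_recurrent_on rate (state_space \<beta> E)"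
proof (rule positive_recurrent_if_geometric)
  define D where "D = (c + 1)\<^sup>2 / (4 * a)"
  have le: "- a * x\<^sup>2 + c * x \<le> D - x" for x :: real
  proof -
    have "0 \<le> a * (x - (c + 1) / (2 * a))\<^sup>2" using a by simp
    also have "\<dots> = a * x\<^sup>2 - (c + 1) * x + D"
      using a by (simp add: D_def power2_eq_square field_simps)
    finally show ?thesis by (simp add: algebra_simps)
  qed
  show "gibbs \<xi> \<le> exp (real CARD('v) * D) * exp (-1) ^ population \<xi>" for \<xi>
  proof -
    have "gibbs \<xi> \<le> exp (\<Sum>i\<in>UNIV. - a * (real (\<xi> $ i))\<^sup>2 + c * real (\<xi> $ i))" by (rule bound)
    also have "\<dots> \<le> exp (\<Sum>i\<in>UNIV. D - real (\<xi> $ i))" unfolding exp_le_cancel_iff by (intro sum_mono le)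
    also have "(\<Sum>i\<in>UNIV. D - real (\<xi> $ i)) = real CARD('v) * D + real (population \<xi>) * (-1)"
      by (simp add: sum_subtractf population_def)
    finally show ?thesis by (simp only: exp_add exp_of_nat_mult)
  qed
qed simp_all

text \<open>
For \<open>\<beta> \<ge> 0\<close> the Rayleigh principle bounds the interaction by \<open>\<lambda>\<^sub>1\<close> times the sum of squares; for
\<open>\<beta> < 0\<close> the interaction only decreases the weight.
\<close>

lemma positive_recurrent_subcritical:
  assumes alpha: "\<alpha> < 0" and lam: "ereal \<alpha> + \<beta> * ereal (largest_eigenvalue (adjacency_matrix E)) < 0"
  shows "positive_recurrent_on rate (state_space \<beta> E)"
proof (cases "\<beta> \<ge> 0")
  case True
  then obtain b where b: "\<beta> = ereal b" "b \<ge> 0" using beta_finite by (cases \<beta>) auto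
  define \<Lambda> where "\<Lambda> = largest_eigenvalue (adjacency_matrix E)"
  have neg: "\<alpha> + b * \<Lambda> < 0" using lam unfolding b \<Lambda>_def by simp
  show ?thesis
  proof (rule positive_recurrent_if_gaussian[of "- (\<alpha> + b * \<Lambda>) / 2" "- \<alpha> / 2"])
    fix \<xi> :: "nat^'v"
    have "real_state \<xi> \<bullet> (adjacency_matrix E *v real_state \<xi>) \<le> \<Lambda> * (real_state \<xi> \<bullet> real_state \<xi>)"
      unfolding \<Lambda>_def using graph by (intro rayleigh) (simp add: simple_graph_def)
    then have "b / 2 * (real_state \<xi> \<bullet> (adjacency_matrix E *v real_state \<xi>)) \<le>
        b / 2 * (\<Lambda> * (real_state \<xi> \<bullet> real_state \<xi>))"
      using b by (intro mult_left_mono) auto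
    also have "\<dots> = (\<Sum>i\<in>UNIV. b * \<Lambda> / 2 * (real (\<xi> $ i))\<^sup>2)"
      by (simp add: inner_vec_def real_state_def sum_distrib_left power2_eq_square mult_ac)
    finally have "\<alpha> / 2 * (\<Sum>i\<in>UNIV. real (\<xi> $ i) * (real (\<xi> $ i) - 1)) +
        b / 2 * (real_state \<xi> \<bullet> (adjacency_matrix E *v real_state \<xi>)) \<le>
        (\<Sum>i\<in>UNIV. \<alpha> / 2 * (real (\<xi> $ i) * (real (\<xi> $ i) - 1)) + b * \<Lambda> / 2 * (real (\<xi> $ i))\<^sup>2)"
      by (simp add: sum.distrib sum_distrib_left)
    also have "\<dots> = (\<Sum>i\<in>UNIV. - (- (\<alpha> + b * \<Lambda>) / 2) * (real (\<xi> $ i))\<^sup>2 + - \<alpha> / 2 * real (\<xi> $ i))"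
      by (intro sum.cong refl) (simp add: power2_eq_square field_simps)
    finally show "gibbs \<xi> \<le> exp (\<Sum>i\<in>UNIV. - (- (\<alpha> + b * \<Lambda>) / 2) * (real (\<xi> $ i))\<^sup>2 + - \<alpha> / 2 * real (\<xi> $ i))"
      unfolding gibbs_exp[OF b(1)] exp_le_cancel_iff .
  qed (use neg in simp)
next
  case False
  then have boltzmann: "boltzmann \<le> 1" by (cases \<beta>) (auto simp: exp_ereal_def)
  show ?thesis
  proof (rule positive_recurrent_if_gaussian[of "- \<alpha> / 2" "- \<alpha> / 2"])
    fix \<xi> :: "nat^'v"
    have "gibbs \<xi> \<le> exp (\<alpha> / 2 * (\<Sum>i\<in>UNIV. real (\<xi> $ i) * (real (\<xi> $ i) - 1))) * 1"
      unfolding gibbs_def using boltzmann by (intro mult_left_mono power_le_one) auto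
    also have "\<alpha> / 2 * (\<Sum>i\<in>UNIV. real (\<xi> $ i) * (real (\<xi> $ i) - 1)) =
        (\<Sum>i\<in>UNIV. - (- \<alpha> / 2) * (real (\<xi> $ i))\<^sup>2 + - \<alpha> / 2 * real (\<xi> $ i))"
      unfolding sum_distrib_left by (intro sum.cong refl) (simp add: power2_eq_square field_simps)
    finally show "gibbs \<xi> \<le> exp (\<Sum>i\<in>UNIV. - (- \<alpha> / 2) * (real (\<xi> $ i))\<^sup>2 + - \<alpha> / 2 * real (\<xi> $ i))"
      by simp
  qed (use alpha in simp)
qed

section \<open>Transience along lattice paths\<close>

text \<open>
Along a path that adds one particle per step, the edge resistances are the inverse weights, so they are summable
if the weights grow exponentially.
\<close>

lemma transient_if_growing_path:
  assumes p0: "p 0 = 0" and step: "\<And>m. \<exists>i. p (Suc m) = p m + axis i 1"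
    and c: "c > 0" and \<rho>: "\<rho> > 1" and growth: "\<And>m. gibbs (p (Suc m)) \<ge> c * \<rho> ^ m"
  shows "transient_on rate (state_space \<beta> E)"
proof (rule transient_if_finite_resistance)
  have pop: "population (p m) = m" for m
  proof (induction m)
    case (Suc m)
    then show ?case using step[of m] by auto
  qed (simp add: p0 population_0_iff)
  have conductance: "conductance (p m) (p (Suc m)) = gibbs (p (Suc m))" for m
    using step[of m] conductance_up by force
  have pos: "c * \<rho> ^ m > 0" for m using c \<rho> by simp
  have "finite_resistance (p 0)"
  proof (rule finite_resistance_if_path)
    show "inj p" using pop by (intro injI) metis
    show "conductance (p m) (p (Suc m)) > 0" for m unfolding conductance using growth[of m] pos[of m] by linarith
    show "summable (\<lambda>m. 1 / conductance (p m) (p (Suc m)))"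
    proof (rule summable_comparison_test)
      show "summable (\<lambda>m. 1 / c * (1 / \<rho>) ^ m)"
        using \<rho> by (intro summable_mult summable_geometric) simp
      have "norm (1 / gibbs (p (Suc m))) \<le> 1 / c * (1 / \<rho>) ^ m" for m
      proof -
        have "1 / gibbs (p (Suc m)) \<le> 1 / (c * \<rho> ^ m)"
          using growth[of m] pos[of m] by (intro divide_left_mono) (auto intro: mult_pos_pos)
        then show ?thesis using gibbs_nonneg[of "p (Suc m)"] by (simp add: power_divide)
      qed
      then show "\<exists>N. \<forall>m\<ge>N. norm (1 / conductance (p m) (p (Suc m))) \<le> 1 / c * (1 / \<rho>) ^ m"
        unfolding conductance by blast
    qed
  qed
  then show "finite_resistance 0" unfolding p0 .
qed

lemma axis_0 [simp]: "axis i 0 = (0 :: nat^'v)"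
  by (simp add: vec_eq_iff axis_def)

lemma transient_alpha_positive:
  assumes "\<alpha> > 0" shows "transient_on rate (state_space \<beta> E)"
proof -
  obtain i :: 'v where True by simp
  show ?thesis
  proof (rule transient_if_growing_path[of "axis i" 1 "exp (\<alpha> / 2)"])
    show "\<exists>j. axis i (Suc m) = axis i m + axis j (1 :: nat)" for m using axis_Suc by blast
    fix m
    have "exp (\<alpha> / 2) ^ m = exp (real m * (\<alpha> / 2))" by (rule exp_of_nat_mult[symmetric])
    also have "\<dots> \<le> gibbs (axis i (Suc m))"
      unfolding gibbs_axis exp_le_cancel_iff using assms by (simp add: field_simps)
    finally show "1 * exp (\<alpha> / 2) ^ m \<le> gibbs (axis i (Suc m))" by simp
  qed (use assms in auto)
qed

lemma interaction_edge:
  assumes "E i j" shows "interaction (axis i a + axis j b) = 2 * (a * b)"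
proof (induction b)
  case (Suc b)
  have "(\<Sum>l | E j l. (axis i a + axis j b) $ l) = (\<Sum>l | E j l. if l = i then a else 0)"
    by (intro sum.cong) (auto simp: axis_def)
  also have "\<dots> = a" using assms E_sym by (simp add: sum.If_cases)
  finally show ?case
    using interaction_add[of "axis i a + axis j b" j] Suc
    by (simp only: axis_Suc[of j b] add.assoc[symmetric]) (simp add: algebra_simps)
qed simp

text \<open>
The path alternates between the two ends of the edge; in its state with \<open>a\<close> and \<open>b\<close> particles there, the weight is \<open>e^(\<beta> a b)\<close>.
\<close>

lemma transient_attractive_edge:
  assumes alpha: "\<alpha> = 0" and beta: "\<beta> > 0" and edge: "E i j"
  shows "transient_on rate (state_space \<beta> E)"
proof (rule transient_if_growing_path[of "\<lambda>m. axis i (Suc m div 2) + axis j (m div 2)" 1 boltzmann])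
  show boltzmann: "boltzmann > 1" using beta beta_finite by (cases \<beta>) (auto simp: exp_ereal_def)
  fix m
  show "\<exists>k. axis i (Suc (Suc m) div 2) + axis j (Suc m div 2) =
      axis i (Suc m div 2) + axis j (m div 2) + axis k (1 :: nat)"
  proof (cases "even m")
    case True
    then have "Suc m div 2 = m div 2" by simp
    then show ?thesis
      using axis_Suc[of i "m div 2"] by (intro exI[of _ i]) (simp add: add_ac)
  next
    case False
    then have "Suc m div 2 = Suc (m div 2)" by simp
    then show ?thesis
      using axis_Suc[of j "m div 2"] by (intro exI[of _ j]) (simp add: add_ac)
  qed
  have "m \<le> Suc (Suc m) div 2 * (Suc m div 2)"
  proof (cases "even m")
    case True
    then obtain k where "m = 2 * k" by blast
    then show ?thesis by (cases k) auto
  next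
    case False
    then obtain k where "m = 2 * k + 1" using oddE by blast
    then show ?thesis by simp
  qed
  then have "boltzmann ^ m \<le> boltzmann ^ (Suc (Suc m) div 2 * (Suc m div 2))"
    using boltzmann by (intro power_increasing) auto
  also have "\<dots> = gibbs (axis i (Suc (Suc m) div 2) + axis j (Suc m div 2))"
  proof -
    have square: "sqrt boltzmann ^ (2 * k) = boltzmann ^ k" for k by (simp add: power_mult)
    show ?thesis unfolding gibbs_def interaction_edge[OF edge] square using alpha by simp
  qed
  finally show "1 * boltzmann ^ m \<le> gibbs (axis i (Suc (Suc m) div 2) + axis j (Suc m div 2))" by simp
qed auto

text \<open>
At step \<open>m\<close> some coordinate is still below its target \<open>(m + 1) * v $ i\<close>, because the targets sum to \<open>m + 1\<close>; a particle
is added there. No coordinate ever exceeds its target by more than \<open>1\<close>, and since the total is correct, none falls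
behind by more than a constant either.
\<close>

lemma greedy_path:
  fixes v :: "real^'v"
  assumes v: "\<And>i. v $ i \<ge> 0" "(\<Sum>i\<in>UNIV. v $ i) = 1"
  obtains p :: "nat \<Rightarrow> nat^'v" where "p 0 = 0" "\<And>m. \<exists>i. p (Suc m) = p m + axis i 1"
    "\<And>m. population (p m) = m" "\<And>m i. real (p m $ i) \<le> real m * v $ i + 1"
proof -
  define P where "P m \<xi> \<longleftrightarrow> population \<xi> = m \<and> (\<forall>i. real (\<xi> $ i) \<le> real m * v $ i + 1)" for m and \<xi> :: "nat^'v"
  have "\<exists>p. \<forall>m. P m (p m) \<and> (\<exists>i. p (Suc m) = p m + axis i 1)"
  proof (rule dependent_nat_choice)
    show "\<exists>\<xi>. P 0 \<xi>" by (rule exI[of _ 0]) (simp add: P_def population_0_iff)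
    fix \<xi> m assume \<xi>: "P m \<xi>"
    have "\<exists>i. real (\<xi> $ i) < real (Suc m) * v $ i"
    proof (rule ccontr)
      assume "\<nexists>i. real (\<xi> $ i) < real (Suc m) * v $ i"
      then have "(\<Sum>i\<in>UNIV. real (Suc m) * v $ i) \<le> (\<Sum>i\<in>UNIV. real (\<xi> $ i))"
        by (intro sum_mono) (simp add: not_less)
      also have "\<dots> = real m" using \<xi> unfolding P_def population_def by (metis of_nat_sum)
      finally show False using v(2) by (simp add: sum_distrib_left[symmetric])
    qed
    then obtain i where i: "real (\<xi> $ i) < real (Suc m) * v $ i" by blast
    have "real ((\<xi> + axis i 1) $ k) \<le> real (Suc m) * v $ k + 1" for k
    proof (cases "k = i")
      case False
      have "real (\<xi> $ k) \<le> real m * v $ k + 1" using \<xi> unfolding P_def by blast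
      also have "\<dots> \<le> real (Suc m) * v $ k + 1" using v(1)[of k] by (simp add: algebra_simps)
      finally show ?thesis using False by (simp add: axis_def)
    qed (use i in \<open>simp add: axis_def\<close>)
    then have "P (Suc m) (\<xi> + axis i 1)" using \<xi> unfolding P_def population_add by blast
    then show "\<exists>\<eta>. P (Suc m) \<eta> \<and> (\<exists>i. \<eta> = \<xi> + axis i 1)" by blast
  qed
  then obtain p where p: "\<And>m. P m (p m)" "\<And>m. \<exists>i. p (Suc m) = p m + axis i 1" by blast
  have "p 0 = 0" using p(1)[of 0] unfolding P_def by (simp add: population_0_iff)
  then show ?thesis using that p unfolding P_def by blast
qed

text \<open>
Write the state of the greedy path as \<open>x = m v + \<delta>\<close> with the Perron vector \<open>v\<close> and bounded \<open>\<delta>\<close>. Because \<open>v\<close> is an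
eigenvector, the quadratic form \<open>\<alpha> |x|\<^sup>2 + \<beta> (x, A x)\<close> is \<open>(\<alpha> + \<beta> \<lambda>\<^sub>1) |x|\<^sup>2\<close> plus terms that involve only
\<open>\<delta>\<close>, hence bounded below. What is left in the exponent is the linear term
\<open>- \<alpha> / 2\<close> times the number of particles, which is positive.
\<close>

lemma transient_supercritical:
  assumes alpha: "\<alpha> < 0" and lam: "ereal \<alpha> + \<beta> * ereal (largest_eigenvalue (adjacency_matrix E)) \<ge> 0"
  shows "transient_on rate (state_space \<beta> E)"
proof -
  define A where "A = adjacency_matrix E"
  define \<Lambda> where "\<Lambda> = largest_eigenvalue A"
  define n where "n = real CARD('v)"
  have symp: "symp E" using graph by (simp add: simple_graph_def)
  have sym: "x \<bullet> (A *v y) = y \<bullet> (A *v x)" for x y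
    unfolding A_def by (rule adjacency_form_sym[OF symp])
  have \<Lambda>_nonneg: "\<Lambda> \<ge> 0"
  proof -
    obtain i :: 'v where True by simp
    let ?x = "axis i 1 :: real^'v"
    have "?x \<bullet> (A *v ?x) \<le> \<Lambda> * (?x \<bullet> ?x)"
      unfolding \<Lambda>_def A_def by (rule rayleigh[OF symp])
    moreover have "?x \<bullet> (A *v ?x) = 0"
      unfolding A_def adjacency_form by (intro sum.neutral ballI) (auto simp: axis_def)
    ultimately show ?thesis by (simp add: inner_axis_axis)
  qed
  obtain b where b: "\<beta> = ereal b" and \<mu>: "\<alpha> + b * \<Lambda> \<ge> 0"
  proof (cases \<beta>)
    case (real b)
    then show ?thesis using that lam unfolding \<Lambda>_def A_def by simp
  next
    case MInf
    then show ?thesis using lam alpha \<Lambda>_nonneg unfolding \<Lambda>_def A_def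
      by (cases "largest_eigenvalue (adjacency_matrix E) = 0") (auto simp: zero_ereal_def[symmetric])
  qed (use beta_finite in simp)
  have b_pos: "b > 0" using \<mu> alpha \<Lambda>_nonneg by (smt (verit) mult_nonpos_nonneg)
  obtain v where v: "\<And>i. v $ i \<ge> 0" "(\<Sum>i\<in>UNIV. v $ i) = 1" "A *v v = \<Lambda> *\<^sub>R v"
    using perron_vector[OF symp] unfolding A_def \<Lambda>_def by blast
  obtain p :: "nat \<Rightarrow> nat^'v" where p: "p 0 = 0" "\<And>m. \<exists>i. p (Suc m) = p m + axis i 1"
    "\<And>m. population (p m) = m" "\<And>m i. real (p m $ i) \<le> real m * v $ i + 1"
    using greedy_path[OF v(1,2)] by blast
  \<comment> \<open>A bound for the terms in \<open>\<delta>\<close>, whose entries have absolute value at most \<open>n\<close>.\<close>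
  define D where "D = b * \<Lambda> * (n * n\<^sup>2) + b * (n * (n * n\<^sup>2))"
  have n1: "n \<ge> 1" unfolding n_def by (simp add: Suc_le_eq)
  have energy_bound: "\<alpha> * (x \<bullet> x) + b * (x \<bullet> (A *v x)) \<ge> - D" if x: "x = real_state (p m)" for x m
  proof -
    define \<delta> where "\<delta> = x - real m *\<^sub>R v"
    have \<delta>_le: "\<delta> $ i \<le> 1" for i using p(4)[of m i] by (simp add: \<delta>_def x real_state_def)
    have sum0: "(\<Sum>i\<in>UNIV. \<delta> $ i) = 0"
    proof -
      have "(\<Sum>i\<in>UNIV. x $ i) = real m"
        using p(3)[of m] unfolding x real_state_def population_def by (simp flip: of_nat_sum)
      then show ?thesis using v(2) by (simp add: \<delta>_def sum_subtractf sum_distrib_left[symmetric])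
    qed
    have \<delta>_abs: "\<bar>\<delta> $ i\<bar> \<le> n" for i
    proof -
      have "(\<Sum>k\<in>UNIV - {i}. \<delta> $ k) \<le> (\<Sum>k\<in>UNIV - {i}. 1)" by (intro sum_mono \<delta>_le)
      also have "\<dots> \<le> n" unfolding n_def by (simp add: card_Diff_singleton)
      finally have "(\<Sum>k\<in>UNIV - {i}. \<delta> $ k) \<le> n" .
      moreover have "\<delta> $ i + (\<Sum>k\<in>UNIV - {i}. \<delta> $ k) = 0" using sum0 sum.remove[of UNIV i "\<lambda>k. \<delta> $ k"] by simp
      ultimately show ?thesis using \<delta>_le[of i] n1 by linarith
    qed
    have sq: "\<bar>\<delta> $ i * \<delta> $ j\<bar> \<le> n\<^sup>2" for i j
      unfolding abs_mult power2_eq_square by (intro mult_mono \<delta>_abs) (use n1 in auto)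
    have "\<delta> \<bullet> \<delta> \<le> (\<Sum>i\<in>(UNIV :: 'v set). n\<^sup>2)"
      unfolding inner_vec_def using sq by (intro sum_mono) (simp add: abs_le_iff)
    then have \<delta>\<delta>: "\<delta> \<bullet> \<delta> \<le> n * n\<^sup>2" by (simp add: n_def)
    have "(\<Sum>i\<in>(UNIV :: 'v set). \<Sum>j | E i j. - (n\<^sup>2)) \<le> \<delta> \<bullet> (A *v \<delta>)"
      unfolding A_def adjacency_form using sq by (intro sum_mono) (simp add: abs_le_iff minus_le_iff)
    moreover have "(\<Sum>i\<in>(UNIV :: 'v set). \<Sum>j | E i j. - (n\<^sup>2)) \<ge> (\<Sum>i\<in>(UNIV :: 'v set). - (n * n\<^sup>2))"
    proof (rule sum_mono)
      fix i :: 'v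
      have "real (card {j. E i j}) \<le> n" unfolding n_def by (simp add: card_mono)
      then show "- (n * n\<^sup>2) \<le> (\<Sum>j | E i j. - (n\<^sup>2))" by (simp add: mult_right_mono)
    qed
    ultimately have \<delta>A\<delta>: "- (n * (n * n\<^sup>2)) \<le> \<delta> \<bullet> (A *v \<delta>)" by (simp add: n_def)
    have xv: "x = real m *\<^sub>R v + \<delta>" by (simp add: \<delta>_def)
    have xx: "x \<bullet> x = (real m)\<^sup>2 * (v \<bullet> v) + 2 * real m * (v \<bullet> \<delta>) + \<delta> \<bullet> \<delta>"
      unfolding xv by (simp add: inner_add_left inner_add_right inner_commute power2_eq_square)
    have "v \<bullet> (A *v \<delta>) = \<Lambda> * (v \<bullet> \<delta>)" using sym[of v \<delta>] v(3) by (simp add: inner_commute)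
    then have "x \<bullet> (A *v x) = \<Lambda> * ((real m)\<^sup>2 * (v \<bullet> v) + 2 * real m * (v \<bullet> \<delta>)) + \<delta> \<bullet> (A *v \<delta>)"
      unfolding xv
      by (simp add: matrix_vector_right_distrib matrix_vector_mult_scaleR v(3) inner_add_left inner_add_right
          inner_commute[of \<delta> v] power2_eq_square algebra_simps)
    then have xAx: "x \<bullet> (A *v x) = \<Lambda> * (x \<bullet> x - \<delta> \<bullet> \<delta>) + \<delta> \<bullet> (A *v \<delta>)"
      unfolding xx by simp
    have "b * \<Lambda> * (\<delta> \<bullet> \<delta>) \<le> b * \<Lambda> * (n * n\<^sup>2)"
      using b_pos \<Lambda>_nonneg \<delta>\<delta> by (intro mult_left_mono) auto
    moreover have "b * (- (n * (n * n\<^sup>2))) \<le> b * (\<delta> \<bullet> (A *v \<delta>))"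
      using b_pos \<delta>A\<delta> by (intro mult_left_mono) auto
    moreover have "0 \<le> (\<alpha> + b * \<Lambda>) * (x \<bullet> x)" using \<mu> by simp
    ultimately show ?thesis unfolding xAx D_def by (simp add: algebra_simps)
  qed
  show ?thesis
  proof (rule transient_if_growing_path[OF p(1,2), of "exp (- D / 2)" "exp (- \<alpha> / 2)"])
    show "exp (- \<alpha> / 2) > 1" using alpha by simp
    fix m
    let ?\<xi> = "p (Suc m)" let ?x = "real_state ?\<xi>"
    have squares: "(\<Sum>i\<in>UNIV. real (?\<xi> $ i) * (real (?\<xi> $ i) - 1)) = ?x \<bullet> ?x - real (population ?\<xi>)"
      by (simp add: inner_vec_def real_state_def population_def right_diff_distrib sum_subtractf)
    have g: "gibbs ?\<xi> = exp ((\<alpha> * (?x \<bullet> ?x) + b * (?x \<bullet> (A *v ?x))) / 2 + real (Suc m) * (- \<alpha> / 2))"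
      unfolding gibbs_exp[OF b] squares p(3) A_def
      by (intro arg_cong[where f = exp]) (simp add: field_simps)
    have "exp (- D / 2) * exp (- \<alpha> / 2) ^ m = exp (- D / 2 + real m * (- \<alpha> / 2))"
      by (simp only: exp_add exp_of_nat_mult)
    also have "\<dots> \<le> gibbs ?\<xi>"
      unfolding g exp_le_cancel_iff using energy_bound[of ?x "Suc m"] alpha
      by (intro add_mono mult_right_mono) auto
    finally show "exp (- D / 2) * exp (- \<alpha> / 2) ^ m \<le> gibbs ?\<xi>" .
  qed simp
qed


section \<open>Transience on a three-dimensional octant\<close>

definition layer :: "'v set \<Rightarrow> nat \<Rightarrow> (nat^'v) set" where
  "layer I m = {\<xi>. population \<xi> = m \<and> (\<forall>k. k \<notin> I \<longrightarrow> \<xi> $ k = 0)}"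

text \<open>
The probability of each configuration of Polya's urn with three colours after \<open>m\<close> draws, starting from one ball of each
colour: the distribution is uniform on \<open>(m + 1) (m + 2) / 2\<close> configurations.
\<close>

definition urn_mass :: "nat \<Rightarrow> real" where
  "urn_mass m = 2 / (real (m + 1) * real (m + 2))"

text \<open>
The probability that the urn passes through \<open>\<xi>\<close> and that colour \<open>i\<close>, of which there are \<open>\<xi>\<^sub>i + 1\<close>
among \<open>m + 3\<close> balls, is drawn next.
\<close>

definition urn_flow :: "(nat^'v) \<times> 'v \<Rightarrow> real" where
  "urn_flow = (\<lambda>(\<xi>, i). urn_mass (population \<xi>) * real (\<xi> $ i + 1) / real (population \<xi> + 3))"

lemma finite_layer [simp]: "finite (layer I m)"
  by (rule finite_subset[OF _ finite_population_le[of m]]) (auto simp: layer_def)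

lemma layer_0: "layer I 0 = {0}"
  unfolding layer_def by (auto simp: population_0_iff)

lemma layer_population: "\<xi> \<in> layer I m \<Longrightarrow> (\<Sum>i\<in>I. \<xi> $ i) = m"
  unfolding layer_def population_def by (auto intro!: sum.mono_neutral_left)

lemma layer_population_real: "\<xi> \<in> layer I m \<Longrightarrow> (\<Sum>i\<in>I. real (\<xi> $ i)) = real m"
  by (simp only: of_nat_sum[symmetric] layer_population)

lemma layer_up:
  assumes "\<xi> \<in> layer I m" "i \<in> I" shows "\<xi> + axis i 1 \<in> layer I (Suc m)"
proof -
  have "(\<xi> + axis i 1) $ k = 0" if "k \<notin> I" for k
  proof -
    have "\<xi> $ k = 0" "k \<noteq> i" using assms that unfolding layer_def by auto
    then show ?thesis by (simp add: axis_def)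
  qed
  then show ?thesis using assms(1) unfolding layer_def mem_Collect_eq population_add by blast
qed

lemma urn_flow_nonneg: "urn_flow e \<ge> 0"
  unfolding urn_flow_def urn_mass_def by (cases e) simp

lemma urn_flow_out:
  assumes I: "card I = 3" and \<xi>: "\<xi> \<in> layer I m"
  shows "(\<Sum>i\<in>I. urn_flow (\<xi>, i)) = urn_mass m"
proof -
  have "population \<xi> = m" using \<xi> by (simp add: layer_def)
  then have "(\<Sum>i\<in>I. urn_flow (\<xi>, i)) = urn_mass m * (\<Sum>i\<in>I. real (\<xi> $ i + 1)) / real (m + 3)"
    unfolding urn_flow_def by (simp add: sum_distrib_left sum_divide_distrib)
  also have "(\<Sum>i\<in>I. real (\<xi> $ i + 1)) = real (m + 3)"
    using layer_population_real[OF \<xi>] I by (simp add: sum.distrib)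
  finally show ?thesis by simp
qed

text \<open>
The urn stays uniform: the configuration \<open>\<eta>\<close> on level \<open>m + 1\<close> is reached through \<open>i\<close> with a probability
proportional to \<open>\<eta> $ i\<close>, and these numbers sum to \<open>m + 1\<close>.
\<close>

lemma urn_flow_in:
  "(\<Sum>(\<xi>, i)\<in>layer I m \<times> I. urn_flow (\<xi>, i) * f (\<xi> + axis i 1)) =
    (\<Sum>\<eta>\<in>layer I (Suc m). urn_mass (Suc m) * f \<eta>)"
proof -
  let ?c = "urn_mass m / real (m + 3)"
  let ?T = "{(\<eta>, i). \<eta> \<in> layer I (Suc m) \<and> i \<in> I \<and> \<eta> $ i > 0}"
  have "(\<Sum>(\<xi>, i)\<in>layer I m \<times> I. urn_flow (\<xi>, i) * f (\<xi> + axis i 1)) =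
      (\<Sum>(\<eta>, i)\<in>?T. ?c * real (\<eta> $ i) * f \<eta>)"
  proof (rule sum.reindex_bij_witness[where i = "\<lambda>(\<eta>, i). (\<eta> - axis i 1, i)" and j = "\<lambda>(\<xi>, i). (\<xi> + axis i 1, i)"])
    fix e assume e: "e \<in> layer I m \<times> I"
    obtain \<xi> i where eq: "e = (\<xi>, i)" by (cases e)
    have \<xi>: "\<xi> \<in> layer I m" "i \<in> I" "population \<xi> = m" using e unfolding eq layer_def by auto
    show "(case case e of (\<xi>, i) \<Rightarrow> (\<xi> + axis i 1, i) of (\<eta>, i) \<Rightarrow> (\<eta> - axis i 1, i)) = e"
      unfolding eq by simp
    show "(case e of (\<xi>, i) \<Rightarrow> (\<xi> + axis i 1, i)) \<in> ?T"
      using layer_up[OF \<xi>(1,2)] \<xi>(2) unfolding eq by (simp add: axis_def)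
    show "(case case e of (\<xi>, i) \<Rightarrow> (\<xi> + axis i 1, i) of (\<eta>, i) \<Rightarrow> ?c * real (\<eta> $ i) * f \<eta>) =
        (case e of (\<xi>, i) \<Rightarrow> urn_flow (\<xi>, i) * f (\<xi> + axis i 1))"
      unfolding eq urn_flow_def using \<xi>(3) by (simp add: axis_def)
  next
    fix e assume e: "e \<in> ?T"
    obtain \<eta> i where eq: "e = (\<eta>, i)" by (cases e)
    have \<eta>: "\<eta> \<in> layer I (Suc m)" "i \<in> I" "\<eta> $ i > 0" using e unfolding eq by auto
    have up: "\<eta> - axis i 1 + axis i 1 = \<eta>" by (rule add_diff_axis[OF \<eta>(3)])
    then show "(case case e of (\<eta>, i) \<Rightarrow> (\<eta> - axis i 1, i) of (\<xi>, i) \<Rightarrow> (\<xi> + axis i 1, i)) = e"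
      unfolding eq by simp
    have "Suc (population (\<eta> - axis i 1)) = Suc m"
      using \<eta>(1) population_add[of "\<eta> - axis i 1" i] unfolding up layer_def by simp
    then have "\<eta> - axis i 1 \<in> layer I m" using \<eta>(1) unfolding layer_def by simp
    then show "(case e of (\<eta>, i) \<Rightarrow> (\<eta> - axis i 1, i)) \<in> layer I m \<times> I"
      using \<eta>(2) unfolding eq by simp
  qed
  also have "\<dots> = (\<Sum>(\<eta>, i)\<in>layer I (Suc m) \<times> I. ?c * real (\<eta> $ i) * f \<eta>)"
    by (rule sum.mono_neutral_left) auto
  also have "\<dots> = (\<Sum>\<eta>\<in>layer I (Suc m). \<Sum>i\<in>I. ?c * real (\<eta> $ i) * f \<eta>)"
    by (rule sum.cartesian_product[symmetric])
  also have "\<dots> = (\<Sum>\<eta>\<in>layer I (Suc m). urn_mass (Suc m) * f \<eta>)"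
  proof (rule sum.cong[OF refl])
    fix \<eta> assume "\<eta> \<in> layer I (Suc m)"
    then have "(\<Sum>i\<in>I. real (\<eta> $ i)) = real (Suc m)" by (rule layer_population_real)
    then have "(\<Sum>i\<in>I. ?c * real (\<eta> $ i) * f \<eta>) = ?c * real (Suc m) * f \<eta>"
      by (simp only: sum_distrib_left[symmetric] sum_distrib_right[symmetric])
    also have "?c * real (Suc m) = urn_mass (Suc m)"
    proof -
      have cancel: "2 / (b * c) / d * b = 2 / (c * d)" if "b \<noteq> 0" for b c d :: real using that by simp
      have shift: "m + 1 = Suc m" "Suc m + 1 = m + 2" "Suc m + 2 = m + 3" by simp_all
      show ?thesis unfolding urn_mass_def shift by (rule cancel) simp
    qed
    finally show "(\<Sum>i\<in>I. ?c * real (\<eta> $ i) * f \<eta>) = urn_mass (Suc m) * f \<eta>" .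
  qed
  finally show ?thesis .
qed

definition urn_average :: "'v set \<Rightarrow> (nat^'v \<Rightarrow> real) \<Rightarrow> nat \<Rightarrow> real" where
  "urn_average I f m = (\<Sum>\<xi>\<in>layer I m. urn_mass m * f \<xi>)"

lemma urn_average_step:
  assumes I: "card I = 3"
  shows "urn_average I f m - urn_average I f (Suc m) =
    (\<Sum>(\<xi>, i)\<in>layer I m \<times> I. urn_flow (\<xi>, i) * (f \<xi> - f (\<xi> + axis i 1)))"
proof -
  have "urn_average I f m = (\<Sum>\<xi>\<in>layer I m. \<Sum>i\<in>I. urn_flow (\<xi>, i) * f \<xi>)"
    unfolding urn_average_def sum_distrib_right[symmetric]
    by (intro sum.cong refl) (simp add: urn_flow_out[OF I])
  also have "\<dots> = (\<Sum>(\<xi>, i)\<in>layer I m \<times> I. urn_flow (\<xi>, i) * f \<xi>)"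
    by (rule sum.cartesian_product)
  finally show ?thesis
    unfolding urn_average_def urn_flow_in[symmetric]
    by (simp add: sum_subtractf[symmetric] case_prod_unfold right_diff_distrib)
qed

lemma urn_average_0: "urn_average I f 0 = f 0"
  unfolding urn_average_def layer_0 urn_mass_def by simp

lemma urn_total_mass: "card I = 3 \<Longrightarrow> urn_average I (\<lambda>_. 1) m = 1"
proof (induction m)
  case (Suc m)
  then show ?case using urn_average_step[of I "\<lambda>_. 1" m] by simp
qed (rule urn_average_0)

text \<open>
Every edge carries at most \<open>urn_mass m\<close>, and all edges out of level \<open>m\<close> together carry \<open>1\<close>.
\<close>

lemma urn_energy_le:
  assumes I: "card I = 3"
  shows "(\<Sum>e\<in>layer I m \<times> I. (urn_flow e)\<^sup>2) \<le> urn_mass m"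
proof -
  have mass: "urn_mass m \<ge> 0" unfolding urn_mass_def by simp
  have finI: "finite I" using I by (simp add: card_ge_0_finite)
  have "(\<Sum>e\<in>layer I m \<times> I. (urn_flow e)\<^sup>2) \<le> (\<Sum>e\<in>layer I m \<times> I. urn_mass m * urn_flow e)"
  proof (rule sum_mono)
    fix e assume "e \<in> layer I m \<times> I"
    then obtain \<xi> i where e: "e = (\<xi>, i)" "\<xi> \<in> layer I m" "i \<in> I" by blast
    have "urn_flow e \<le> (\<Sum>i\<in>I. urn_flow (\<xi>, i))"
      unfolding e(1) using e(3) finI urn_flow_nonneg by (intro member_le_sum) auto
    then have "urn_flow e \<le> urn_mass m" using urn_flow_out[OF I e(2)] by simp
    then show "(urn_flow e)\<^sup>2 \<le> urn_mass m * urn_flow e"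
      unfolding power2_eq_square using urn_flow_nonneg by (intro mult_right_mono)
  qed
  also have "\<dots> = urn_mass m * (\<Sum>\<xi>\<in>layer I m. \<Sum>i\<in>I. urn_flow (\<xi>, i))"
    unfolding sum.cartesian_product by (simp add: sum_distrib_left case_prod_unfold)
  also have "(\<Sum>\<xi>\<in>layer I m. \<Sum>i\<in>I. urn_flow (\<xi>, i)) = urn_average I (\<lambda>_. 1) m"
    unfolding urn_average_def by (simp add: urn_flow_out[OF I])
  finally show ?thesis unfolding urn_total_mass[OF I] by simp
qed

text \<open>
The flow of the urn has finite energy because the masses \<open>urn_mass m\<close> sum to \<open>2\<close>. It has source \<open>0\<close> and no sink,
as the averages of a finitely supported function over the levels start at \<open>f 0\<close> and are eventually \<open>0\<close>.
\<close>

lemma transient_three_free_coordinates: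
  assumes I: "card I = 3" and flat: "\<And>\<xi> m. \<xi> \<in> layer I m \<Longrightarrow> gibbs \<xi> = 1"
  shows "transient_on rate (state_space \<beta> E)"
proof (rule transient_if_finite_resistance)
  define T where "T = {(\<xi>, i). \<xi> \<in> layer I (population \<xi>) \<and> i \<in> I}"
  define TM where "TM M = (SIGMA m:{..<M}. layer I m \<times> I)" for M
  have finI: "finite I" using I by (simp add: card_ge_0_finite)
  have layer_pop: "\<xi> \<in> layer I m \<Longrightarrow> population \<xi> = m" for \<xi> m by (simp add: layer_def)
  have conductance1: "conductance (fst e) (fst e + axis (snd e) 1) = 1" if "e \<in> T" for e
    using that flat[OF layer_up] unfolding conductance_up T_def by (auto simp del: One_nat_def)
  have inj_TM: "inj_on snd (TM M)" for M
    unfolding TM_def inj_on_def by (auto dest: layer_pop)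
  have TM_T: "snd ` TM M \<subseteq> T" for M unfolding TM_def T_def by (auto simp: layer_def)
  have fin_TM: "finite (TM M)" for M unfolding TM_def by (intro finite_SigmaI finite_lessThan finite_layer finI)
  show "finite_resistance 0"
  proof (rule finite_resistance_if_flow[where T = T and \<theta> = urn_flow and src = fst
        and dst = "\<lambda>e. fst e + axis (snd e) 1" and R = 2])
    fix f :: "nat^'v \<Rightarrow> real" assume "finite {x. f x \<noteq> 0}"
    then have "finite (population ` {x. f x \<noteq> 0})" by (rule finite_imageI)
    then obtain M where "population ` {x. f x \<noteq> 0} \<subseteq> {..<M}" unfolding finite_nat_iff_bounded by blast
    then have M: "population \<xi> < M" if "f \<xi> \<noteq> 0" for \<xi> using that by auto
    have "urn_average I f M = 0"
      unfolding urn_average_def using M layer_pop by (intro sum.neutral) fastforce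
    then have "f 0 = (\<Sum>m<M. urn_average I f m - urn_average I f (Suc m))"
      using sum_lessThan_telescope'[of "urn_average I f" M] by (simp add: urn_average_0)
    also have "\<dots> = (\<Sum>m<M. \<Sum>e\<in>layer I m \<times> I. urn_flow e * (f (fst e) - f (fst e + axis (snd e) 1)))"
      unfolding urn_average_step[OF I] by (simp add: case_prod_unfold)
    also have "\<dots> = (\<Sum>(m, e)\<in>TM M. urn_flow e * (f (fst e) - f (fst e + axis (snd e) 1)))"
      unfolding TM_def using finI by (intro sum.Sigma) auto
    also have "\<dots> = (\<Sum>e\<in>snd ` TM M. urn_flow e * (f (fst e) - f (fst e + axis (snd e) 1)))"
      by (subst sum.reindex[OF inj_TM]) (simp add: case_prod_unfold)
    finally show "\<exists>P. finite P \<and> P \<subseteq> T \<and> f 0 = (\<Sum>e\<in>P. urn_flow e * (f (fst e) - f (fst e + axis (snd e) 1)))"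
      using TM_T by (intro exI[of _ "snd ` TM M"] conjI finite_imageI fin_TM)
  next
    fix P assume P: "finite P" "P \<subseteq> T"
    then have "finite ((\<lambda>e. population (fst e)) ` P)" by (intro finite_imageI)
    then obtain M where "(\<lambda>e. population (fst e)) ` P \<subseteq> {..<M}" unfolding finite_nat_iff_bounded by blast
    then have M: "population (fst e) < M" if "e \<in> P" for e using that by auto
    have "P \<subseteq> snd ` TM M"
    proof
      fix e assume e: "e \<in> P"
      then have "(population (fst e), e) \<in> TM M"
        using P(2) M[OF e] unfolding TM_def T_def by auto
      then show "e \<in> snd ` TM M" by force
    qed
    have "(\<Sum>e\<in>P. (urn_flow e)\<^sup>2 / conductance (fst e) (fst e + axis (snd e) 1)) = (\<Sum>e\<in>P. (urn_flow e)\<^sup>2)"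
      using P(2) conductance1 by (intro sum.cong) auto
    also have "\<dots> \<le> (\<Sum>e\<in>snd ` TM M. (urn_flow e)\<^sup>2)"
      using \<open>P \<subseteq> snd ` TM M\<close> fin_TM by (intro sum_mono2) auto
    also have "\<dots> = (\<Sum>(m, e)\<in>TM M. (urn_flow e)\<^sup>2)"
      by (subst sum.reindex[OF inj_TM]) (simp add: case_prod_unfold)
    also have "\<dots> = (\<Sum>m<M. \<Sum>e\<in>layer I m \<times> I. (urn_flow e)\<^sup>2)"
      unfolding TM_def using finI by (intro sum.Sigma[symmetric]) auto
    also have "\<dots> \<le> (\<Sum>m<M. urn_mass m)" by (intro sum_mono urn_energy_le I)
    also have "\<dots> = (\<Sum>m<M. 2 / real (m + 1) - 2 / real (Suc m + 1))"
      by (intro sum.cong refl) (simp add: urn_mass_def field_simps)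
    also have "\<dots> = 2 - 2 / real (M + 1)"
      by (subst sum_lessThan_telescope') simp
    also have "\<dots> \<le> 2" by simp
    finally show "(\<Sum>e\<in>P. (urn_flow e)\<^sup>2 / conductance (fst e) (fst e + axis (snd e) 1)) \<le> 2" .
  next
    show "inj_on (\<lambda>e. (fst e, fst e + axis (snd e) 1)) T"
      by (rule inj_onI) (auto simp: prod_eq_iff axis_inject_nat simp del: One_nat_def)
  qed (simp add: conductance1 del: One_nat_def)
qed

lemma interaction_layer:
  assumes "\<xi> \<in> layer I m" and "independent_set E I"
  shows "interaction \<xi> = 0"
proof -
  have "\<xi> $ i * \<xi> $ j = 0" if "E i j" for i j
  proof -
    have "i \<notin> I \<or> j \<notin> I" using assms(2) that unfolding independent_set_def by blast
    then show ?thesis using assms(1) unfolding layer_def by auto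
  qed
  then show ?thesis unfolding interaction_def by (intro sum.neutral ballI) blast
qed

lemma transient_independent_triple:
  assumes alpha: "\<alpha> = 0" and kappa: "independence_number E \<ge> 3"
  shows "transient_on rate (state_space \<beta> E)"
proof -
  have "independence_number E \<in> card ` {S. independent_set E S}"
    unfolding independence_number_def
    by (rule Max_in) (auto simp: independent_set_def intro: exI[of _ "{}"])
  then obtain S where indep: "independent_set E S" "independence_number E = card S" by blast
  have large: "3 \<le> card S" using kappa unfolding indep(2) .
  obtain I where I: "I \<subseteq> S" "card I = 3"
    by (rule obtain_subset_with_card_n[OF large])
  have "independent_set E I" using indep(1) I(1) unfolding independent_set_def by blast
  then have "gibbs \<xi> = 1" if "\<xi> \<in> layer I m" for \<xi> m
    unfolding gibbs_def using interaction_layer[OF that] alpha by simp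
  then show ?thesis by (rule transient_three_free_coordinates[OF I(2)])
qed

lemma transient_free:
  assumes alpha: "\<alpha> = 0" and beta: "\<beta> = 0" and card: "CARD('v) \<ge> 3"
  shows "transient_on rate (state_space \<beta> E)"
proof -
  obtain I :: "'v set" where I: "card I = 3" by (rule obtain_subset_with_card_n[OF card])
  have "boltzmann = 1" using beta by (simp add: exp_ereal_def zero_ereal_def)
  then have "gibbs \<xi> = 1" for \<xi> unfolding gibbs_def using alpha by simp
  then show ?thesis using transient_three_free_coordinates[OF I] by blast
qed

lemma independence_number_no_edges:
  assumes "\<And>i j. \<not> E i j" shows "independence_number E \<ge> CARD('v)"
  using independence_number_ge[of UNIV] assms unfolding independent_set_def by simp

lemma edge_count_pos_iff: "edge_count E > 0 \<longleftrightarrow> (\<exists>i j. E i j)"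
proof -
  have "edge_set E = {} \<longleftrightarrow> (\<forall>i j. \<not> E i j)" unfolding edge_set_def by auto
  then show ?thesis unfolding edge_count_def by (auto simp: card_gt_0_iff)
qed

end

theorem theorem2p3:
  fixes E :: "'v::finite \<Rightarrow> 'v \<Rightarrow> bool" and \<alpha> :: real and \<beta> :: ereal
  assumes graph: "simple_graph E" and beta: "\<beta> < \<infinity>"
  defines "n \<equiv> CARD('v)"
    and "lam \<equiv> largest_eigenvalue (adjacency_matrix E)"
    and "\<kappa> \<equiv> independence_number E"
    and "e \<equiv> edge_count E"
    and "q \<equiv> transition_rate \<alpha> \<beta> E"
    and "S \<equiv> state_space \<beta> E"
  defines "case_i \<equiv> \<alpha> < 0 \<and> ereal \<alpha> + \<beta> * ereal lam < 0"
    and "case_ii \<equiv>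
        (\<alpha> = 0 \<and> \<beta> < 0 \<and> \<kappa> \<le> 2) \<or>
        (\<alpha> = 0 \<and> \<beta> = 0 \<and> n \<le> 2) \<or>
        (\<alpha> = 0 \<and> \<beta> > 0 \<and> e = 0 \<and> n \<le> 2)"
    and "case_iii \<equiv>
        (\<alpha> > 0) \<or>
        (\<alpha> = 0 \<and> \<beta> > 0 \<and> e > 0) \<or>
        (\<alpha> = 0 \<and> \<beta> > 0 \<and> e = 0 \<and> n \<ge> 3) \<or>
        (\<alpha> = 0 \<and> \<beta> = 0 \<and> n \<ge> 3) \<or>
        (\<alpha> = 0 \<and> \<beta> < 0 \<and> \<kappa> \<ge> 3) \<or>
        (\<alpha> < 0 \<and> ereal \<alpha> + \<beta> * ereal lam \<ge> 0)"
  shows "(case_i \<longrightarrow> positive_recurrent_on q S) \<and>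
         (case_ii \<longrightarrow> null_recurrent_on q S) \<and>
         (case_iii \<longrightarrow> transient_on q S) \<and>
         (case_iii \<longleftrightarrow> \<not> case_i \<and> \<not> case_ii)"
proof -
  interpret graph_chain E \<alpha> \<beta> using graph beta by unfold_locales
  have no_edges: "e = 0 \<longleftrightarrow> (\<forall>i j. \<not> E i j)" unfolding e_def using edge_count_pos_iff by auto
  have "positive_recurrent_on q S" if case_i
    unfolding q_def S_def using that positive_recurrent_subcritical
    unfolding case_i_def lam_def by blast
  moreover have "null_recurrent_on q S" if case_ii
    unfolding q_def S_def using that null_recurrent_repulsive null_recurrent_free no_edges
    unfolding case_ii_def \<kappa>_def n_def by blast
  moreover have "transient_on q S" if case_iii
  proof -
    have "transient_on q S" if "\<alpha> = 0" "e = 0" "n \<ge> 3"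
    proof -
      have "independence_number E \<ge> 3"
        using that no_edges independence_number_no_edges unfolding n_def by (meson order_trans)
      then show ?thesis unfolding q_def S_def using that(1) by (intro transient_independent_triple)
    qed
    moreover have "transient_on q S" if "\<alpha> = 0" "\<beta> > 0" "e > 0"
      using that edge_count_pos_iff transient_attractive_edge unfolding q_def S_def e_def by blast
    ultimately show ?thesis
      using that transient_alpha_positive transient_free transient_independent_triple transient_supercritical
      unfolding case_iii_def q_def S_def n_def \<kappa>_def lam_def by blast
  qed
  moreover have "case_iii \<longleftrightarrow> \<not> case_i \<and> \<not> case_ii"
  proof -
    have "\<alpha> < 0 \<or> \<alpha> = 0 \<or> \<alpha> > 0" "\<beta> < 0 \<or> \<beta> = 0 \<or> \<beta> > 0" by auto
    then show ?thesis
      unfolding case_i_def case_ii_def case_iii_def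
      by (elim disjE) (auto simp: not_le not_less)
  qed
  ultimately show ?thesis by blast
qed

end
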